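(* Let $P$ be a topologically finitely generated pro-$p$ group and $M$ a finite $P$-module. Then $\varphi^1:H^1_c(P,M)\to H^1_d(P,M)$ and $\varphi_1:H_1^d(P,M)\to H_1^c(P,M)$ are isomorphisms.
   Context: For a profinite group $G$ and discrete $G$-module $M$, $H^q_c$ is continuous cohomology (continuous cochains), $H^q_d$ abstract group cohomology (all cochains), and $\varphi^q$ the map induced by inclusion of cochains. For a profinite $G$-module $M$, $H_q^d$ is abstract group homology, $H_q^c$ is profinite homology (profinite projective resolution over $\hat{\mathbb{Z}}[[G]]$ with completed tensor product), and $\varphi_q:H_q^d\to H_q^c$ is induced by a comparison chain map. Finite modules are regarded as both discrete and profinite. *)

theory Defs
  imports "HOL-Analysis.Analysis" "HOL-Algebra.Algebra"
begin

definition profinite_group :: "'a monoid \<Rightarrow> 'a topology \<Rightarrow> bool" where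
  "profinite_group G T \<longleftrightarrow>
     group G \<and> topspace T = carrier G \<and>
     compact_space T \<and> Hausdorff_space T \<and>
     (\<forall>x\<in>topspace T. connected_component_of_set T x = {x}) \<and>
     continuous_map (prod_topology T T) T (\<lambda>x. fst x \<otimes>\<^bsub>G\<^esub> snd x) \<and>
     continuous_map T T (\<lambda>x. inv\<^bsub>G\<^esub> x)"

definition pro_p_group :: "nat \<Rightarrow> 'a monoid \<Rightarrow> 'a topology \<Rightarrow> bool" where
  "pro_p_group p G T \<longleftrightarrow>
     Factorial_Ring.prime p \<and> profinite_group G T \<and>
     (\<forall>U. openin T U \<and> U \<lhd> G \<longrightarrow> (\<exists>k. card (rcosets\<^bsub>G\<^esub> U) = p ^ k))"

definition topologically_finitely_generated :: "'a monoid \<Rightarrow> 'a topology \<Rightarrow> bool" where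
  "topologically_finitely_generated G T \<longleftrightarrow>
     (\<exists>S. finite S \<and> S \<subseteq> carrier G \<and> T closure_of (generate G S) = carrier G)"

definition finite_G_module :: "'a monoid \<Rightarrow> 'a topology \<Rightarrow> ('a \<Rightarrow> 'm::{finite,ab_group_add} \<Rightarrow> 'm) \<Rightarrow> bool" where
  "finite_G_module G T act \<longleftrightarrow>
     (\<forall>g\<in>carrier G. \<forall>x y. act g (x + y) = act g x + act g y) \<and>
     (\<forall>x. act \<one>\<^bsub>G\<^esub> x = x) \<and>
     (\<forall>g\<in>carrier G. \<forall>h\<in>carrier G. \<forall>x. act (g \<otimes>\<^bsub>G\<^esub> h) x = act g (act h x)) \<and>
     continuous_map (prod_topology T (discrete_topology UNIV)) (discrete_topology UNIV)
        (\<lambda>x. act (fst x) (snd x))"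

definition cochains1 :: "'a monoid \<Rightarrow> ('a \<Rightarrow> 'm::ab_group_add) set" where
  "cochains1 G = {f. \<forall>x. x \<notin> carrier G \<longrightarrow> f x = 0}"

definition cocycles1_d :: "'a monoid \<Rightarrow> ('a \<Rightarrow> 'm \<Rightarrow> 'm) \<Rightarrow> ('a \<Rightarrow> 'm::ab_group_add) set" where
  "cocycles1_d G act = {f \<in> cochains1 G. \<forall>g\<in>carrier G. \<forall>h\<in>carrier G.
      act g (f h) - f (g \<otimes>\<^bsub>G\<^esub> h) + f g = 0}"

definition cocycles1_c :: "'a monoid \<Rightarrow> 'a topology \<Rightarrow> ('a \<Rightarrow> 'm \<Rightarrow> 'm) \<Rightarrow> ('a \<Rightarrow> 'm::ab_group_add) set" where
  "cocycles1_c G T act = {f \<in> cocycles1_d G act. continuous_map T (discrete_topology UNIV) f}"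

text \<open>1-coboundaries: image of d^0 m = (g \<mapsto> g m - m) (0-cochains = M, all continuous).\<close>
definition coboundaries1 :: "'a monoid \<Rightarrow> ('a \<Rightarrow> 'm \<Rightarrow> 'm) \<Rightarrow> ('a \<Rightarrow> 'm::ab_group_add) set" where
  "coboundaries1 G act = {(\<lambda>g. if g \<in> carrier G then act g m - m else 0) | m. True}"

definition coh_class :: "'a monoid \<Rightarrow> ('a \<Rightarrow> 'm \<Rightarrow> 'm) \<Rightarrow> ('a \<Rightarrow> 'm::ab_group_add) \<Rightarrow> ('a \<Rightarrow> 'm) set" where
  "coh_class G act f = {(\<lambda>x. f x + b x) | b. b \<in> coboundaries1 G act}"

definition H1_d :: "'a monoid \<Rightarrow> ('a \<Rightarrow> 'm \<Rightarrow> 'm) \<Rightarrow> ('a \<Rightarrow> 'm::ab_group_add) set set" where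
  "H1_d G act = coh_class G act ` cocycles1_d G act"

definition H1_c :: "'a monoid \<Rightarrow> 'a topology \<Rightarrow> ('a \<Rightarrow> 'm \<Rightarrow> 'm) \<Rightarrow> ('a \<Rightarrow> 'm::ab_group_add) set set" where
  "H1_c G T act = coh_class G act ` cocycles1_c G T act"

text \<open>phi^1 : H^1_c \<rightarrow> H^1_d, induced by the inclusion of cochains.\<close>
definition phi_up1 :: "'a monoid \<Rightarrow> ('a \<Rightarrow> 'm \<Rightarrow> 'm) \<Rightarrow> ('a \<Rightarrow> 'm::ab_group_add) set \<Rightarrow> ('a \<Rightarrow> 'm) set" where
  "phi_up1 G act Y = coh_class G act (SOME y. y \<in> Y)"

section \<open>First abstract homology (bar complex  Z[G^n] \<otimes> M)\<close>

definition chains1 :: "'a monoid \<Rightarrow> ('a \<Rightarrow> 'm::ab_group_add) set" where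
  "chains1 G = {c. finite {g. c g \<noteq> 0} \<and> {g. c g \<noteq> 0} \<subseteq> carrier G}"

definition chains2 :: "'a monoid \<Rightarrow> ('a \<times> 'a \<Rightarrow> 'm::ab_group_add) set" where
  "chains2 G = {c. finite {x. c x \<noteq> 0} \<and> {x. c x \<noteq> 0} \<subseteq> carrier G \<times> carrier G}"

definition hd1 :: "'a monoid \<Rightarrow> ('a \<Rightarrow> 'm \<Rightarrow> 'm) \<Rightarrow> ('a \<Rightarrow> 'm::ab_group_add) \<Rightarrow> 'm" where
  "hd1 G act c = (\<Sum>g\<in>{g. c g \<noteq> 0}. act (inv\<^bsub>G\<^esub> g) (c g) - c g)"

text \<open>d_2 ((g,h) \<otimes> m) = h \<otimes> g^{-1} m - gh \<otimes> m + g \<otimes> m\<close>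
definition hd2 :: "'a monoid \<Rightarrow> ('a \<Rightarrow> 'm \<Rightarrow> 'm) \<Rightarrow> ('a \<times> 'a \<Rightarrow> 'm::ab_group_add) \<Rightarrow> ('a \<Rightarrow> 'm)" where
  "hd2 G act c = (\<lambda>h. (\<Sum>g\<in>{g. c (g, h) \<noteq> 0}. act (inv\<^bsub>G\<^esub> g) (c (g, h)))
                      - (\<Sum>x\<in>{x. c x \<noteq> 0 \<and> fst x \<otimes>\<^bsub>G\<^esub> snd x = h}. c x)
                      + (\<Sum>b\<in>{b. c (h, b) \<noteq> 0}. c (h, b)))"

definition hom_class_d :: "'a monoid \<Rightarrow> ('a \<Rightarrow> 'm \<Rightarrow> 'm) \<Rightarrow> ('a \<Rightarrow> 'm::ab_group_add) \<Rightarrow> ('a \<Rightarrow> 'm) set" where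
  "hom_class_d G act z = {(\<lambda>x. z x + b x) | b. b \<in> hd2 G act ` chains2 G}"

definition H1_hom_d :: "'a monoid \<Rightarrow> ('a \<Rightarrow> 'm \<Rightarrow> 'm) \<Rightarrow> ('a \<Rightarrow> 'm::ab_group_add) set set" where
  "H1_hom_d G act = hom_class_d G act ` {c \<in> chains1 G. hd1 G act c = 0}"

section \<open>First profinite homology (profinite bar complex  Zhat[[G^n]] \<hat>\<otimes> M)\<close>

text \<open>For a finite module M and a profinite space X, Zhat[[X]] \<hat>\<otimes> M is the group of
  finitely additive M-valued measures on the clopen subsets of X.\<close>
definition clopen_measures :: "'x topology \<Rightarrow> ('x set \<Rightarrow> 'm::ab_group_add) set" where
  "clopen_measures Y = {\<mu>. (\<forall>A. \<mu> A \<noteq> 0 \<longrightarrow> openin Y A \<and> closedin Y A) \<and>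
     (\<forall>A B. openin Y A \<and> closedin Y A \<and> openin Y B \<and> closedin Y B \<and> A \<inter> B = {}
        \<longrightarrow> \<mu> (A \<union> B) = \<mu> A + \<mu> B)}"

text \<open>Integral over A of a locally constant End(M)-valued function against \<mu>.\<close>
definition mint :: "('x set \<Rightarrow> 'm::{finite,ab_group_add}) \<Rightarrow> ('x \<Rightarrow> 'm \<Rightarrow> 'm) \<Rightarrow> 'x set \<Rightarrow> 'm" where
  "mint \<mu> \<phi> A = (\<Sum>e\<in>\<phi> ` A. e (\<mu> {x\<in>A. \<phi> x = e}))"

definition cd1 :: "'a monoid \<Rightarrow> ('a \<Rightarrow> 'm \<Rightarrow> 'm) \<Rightarrow> ('a set \<Rightarrow> 'm::{finite,ab_group_add}) \<Rightarrow> 'm" where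
  "cd1 G act \<mu> = mint \<mu> (\<lambda>g. act (inv\<^bsub>G\<^esub> g)) (carrier G) - \<mu> (carrier G)"

definition cd2 :: "'a monoid \<Rightarrow> 'a topology \<Rightarrow> ('a \<Rightarrow> 'm \<Rightarrow> 'm)
                    \<Rightarrow> (('a \<times> 'a) set \<Rightarrow> 'm::{finite,ab_group_add}) \<Rightarrow> ('a set \<Rightarrow> 'm)" where
  "cd2 G T act \<nu> = (\<lambda>B. if openin T B \<and> closedin T B then
       mint \<nu> (\<lambda>x. act (inv\<^bsub>G\<^esub> (fst x))) {x \<in> carrier G \<times> carrier G. snd x \<in> B}
       - \<nu> {x \<in> carrier G \<times> carrier G. fst x \<otimes>\<^bsub>G\<^esub> snd x \<in> B}
       + \<nu> {x \<in> carrier G \<times> carrier G. fst x \<in> B}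
     else 0)"

definition hom_class_c :: "'a monoid \<Rightarrow> 'a topology \<Rightarrow> ('a \<Rightarrow> 'm \<Rightarrow> 'm)
                    \<Rightarrow> ('a set \<Rightarrow> 'm::{finite,ab_group_add}) \<Rightarrow> ('a set \<Rightarrow> 'm) set" where
  "hom_class_c G T act z =
     {(\<lambda>A. z A + b A) | b. b \<in> cd2 G T act ` clopen_measures (prod_topology T T)}"

definition H1_hom_c :: "'a monoid \<Rightarrow> 'a topology \<Rightarrow> ('a \<Rightarrow> 'm \<Rightarrow> 'm)
                    \<Rightarrow> ('a set \<Rightarrow> 'm::{finite,ab_group_add}) set set" where
  "H1_hom_c G T act = hom_class_c G T act ` {\<mu> \<in> clopen_measures T. cd1 G act \<mu> = 0}"

text \<open>Comparison chain map in degree 1:  Z[G] \<otimes> M \<rightarrow> Zhat[[G]] \<hat>\<otimes> M  (sum of Dirac measures).\<close>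
definition dirac1 :: "'a topology \<Rightarrow> ('a \<Rightarrow> 'm::ab_group_add) \<Rightarrow> ('a set \<Rightarrow> 'm)" where
  "dirac1 T c = (\<lambda>A. if openin T A \<and> closedin T A then (\<Sum>g\<in>{g\<in>A. c g \<noteq> 0}. c g) else 0)"

definition phi_low1 :: "'a monoid \<Rightarrow> 'a topology \<Rightarrow> ('a \<Rightarrow> 'm \<Rightarrow> 'm)
                    \<Rightarrow> ('a \<Rightarrow> 'm::{finite,ab_group_add}) set \<Rightarrow> ('a set \<Rightarrow> 'm) set" where
  "phi_low1 G T act Y = hom_class_c G T act (dirac1 T (SOME c. c \<in> Y))"

end

theory Submission
  imports Defs "HOL-Library.Function_Algebras"
begin

text \<open>
  Let \<open>U\<close> be the (open, normal) kernel of the action and \<open>n = |M|\<close>. The key point, a case of Serre's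
  theorem, is that the abstract subgroup \<open>V\<close> generated by the \<open>n\<close>-th powers and commutators of \<open>U\<close> is
  open. By Schreier's lemma \<open>U\<close> is topologically generated by some \<open>x\<^sub>1, \<dots>, x\<^sub>d\<close>. In a nilpotent group
  generated by these elements every product of commutators has the form
  \<open>[u\<^sub>1, x\<^sub>1] \<cdots> [u\<^sub>d, x\<^sub>d]\<close>; the set of such products in \<open>U\<close> is compact, and finite p-groups are nilpotent,
  so it equals the abstract derived subgroup. Hence \<open>V\<close> is compact, and \<open>U/V\<close> is abelian of exponent
  dividing \<open>n\<close> with a finite dense subgroup, so \<open>V\<close> has finite index.

  A cocycle restricts to a homomorphism \<open>U \<rightarrow> M\<close>, which kills \<open>V\<close>; so it is constant on the cosets of \<open>V\<close>
  and therefore continuous. Dually, \<open>u \<mapsto> u \<otimes> m\<close> is a homomorphism from \<open>U\<close> into 1-chains modulo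
  boundaries, so \<open>g \<otimes> m\<close> depends modulo boundaries only on the coset of \<open>g\<close>. Evaluating a measure on
  the cosets of \<open>V\<close> then gives an inverse of the Dirac map. That a measure differs from its
  discretization by a continuous boundary holds on every finite family of clopen sets, and follows
  in general from the compactness of the space of measures.
\<close>

section \<open>Commutators in nilpotent groups\<close>

text \<open>An abstract cocycle carries no continuity, so it is only known to kill actual products
  of powers and commutators, not limits of them. The subgroup \<open>V\<close> must therefore be
  open without any closure being taken. Compactness replaces closure, and for this the number of
  commutator factors must be bounded uniformly over all finite quotients. This is what the shape
  [u_1, x_1] ... [u_d, x_d] achieves: \<open>d\<close> counts generators, while the nilpotency class
  of the quotients, for which no bound is available, only affects the number of correction steps.

  Passing to the kernel of the action turns cocycles into homomorphisms; the price is that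
  topological generators of this kernel have to be found. The exponent |M| is chosen because it
  annihilates the module, and it does so in both halves: it kills the values of a cocycle, and also
  u \<otimes> m for every \<open>u\<close>, since |M| m = 0. Hence one and the same \<open>V\<close>
  serves cohomology and homology.\<close>

definition commutator :: "('a, 'b) monoid_scheme \<Rightarrow> 'a \<Rightarrow> 'a \<Rightarrow> 'a" where
  "commutator G g x = g \<otimes>\<^bsub>G\<^esub> x \<otimes>\<^bsub>G\<^esub> inv\<^bsub>G\<^esub> g \<otimes>\<^bsub>G\<^esub> inv\<^bsub>G\<^esub> x"

primrec lower_central :: "('a, 'b) monoid_scheme \<Rightarrow> nat \<Rightarrow> 'a set" where
  "lower_central G 0 = carrier G"
| "lower_central G (Suc k) =
     generate G {commutator G g y | g y. g \<in> lower_central G k \<and> y \<in> carrier G}"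

text \<open>The list fixes the order of the factors, since the set need not be a subgroup. The first
  entries range over a parameter \<open>H\<close> because the nilpotency argument uses both the
  carrier and, in a quotient, the image of a term of the lower central series.\<close>

primrec comm_products :: "('a, 'b) monoid_scheme \<Rightarrow> 'a set \<Rightarrow> 'a list \<Rightarrow> 'a set" where
  "comm_products G H [] = {\<one>\<^bsub>G\<^esub>}"
| "comm_products G H (x # xs) =
     {commutator G g x \<otimes>\<^bsub>G\<^esub> c | g c. g \<in> H \<and> c \<in> comm_products G H xs}"

context group
begin

lemma commutator_closed [simp, intro]:
  "g \<in> carrier G \<Longrightarrow> x \<in> carrier G \<Longrightarrow> commutator G g x \<in> carrier G"
  by (simp add: commutator_def)

lemma commutator_one_left [simp]: "x \<in> carrier G \<Longrightarrow> commutator G \<one> x = \<one>"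
  by (simp add: commutator_def)

lemma commutator_one_right [simp]: "x \<in> carrier G \<Longrightarrow> commutator G x \<one> = \<one>"
  by (simp add: commutator_def)

lemma commutator_mult_swap:
  assumes "g \<in> carrier G" "x \<in> carrier G"
  shows "commutator G g x \<otimes> (x \<otimes> g) = g \<otimes> x"
proof -
  have "inv g \<otimes> (inv x \<otimes> (x \<otimes> g)) = \<one>"
    using assms by (metis inv_closed l_inv l_one m_assoc)
  then show ?thesis using assms by (simp add: commutator_def m_assoc)
qed

lemma commutator_eq_one_iff:
  assumes "g \<in> carrier G" "x \<in> carrier G"
  shows "commutator G g x = \<one> \<longleftrightarrow> g \<otimes> x = x \<otimes> g"
  using commutator_mult_swap[OF assms] assms
  by (metis commutator_closed l_one m_closed one_closed r_cancel)

text \<open>In general [gh, x] = g [h, x] g^-1 [g, x]; centrality of [h, x] removes the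
  conjugation.\<close>

lemma commutator_mult_left:
  assumes "g \<in> carrier G" "h \<in> carrier G" "x \<in> carrier G"
    and central: "\<And>y. y \<in> carrier G \<Longrightarrow> commutator G h x \<otimes> y = y \<otimes> commutator G h x"
  shows "commutator G (g \<otimes> h) x = commutator G g x \<otimes> commutator G h x"
proof -
  have "commutator G (g \<otimes> h) x \<otimes> (x \<otimes> g \<otimes> h) = g \<otimes> (h \<otimes> x)"
    using commutator_mult_swap[of "g \<otimes> h" x] assms by (simp add: m_assoc)
  also have "\<dots> = g \<otimes> (commutator G h x \<otimes> (x \<otimes> h))"
    using commutator_mult_swap[of h x] assms by simp
  also have "\<dots> = commutator G h x \<otimes> (g \<otimes> x) \<otimes> h"
    using central[of g] assms by (metis commutator_closed m_assoc m_closed)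
  also have "\<dots> = commutator G h x \<otimes> (commutator G g x \<otimes> (x \<otimes> g)) \<otimes> h"
    using commutator_mult_swap[of g x] assms by simp
  also have "\<dots> = commutator G g x \<otimes> commutator G h x \<otimes> (x \<otimes> g \<otimes> h)"
    using central[of "commutator G g x"] assms by (simp add: m_assoc[symmetric])
  finally show ?thesis using assms by simp
qed

text \<open>In general [g, xy] = [g, x] x [g, y] x^-1, so here [g, y] has to be central.\<close>

lemma commutator_mult_right:
  assumes "g \<in> carrier G" "x \<in> carrier G" "y \<in> carrier G"
    and central: "\<And>w. w \<in> carrier G \<Longrightarrow> commutator G g y \<otimes> w = w \<otimes> commutator G g y"
  shows "commutator G g (x \<otimes> y) = commutator G g x \<otimes> commutator G g y"
proof -
  have "commutator G g (x \<otimes> y) \<otimes> (x \<otimes> y \<otimes> g) = g \<otimes> x \<otimes> y"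
    using commutator_mult_swap[of g "x \<otimes> y"] assms by (simp add: m_assoc)
  also have "\<dots> = commutator G g x \<otimes> (x \<otimes> g) \<otimes> y"
    using commutator_mult_swap[of g x] assms by simp
  also have "\<dots> = commutator G g x \<otimes> x \<otimes> (g \<otimes> y)"
    using assms by (simp add: m_assoc)
  also have "\<dots> = commutator G g x \<otimes> x \<otimes> (commutator G g y \<otimes> (y \<otimes> g))"
    using commutator_mult_swap[of g y] assms by simp
  also have "\<dots> = commutator G g x \<otimes> (x \<otimes> commutator G g y) \<otimes> (y \<otimes> g)"
    using assms by (simp add: m_assoc)
  also have "\<dots> = commutator G g x \<otimes> commutator G g y \<otimes> (x \<otimes> y \<otimes> g)"
    using central[of x] assms by (metis commutator_closed m_assoc m_closed)
  finally show ?thesis using assms by simp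
qed

lemma lower_central_subset: "lower_central G k \<subseteq> carrier G"
proof (induction k)
  case (Suc k)
  then show ?case unfolding lower_central.simps by (intro generate_incl) blast
qed simp

text \<open>Conjugation sends [g, y] to the commutator of the conjugates, so by induction it maps
  the generating set of the next term into itself.\<close>

lemma lower_central_normal: "lower_central G k \<lhd> G"
proof (induction k)
  case 0
  then show ?case by (simp add: normal_self)
next
  case (Suc k)
  have conj: "h \<otimes> commutator G g y \<otimes> inv h = commutator G (h \<otimes> g \<otimes> inv h) (h \<otimes> y \<otimes> inv h)"
    if "h \<in> carrier G" "g \<in> carrier G" "y \<in> carrier G" for g y h
  proof -
    have *: "x \<otimes> inv h \<otimes> (h \<otimes> z) = x \<otimes> z" if "x \<in> carrier G" "z \<in> carrier G" for x z
      using that \<open>h \<in> carrier G\<close> by (metis inv_closed l_inv m_assoc m_closed r_one)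
    show ?thesis using that *
      by (simp add: commutator_def inv_mult_group m_assoc)
  qed
  show ?case unfolding lower_central.simps
  proof (rule normal_generateI)
    show "{commutator G g y |g y. g \<in> lower_central G k \<and> y \<in> carrier G} \<subseteq> carrier G"
      using lower_central_subset by blast
    fix h x assume "h \<in> {commutator G g y |g y. g \<in> lower_central G k \<and> y \<in> carrier G}"
      and x: "x \<in> carrier G"
    then obtain g y where gy: "h = commutator G g y" "g \<in> lower_central G k" "y \<in> carrier G" by auto
    have "x \<otimes> g \<otimes> inv x \<in> lower_central G k"
      using normal.inv_op_closed2[OF Suc x gy(2)] .
    then show "x \<otimes> h \<otimes> inv x \<in> {commutator G g y |g y. g \<in> lower_central G k \<and> y \<in> carrier G}"
      using conj[OF x, of g y] gy x lower_central_subset by blast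
  qed
qed

lemma lower_central_commutator:
  "g \<in> lower_central G k \<Longrightarrow> y \<in> carrier G \<Longrightarrow> commutator G g y \<in> lower_central G (Suc k)"
  unfolding lower_central.simps by (rule generate.incl) auto

end

lemma (in group_hom) hom_commutator:
  "g \<in> carrier G \<Longrightarrow> x \<in> carrier G \<Longrightarrow> h (commutator G g x) = commutator H (h g) (h x)"
  by (simp add: commutator_def)

lemma (in group) comm_products_subset:
  assumes "H \<subseteq> carrier G" "set xs \<subseteq> carrier G"
  shows "comm_products G H xs \<subseteq> carrier G"
  using assms by (induction xs) auto

lemma (in group_hom) comm_products_img:
  assumes K: "K \<subseteq> carrier G" and "set xs \<subseteq> carrier G"
  shows "h ` comm_products G K xs = comm_products H (h ` K) (map h xs)"
  using assms(2)
proof (induction xs)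
  case (Cons x xs)
  have sub: "comm_products G K xs \<subseteq> carrier G"
    using Cons.prems K by (intro G.comm_products_subset) auto
  have x: "x \<in> carrier G" using Cons.prems by simp
  have IH: "h ` comm_products G K xs = comm_products H (h ` K) (map h xs)" using Cons by simp
  have eq: "h (commutator G g x \<otimes>\<^bsub>G\<^esub> c) = commutator H (h g) (h x) \<otimes>\<^bsub>H\<^esub> h c"
    if "g \<in> K" "c \<in> comm_products G K xs" for g c
    using that x K sub hom_commutator by (metis G.commutator_closed hom_mult subsetD)
  have "comm_products G K (x # xs) = (\<lambda>(g, c). commutator G g x \<otimes>\<^bsub>G\<^esub> c) ` (K \<times> comm_products G K xs)"
    by auto
  moreover have "comm_products H (h ` K) (map h (x # xs)) =
      (\<lambda>(g, c). commutator H g (h x) \<otimes>\<^bsub>H\<^esub> c) ` ((h ` K) \<times> (h ` comm_products G K xs))"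
    unfolding IH by auto
  moreover have "(h ` K) \<times> (h ` comm_products G K xs) = (\<lambda>(g, c). (h g, h c)) ` (K \<times> comm_products G K xs)"
    by auto
  ultimately show ?case using eq by (auto simp: image_image intro!: image_cong)
qed simp

context group
begin

lemma one_in_comm_products:
  "\<one> \<in> H \<Longrightarrow> set xs \<subseteq> carrier G \<Longrightarrow> \<one> \<in> comm_products G H xs"
proof (induction xs)
  case (Cons x xs)
  then have "\<one> = commutator G \<one> x \<otimes> \<one>" "\<one> \<in> comm_products G H xs" by auto
  then show ?case using Cons.prems unfolding comm_products.simps by blast
qed simp

text \<open>The factors of \<open>b\<close> are central, so each slides left to the factor of
  \<open>a\<close> with the same \<open>x\<close> and merges with it by [g, x][h, x] = [gh, x].
  Allowing a different \<open>L\<close> for \<open>a\<close> is what lets a general product absorb a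
  central error term.\<close>

lemma comm_products_mult_central:
  assumes H: "H \<subseteq> carrier G" and L: "L \<subseteq> carrier G" and LH: "\<And>g h. g \<in> L \<Longrightarrow> h \<in> H \<Longrightarrow> g \<otimes> h \<in> L"
    and central: "\<And>g y z. g \<in> H \<Longrightarrow> y \<in> carrier G \<Longrightarrow> z \<in> carrier G \<Longrightarrow>
       commutator G g y \<otimes> z = z \<otimes> commutator G g y"
    and xs: "set xs \<subseteq> carrier G" and "a \<in> comm_products G L xs" "b \<in> comm_products G H xs"
  shows "a \<otimes> b \<in> comm_products G L xs"
  using assms(5-)
proof (induction xs arbitrary: a b)
  case (Cons x xs)
  obtain g c where gc: "a = commutator G g x \<otimes> c" "g \<in> L" "c \<in> comm_products G L xs"
    using Cons.prems by auto
  obtain h d where hd: "b = commutator G h x \<otimes> d" "h \<in> H" "d \<in> comm_products G H xs"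
    using Cons.prems by auto
  have car: "x \<in> carrier G" "g \<in> carrier G" "h \<in> carrier G" "c \<in> carrier G" "d \<in> carrier G"
    using gc hd H L Cons.prems comm_products_subset[OF H, of xs] comm_products_subset[OF L, of xs]
    by auto
  have "a \<otimes> b = commutator G g x \<otimes> (c \<otimes> commutator G h x) \<otimes> d"
    using gc hd car by (simp add: m_assoc)
  also have "\<dots> = commutator G g x \<otimes> (commutator G h x \<otimes> c) \<otimes> d"
    using central[of h x c] hd car by simp
  also have "\<dots> = commutator G (g \<otimes> h) x \<otimes> (c \<otimes> d)"
    using commutator_mult_left[of g h x] central[of h x] hd car by (simp add: m_assoc)
  finally have "a \<otimes> b = commutator G (g \<otimes> h) x \<otimes> (c \<otimes> d)" .
  moreover have "c \<otimes> d \<in> comm_products G L xs" using Cons gc hd by simp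
  ultimately show ?case using LH[OF gc(2) hd(2)] by auto
qed simp

text \<open>Centrality makes the commutator bilinear on \<open>H\<close> and the carrier. Additivity
  on the right reduces an arbitrary \<open>y\<close> to the entries of \<open>xs\<close>; additivity
  on the left merges factors with equal entries.\<close>

lemma generate_commutators_central:
  assumes H: "subgroup H G"
    and central: "\<And>g y z. g \<in> H \<Longrightarrow> y \<in> carrier G \<Longrightarrow> z \<in> carrier G \<Longrightarrow>
       commutator G g y \<otimes> z = z \<otimes> commutator G g y"
    and xs: "set xs \<subseteq> carrier G" and gen: "generate G (set xs) = carrier G"
  shows "generate G {commutator G g y | g y. g \<in> H \<and> y \<in> carrier G} \<subseteq> comm_products G H xs"
proof -
  have Hc: "H \<subseteq> carrier G" using H by (rule subgroup.subset)
  let ?L = "comm_products G H xs"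
  have mult: "a \<otimes> b \<in> ?L" if "a \<in> ?L" "b \<in> ?L" for a b
    using comm_products_mult_central[OF Hc Hc _ central xs that] H
    by (simp add: subgroup.m_closed)
  have one: "\<one> \<in> ?L" using one_in_comm_products[OF subgroup.one_closed[OF H] xs] .
  have single: "commutator G g x \<in> comm_products G H ys"
    if "g \<in> H" "x \<in> set ys" "set ys \<subseteq> carrier G" for g x ys
    using that(2,3)
  proof (induction ys)
    case (Cons y ys)
    have *: "\<one> \<in> H" using H by (simp add: subgroup.one_closed)
    show ?case
    proof (cases "x = y")
      case True
      then have "commutator G g x = commutator G g y \<otimes> \<one>" using that Hc Cons.prems by auto
      moreover have "\<one> \<in> comm_products G H ys" using one_in_comm_products[OF *] Cons.prems by simp
      ultimately show ?thesis using that(1) unfolding comm_products.simps by blast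
    next
      case False
      then have "commutator G g x \<in> comm_products G H ys" using Cons by auto
      moreover have "commutator G g x = commutator G \<one> y \<otimes> commutator G g x"
        using that Hc Cons.prems by (simp add: subset_iff)
      ultimately show ?thesis using * unfolding comm_products.simps by blast
    qed
  qed simp
  \<comment> \<open>Both sides are inverse to [g, x], by bilinearity in either argument; an inverted
    generator is thereby traded for an inverse in \<open>H\<close>.\<close>
  have inv_r: "commutator G g (inv x) = commutator G (inv g) x" if "g \<in> H" "x \<in> carrier G" for g x
  proof -
    have g: "g \<in> carrier G" "inv g \<in> H" using that H Hc by (auto simp: subgroup.m_inv_closed)
    have "commutator G g x \<otimes> commutator G g (inv x) = \<one>"
      using commutator_mult_right[of g x "inv x"] that g central[of g "inv x"] by simp
    moreover have "commutator G g x \<otimes> commutator G (inv g) x = \<one>"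
      using commutator_mult_left[of g "inv g" x] that g central[of "inv g" x] by simp
    ultimately show ?thesis using g that by (metis commutator_closed inv_closed l_cancel)
  qed
  have all: "y \<in> generate G (set xs) \<Longrightarrow> \<forall>g\<in>H. commutator G g y \<in> ?L" for y
  proof (induction y rule: generate.induct)
    case one
    then show ?case using \<open>\<one> \<in> ?L\<close> Hc by auto
  next
    case (incl h)
    then show ?case using single xs by blast
  next
    case (inv h)
    then show ?case using single xs inv_r H by (metis subgroup.m_inv_closed subsetD)
  next
    case (eng h1 h2)
    then have "h1 \<in> carrier G" "h2 \<in> carrier G" using gen by auto
    moreover have "commutator G g (h1 \<otimes> h2) = commutator G g h1 \<otimes> commutator G g h2" if "g \<in> H" for g
      using calculation that Hc central[OF that] by (intro commutator_mult_right) auto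
    ultimately show ?case using eng mult by simp
  qed
  have inv: "inv a \<in> ?L" if "a \<in> {commutator G g y | g y. g \<in> H \<and> y \<in> carrier G}" for a
  proof -
    obtain g y where gy: "a = commutator G g y" "g \<in> H" "y \<in> carrier G" using \<open>a \<in> _\<close> by auto
    have g: "g \<in> carrier G" "inv g \<in> H" using gy H Hc by (auto simp: subgroup.m_inv_closed)
    have "commutator G g y \<otimes> commutator G (inv g) y = \<one>"
      using commutator_mult_left[of g "inv g" y] gy g central[of "inv g" y] by simp
    then have "inv a = commutator G (inv g) y"
      using gy g by (metis commutator_closed inv_closed inv_equality inv_inv)
    then show ?thesis using all gy g gen by auto
  qed
  show ?thesis
  proof
    fix z assume "z \<in> generate G {commutator G g y | g y. g \<in> H \<and> y \<in> carrier G}"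
    then show "z \<in> ?L"
    proof (induction z rule: generate.induct)
      case (incl h)
      then show ?case using all gen by auto
    next
      case (inv h)
      then show ?case using \<open>\<And>a. a \<in> _ \<Longrightarrow> inv a \<in> ?L\<close> by blast
    qed (use one mult in auto)
  qed
qed

text \<open>Modulo the next term of the lower central series, commutators with elements of the previous
  term are central and bilinear, so the error term \<open>z\<close> can be absorbed into the factors of \<open>c\<close>.\<close>
lemma lower_central_step:
  assumes xs: "set xs \<subseteq> carrier G" and gen: "generate G (set xs) = carrier G"
    and c: "c \<in> comm_products G (carrier G) xs" and z: "z \<in> lower_central G (Suc k)"
  shows "\<exists>c' \<in> comm_products G (carrier G) xs. \<exists>z' \<in> lower_central G (Suc (Suc k)). c \<otimes> z = z' \<otimes> c'"
proof -
  \<comment> \<open>\<open>z\<close> lies in term \<open>k + 1\<close>, generated by commutators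
    [g, y] with \<open>g\<close> in term \<open>k\<close>; bracketing these once more lands in term
    \<open>k + 2\<close>, hence this \<open>K\<close>.\<close>
  define K where "K = lower_central G (Suc (Suc k))"
  have K: "K \<lhd> G" unfolding K_def by (rule lower_central_normal)
  define \<pi> where "\<pi> = (\<lambda>x. K #> x)"
  define Q where "Q = G Mod K"
  interpret Q: group Q unfolding Q_def by (rule normal.factorgroup_is_group[OF K])
  interpret pi: group_hom G Q \<pi>
    unfolding Q_def \<pi>_def using normal.r_coset_hom_Mod[OF K] normal.factorgroup_is_group[OF K]
    by (simp add: group_hom_def group_hom_axioms_def is_group)
  have surj: "\<pi> ` carrier G = carrier Q" by (simp add: \<pi>_def Q_def carrier_FactGroup)
  have \<pi>K: "\<pi> x = \<one>\<^bsub>Q\<^esub>" if "x \<in> K" for x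
    using that K unfolding \<pi>_def Q_def
    by (metis coset_join2 normal_imp_subgroup one_FactGroup subgroup.mem_carrier)
  define H where "H = \<pi> ` lower_central G k"
  have lk: "subgroup (lower_central G k) G" by (simp add: lower_central_normal normal_imp_subgroup)
  have H: "subgroup H Q" unfolding H_def by (rule pi.subgroup_img_is_subgroup[OF lk])
  have central: "commutator Q g y \<otimes>\<^bsub>Q\<^esub> w = w \<otimes>\<^bsub>Q\<^esub> commutator Q g y"
    if g: "g \<in> H" and y: "y \<in> carrier Q" and w: "w \<in> carrier Q" for g y w
  proof -
    obtain g' y' w' where *: "g = \<pi> g'" "g' \<in> lower_central G k" "y = \<pi> y'" "y' \<in> carrier G"
      "w = \<pi> w'" "w' \<in> carrier G"
      using g y w unfolding H_def surj[symmetric] by auto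
    have g': "g' \<in> carrier G" using * lower_central_subset by blast
    have "commutator G (commutator G g' y') w' \<in> K"
      unfolding K_def using * by (intro lower_central_commutator) auto
    then have "commutator Q (commutator Q g y) w = \<one>\<^bsub>Q\<^esub>"
      using \<pi>K * g' by (simp add: pi.hom_commutator[symmetric])
    then show ?thesis
      using Q.commutator_eq_one_iff[of "commutator Q g y" w] y w subgroup.mem_carrier[OF H g] by simp
  qed
  have gx: "set (map \<pi> xs) \<subseteq> carrier Q" using xs by auto
  have gq: "generate Q (set (map \<pi> xs)) = carrier Q"
    using pi.generate_img[OF xs] gen surj by simp
  have set_eq: "\<pi> ` {commutator G g y | g y. g \<in> lower_central G k \<and> y \<in> carrier G} =
      {commutator Q g y | g y. g \<in> H \<and> y \<in> carrier Q}" (is "_ ` ?A = ?B")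
  proof (intro subset_antisym subsetI)
    fix w assume "w \<in> \<pi> ` ?A"
    then obtain g y where gy: "w = \<pi> (commutator G g y)" "g \<in> lower_central G k" "y \<in> carrier G"
      by blast
    then have "w = commutator Q (\<pi> g) (\<pi> y)"
      using pi.hom_commutator[of g y] lower_central_subset by auto
    moreover have "\<pi> g \<in> H" "\<pi> y \<in> carrier Q" using gy unfolding H_def by auto
    ultimately show "w \<in> ?B" by blast
  next
    fix w assume "w \<in> ?B"
    then obtain g y where gy: "w = commutator Q g y" "g \<in> H" "y \<in> carrier Q" by blast
    then obtain g' y' where *: "g = \<pi> g'" "g' \<in> lower_central G k" "y = \<pi> y'" "y' \<in> carrier G"
      unfolding H_def surj[symmetric] by auto
    then have "w = \<pi> (commutator G g' y')"
      using pi.hom_commutator[of g' y'] lower_central_subset gy by auto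
    then show "w \<in> \<pi> ` ?A" using * by blast
  qed
  have A: "{commutator G g y | g y. g \<in> lower_central G k \<and> y \<in> carrier G} \<subseteq> carrier G"
    using lower_central_subset by blast
  have "\<pi> z \<in> generate Q {commutator Q g y | g y. g \<in> H \<and> y \<in> carrier Q}"
    using z pi.generate_img[OF A] unfolding set_eq by auto
  then have \<pi>z: "\<pi> z \<in> comm_products Q H (map \<pi> xs)"
    using Q.generate_commutators_central[OF H central gx gq] by blast
  have img: "\<pi> ` comm_products G (carrier G) xs = comm_products Q (carrier Q) (map \<pi> xs)"
    using pi.comm_products_img[of "carrier G" xs] xs surj by simp
  have "\<pi> c \<in> comm_products Q (carrier Q) (map \<pi> xs)" using c img by blast
  then have "\<pi> c \<otimes>\<^bsub>Q\<^esub> \<pi> z \<in> comm_products Q (carrier Q) (map \<pi> xs)"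
    using Q.comm_products_mult_central[of H "carrier Q" "map \<pi> xs" "\<pi> c" "\<pi> z"] H central gx \<pi>z
    by (simp add: subgroup.subset subgroup.mem_carrier)
  then obtain c' where c': "c' \<in> comm_products G (carrier G) xs" "\<pi> c \<otimes>\<^bsub>Q\<^esub> \<pi> z = \<pi> c'"
    using img by (metis imageE)
  have car: "c \<in> carrier G" "z \<in> carrier G" "c' \<in> carrier G"
    using c c' z lower_central_subset[of "Suc k"] comm_products_subset[of "carrier G" xs] xs by auto
  then have "K #> (c \<otimes> z) = K #> c'" using c'(2) \<pi>_def pi.hom_mult by metis
  then have "c \<otimes> z \<in> K #> c'"
    using car by (metis K m_closed normal_imp_subgroup rcos_self)
  then show ?thesis using c'(1) unfolding K_def r_coset_def by blast
qed

text \<open>Successive approximation: \<open>h\<close> is a product of the required form up to an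
  error in ever deeper terms of the lower central series, until nilpotency makes the error trivial.
  The number of factors never grows, since each correction is absorbed.\<close>

lemma nilpotent_derived_comm_products:
  assumes xs: "set xs \<subseteq> carrier G" and gen: "generate G (set xs) = carrier G"
    and nil: "lower_central G m \<subseteq> {\<one>}"
  shows "lower_central G 1 \<subseteq> comm_products G (carrier G) xs"
proof
  fix h assume h: "h \<in> lower_central G 1"
  have sub: "comm_products G (carrier G) xs \<subseteq> carrier G" using comm_products_subset xs by simp
  have main: "\<exists>c\<in>comm_products G (carrier G) xs. \<exists>z\<in>lower_central G (Suc k). h = z \<otimes> c" for k
  proof (induction k)
    case 0
    have "\<one> \<in> comm_products G (carrier G) xs" using one_in_comm_products xs by simp
    moreover have "h = h \<otimes> \<one>" using h lower_central_subset by (metis r_one subsetD)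
    ultimately show ?case using h by (metis One_nat_def)
  next
    case (Suc k)
    then obtain c z where cz: "c \<in> comm_products G (carrier G) xs" "z \<in> lower_central G (Suc k)"
      "h = z \<otimes> c" by blast
    have car: "c \<in> carrier G" "z \<in> carrier G" using cz sub lower_central_subset by blast+
    \<comment> \<open>The step lemma expects the error to the right of \<open>c\<close> and returns
      it on the left; conjugation by \<open>c\<close> moves it back.\<close>
    have "inv c \<otimes> z \<otimes> c \<in> lower_central G (Suc k)"
      using normal.inv_op_closed1[OF lower_central_normal car(1) cz(2)] .
    moreover have "h = c \<otimes> (inv c \<otimes> z \<otimes> c)"
      using cz(3) car by (simp add: m_assoc[symmetric])
    ultimately show ?case using lower_central_step[OF xs gen cz(1)] by metis
  qed
  \<comment> \<open>\<open>main\<close> leaves its error in term \<open>Suc m\<close>, while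
    \<open>nil\<close> speaks of term \<open>m\<close>.\<close>
  have "lower_central G (Suc m) \<subseteq> lower_central G m"
  proof -
    have "commutator G g y \<in> lower_central G m" if "g \<in> lower_central G m" "y \<in> carrier G" for g y
    proof -
      have g: "g \<in> carrier G" using that lower_central_subset by blast
      have "g \<otimes> (y \<otimes> inv g \<otimes> inv y) \<in> lower_central G m"
        using that normal.inv_op_closed2[OF lower_central_normal] lower_central_normal
        by (meson normal_imp_subgroup subgroup.m_closed subgroup.m_inv_closed)
      then show ?thesis using g that by (simp add: commutator_def m_assoc)
    qed
    then show ?thesis unfolding lower_central.simps
      by (intro generate_subgroup_incl normal_imp_subgroup lower_central_normal) blast
  qed
  then obtain c where "c \<in> comm_products G (carrier G) xs" "h = \<one> \<otimes> c"
    using main[of m] nil by blast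
  then show "h \<in> comm_products G (carrier G) xs" using sub by auto
qed

section \<open>Nilpotency of finite p-groups\<close>

text \<open>The class equation: conjugacy classes have \<open>p\<close>-power size, and a class of
  size one is a central element. If only the identity were central, the order would be 1 modulo
  \<open>p\<close>.\<close>

lemma p_group_center_nontrivial:
  assumes ord: "order G = p ^ k" and p: "Factorial_Ring.prime p" and "carrier G \<noteq> {\<one>}"
  shows "\<exists>z\<in>carrier G. z \<noteq> \<one> \<and> (\<forall>x\<in>carrier G. z \<otimes> x = x \<otimes> z)"
proof (rule ccontr)
  assume no: "\<not> ?thesis"
  define \<phi> where "\<phi> = (\<lambda>g. \<lambda>h\<in>carrier G. g \<otimes> h \<otimes> inv g)"
  interpret act: group_action G "carrier G" \<phi>
    unfolding \<phi>_def by (rule action_by_conjugation)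
  have fin: "finite (carrier G)" using ord p by (metis order_gt_0_iff_finite prime_gt_0_nat zero_less_power)
  have orb: "orbit G \<phi> x = {g \<otimes> x \<otimes> inv g | g. g \<in> carrier G}" if "x \<in> carrier G" for x
    using that by (auto simp: orbit_def \<phi>_def)
  have orb1: "orbit G \<phi> \<one> = {\<one>}" unfolding orb[OF one_closed] by (auto intro!: exI[of _ \<one>])
  have dvd: "p dvd card (orbit G \<phi> x)" if x: "x \<in> carrier G" "x \<noteq> \<one>" for x
  proof -
    have "card (orbit G \<phi> x) dvd p ^ k"
      using act.orbit_stabilizer_theorem[OF x(1)] ord by (metis dvd_triv_left)
    then obtain i where i: "card (orbit G \<phi> x) = p ^ i" using divides_primepow_nat[OF p] by blast
    have "i \<noteq> 0"
    proof
      assume "i = 0"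
      then have "card (orbit G \<phi> x) = 1" using i by simp
      then obtain w where w: "orbit G \<phi> x = {w}" using card_1_singletonE by blast
      have "x \<in> orbit G \<phi> x" unfolding orb[OF x(1)] using x by (auto intro!: exI[of _ \<one>])
      then have "w = x" using w by simp
      then have c: "g \<otimes> x \<otimes> inv g = x" if "g \<in> carrier G" for g
        using w that unfolding orb[OF x(1)] by blast
      have "x \<otimes> g = g \<otimes> x" if "g \<in> carrier G" for g
        using c[OF that] x that by (metis inv_solve_right m_closed)
      then show False using no x by blast
    qed
    then show ?thesis using i by (simp add: dvd_power)
  qed
  have "card (carrier G) = (\<Sum>R\<in>orbits G (carrier G) \<phi>. card R)"
    using act.disjoint_sum[OF fin, of "\<lambda>_. 1::nat"] by simp
  moreover have orbs: "orbits G (carrier G) \<phi> = insert {\<one>} (orbits G (carrier G) \<phi> - {{\<one>}})"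
    using orb1 unfolding orbits_def by force
  moreover have "finite (orbits G (carrier G) \<phi>)" unfolding orbits_def using fin by simp
  ultimately have card: "card (carrier G) = 1 + (\<Sum>R\<in>orbits G (carrier G) \<phi> - {{\<one>}}. card R)"
    by (metis (no_types, lifting) card_1_singleton_iff One_nat_def finite_Diff Diff_iff insertI1 sum.insert)
  have "p dvd (\<Sum>R\<in>orbits G (carrier G) \<phi> - {{\<one>}}. card R)"
  proof (rule dvd_sum)
    fix R assume R: "R \<in> orbits G (carrier G) \<phi> - {{\<one>}}"
    then obtain x where "x \<in> carrier G" "R = orbit G \<phi> x" unfolding orbits_def by blast
    then show "p dvd card R" using dvd R orb1 by blast
  qed
  moreover have "p dvd card (carrier G)"
  proof -
    have "k \<noteq> 0" using ord assms(3) order_one_triv_iff by (metis power_0)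
    then show ?thesis using ord unfolding order_def by (simp add: dvd_power)
  qed
  ultimately have "p dvd 1" using card by (metis dvd_add_left_iff)
  then show False using p by (simp add: prime_nat_iff)
qed

lemma p_group_nilpotent:
  assumes ord: "order G = p ^ k" and p: "Factorial_Ring.prime p"
  shows "\<exists>m. lower_central G m \<subseteq> {\<one>}"
proof -
  have fin: "finite (carrier G)" using ord p by (metis order_gt_0_iff_finite prime_gt_0_nat zero_less_power)
  \<comment> \<open>Generalizing from the trivial subgroup to every normal \<open>N\<close> keeps
    the induction inside one group; it passes from \<open>N\<close> to a strictly larger
    \<open>M\<close>.\<close>
  have "\<exists>m. lower_central G m \<subseteq> N" if "N \<lhd> G" for N
    using that
  proof (induction "order G - card N" arbitrary: N rule: less_induct)
    case less
    interpret N: normal N G by fact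
    interpret Q: group "G Mod N" by (rule N.factorgroup_is_group)
    interpret pi: group_hom G "G Mod N" "\<lambda>x. N #> x"
      by (simp add: group_hom_def group_hom_axioms_def N.r_coset_hom_Mod is_group Q.is_group)
    have piN: "N #> x = N \<longleftrightarrow> x \<in> N" if "x \<in> carrier G" for x
      using that by (metis N.subgroup_axioms coset_join1 coset_join2 N.subset)
    show ?case
    proof (cases "carrier (G Mod N) = {N}")
      case True
      have "x \<in> N" if "x \<in> carrier G" for x
        using True that piN[OF that] unfolding carrier_FactGroup by blast
      then show ?thesis by (intro exI[of _ 0]) auto
    next
      case False
      have "order (G Mod N) dvd p ^ k"
        using lagrange[OF N.subgroup_axioms] ord unfolding order_def FactGroup_def by (metis dvd_triv_left partial_object.select_convs(1))
      then obtain i where "order (G Mod N) = p ^ i" using divides_primepow_nat[OF p] by blast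
      then obtain z where z: "z \<in> carrier (G Mod N)" "z \<noteq> N"
        "\<And>x. x \<in> carrier (G Mod N) \<Longrightarrow> z \<otimes>\<^bsub>G Mod N\<^esub> x = x \<otimes>\<^bsub>G Mod N\<^esub> z"
        using Q.p_group_center_nontrivial[OF _ p] False by (metis one_FactGroup)
      obtain g where g: "g \<in> carrier G" "z = N #> g" using z(1) unfolding carrier_FactGroup by blast
      \<comment> \<open>\<open>M\<close> is the preimage of the centre of \<open>G Mod N\<close>. So
        [M, G] lies in \<open>N\<close>, and a lower central term inside \<open>M\<close> puts the
        next one inside \<open>N\<close>.\<close>
      define M where "M = {x \<in> carrier G. \<forall>y\<in>carrier (G Mod N). (N #> x) \<otimes>\<^bsub>G Mod N\<^esub> y = y \<otimes>\<^bsub>G Mod N\<^esub> (N #> x)}"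
      have Mc: "commutator G x y \<in> N" if "x \<in> M" "y \<in> carrier G" for x y
      proof -
        have x: "x \<in> carrier G" using that M_def by blast
        have "commutator (G Mod N) (N #> x) (N #> y) = \<one>\<^bsub>G Mod N\<^esub>"
          using that x pi.hom_closed unfolding M_def by (subst Q.commutator_eq_one_iff) auto
        then show ?thesis using piN[of "commutator G x y"] pi.hom_commutator[OF x that(2)] x that by simp
      qed
      have "subgroup M G"
      proof
        show "M \<subseteq> carrier G" "\<one> \<in> M" unfolding M_def using pi.hom_closed by (auto simp del: mult_FactGroup one_FactGroup)
        show "x \<otimes> y \<in> M" if "x \<in> M" "y \<in> M" for x y
        proof -
          have xy: "x \<in> carrier G" "y \<in> carrier G" using that M_def by blast+
          then have "N #> x \<in> carrier (G Mod N)" "N #> y \<in> carrier (G Mod N)" using pi.hom_closed by auto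
          then have "(N #> x) \<otimes>\<^bsub>G Mod N\<^esub> (N #> y) \<otimes>\<^bsub>G Mod N\<^esub> w = w \<otimes>\<^bsub>G Mod N\<^esub> ((N #> x) \<otimes>\<^bsub>G Mod N\<^esub> (N #> y))"
            if "w \<in> carrier (G Mod N)" for w
            using that \<open>x \<in> M\<close> \<open>y \<in> M\<close> unfolding M_def
            by (smt (verit, best) Q.m_assoc mem_Collect_eq)
          then show ?thesis using xy unfolding M_def by (simp del: mult_FactGroup)
        qed
        show "inv x \<in> M" if "x \<in> M" for x
        proof -
          have x: "x \<in> carrier G" using that M_def by blast
          then have X: "N #> x \<in> carrier (G Mod N)" using pi.hom_closed by auto
          have "inv\<^bsub>G Mod N\<^esub> (N #> x) \<otimes>\<^bsub>G Mod N\<^esub> w = w \<otimes>\<^bsub>G Mod N\<^esub> inv\<^bsub>G Mod N\<^esub> (N #> x)"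
            if w: "w \<in> carrier (G Mod N)" for w
          proof -
            have "(N #> x) \<otimes>\<^bsub>G Mod N\<^esub> w = w \<otimes>\<^bsub>G Mod N\<^esub> (N #> x)"
              using w \<open>x \<in> M\<close> unfolding M_def by blast
            then show ?thesis using X w by (metis Q.inv_solve_left Q.inv_solve_right Q.inv_closed Q.m_assoc Q.m_closed)
          qed
          then show ?thesis using x pi.hom_inv[OF x] unfolding M_def by (simp del: mult_FactGroup)
        qed
      qed
      moreover have conj: "x \<otimes> h \<otimes> inv x \<in> M" if "x \<in> carrier G" "h \<in> M" for x h
      proof -
        have h: "h \<in> carrier G" using that M_def by blast
        have "N #> (x \<otimes> h \<otimes> inv x) = (N #> x) \<otimes>\<^bsub>G Mod N\<^esub> (N #> h) \<otimes>\<^bsub>G Mod N\<^esub> inv\<^bsub>G Mod N\<^esub> (N #> x)"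
          using that h by (simp del: mult_FactGroup)
        also have "\<dots> = (N #> h) \<otimes>\<^bsub>G Mod N\<^esub> (N #> x) \<otimes>\<^bsub>G Mod N\<^esub> inv\<^bsub>G Mod N\<^esub> (N #> x)"
          using that unfolding M_def by (simp del: mult_FactGroup)
        also have "\<dots> = N #> h" using that h pi.hom_closed by (simp add: Q.m_assoc del: mult_FactGroup one_FactGroup)
        finally show ?thesis using that unfolding M_def by simp
      qed
      ultimately have M: "M \<lhd> G" by (simp add: normal_inv_iff)
      have "N \<subseteq> M"
      proof
        fix x assume x: "x \<in> N"
        then have "N #> x = \<one>\<^bsub>G Mod N\<^esub>" using piN[of x] by simp
        then show "x \<in> M" unfolding M_def using x pi.hom_closed by (auto simp del: mult_FactGroup one_FactGroup)
      qed
      moreover have "g \<in> M" unfolding M_def using g z(3) pi.hom_closed by (auto simp del: mult_FactGroup)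
      moreover have "g \<notin> N" using g z(2) piN by auto
      ultimately have "N \<subset> M" by blast
      moreover have Msub: "M \<subseteq> carrier G" unfolding M_def by blast
      ultimately have "card N < card M" "card M \<le> order G" unfolding order_def
        using fin by (auto intro: psubset_card_mono card_mono finite_subset)
      then obtain m where m: "lower_central G m \<subseteq> M" using less(1)[OF _ M] by (meson diff_less_mono2 order_less_le_trans)
      have "lower_central G (Suc m) \<subseteq> N"
        unfolding lower_central.simps using m Mc by (intro generate_subgroup_incl N.subgroup_axioms) blast
      then show ?thesis by blast
    qed
  qed
  from this[OF one_is_normal] show ?thesis .
qed

end

section \<open>Powers and commutators; Schreier generators\<close>

text \<open>The abstract subgroup, without closure, so that a homomorphism with no continuity kills
  it as soon as it kills the generators.\<close>

definition power_comm_subgroup :: "('a, 'b) monoid_scheme \<Rightarrow> nat \<Rightarrow> 'a set" where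
  "power_comm_subgroup G n = generate G
     ({u [^]\<^bsub>G\<^esub> n | u. u \<in> carrier G} \<union> {commutator G g y | g y. g \<in> carrier G \<and> y \<in> carrier G})"

lemma (in group_hom) lower_central_img:
  "h ` lower_central G k \<subseteq> lower_central H k"
proof (induction k)
  case (Suc k)
  let ?A = "{commutator G g y | g y. g \<in> lower_central G k \<and> y \<in> carrier G}"
  have A: "?A \<subseteq> carrier G" using G.lower_central_subset by blast
  have "h ` ?A \<subseteq> {commutator H g y | g y. g \<in> lower_central H k \<and> y \<in> carrier H}"
  proof
    fix w assume "w \<in> h ` ?A"
    then obtain g y where gy: "w = h (commutator G g y)" "g \<in> lower_central G k" "y \<in> carrier G" by blast
    then have "w = commutator H (h g) (h y)" using hom_commutator[of g y] G.lower_central_subset[of k] by auto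
    then show "w \<in> {commutator H g y | g y. g \<in> lower_central H k \<and> y \<in> carrier H}"
      using imageI[OF gy(2), of h] hom_closed[OF gy(3)] Suc by auto
  qed
  then have "generate H (h ` ?A) \<subseteq> lower_central H (Suc k)"
    unfolding lower_central.simps by (rule H.mono_generate)
  then show ?case using generate_img[OF A] by simp
qed auto

context group
begin

lemma group_hom_Mod:
  assumes "N \<lhd> G" shows "group_hom G (G Mod N) (\<lambda>x. N #> x)"
  by (simp add: assms group_axioms group_hom.intro group_hom_axioms.intro
      normal.factorgroup_is_group normal.r_coset_hom_Mod)

lemma r_coset_eq_iff:
  assumes "subgroup N G" "x \<in> carrier G" "y \<in> carrier G"
  shows "N #> x = N #> y \<longleftrightarrow> x \<otimes> inv y \<in> N"
proof -
  have "N #> x = N #> y \<longleftrightarrow> x \<in> N #> y"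
    using assms by (metis rcos_self repr_independence)
  then show ?thesis using subgroup.rcos_module[OF assms(1) group_axioms assms(3,2)] by simp
qed

lemma lower_central_1: "lower_central G 1 = derived G (carrier G)"
proof -
  have "{commutator G g y | g y. g \<in> carrier G \<and> y \<in> carrier G} = derived_set G (carrier G)"
    unfolding commutator_def by blast
  then show ?thesis by (simp add: derived_def)
qed

lemma comm_products_derived:
  assumes "set xs \<subseteq> carrier G"
  shows "comm_products G (carrier G) xs \<subseteq> lower_central G 1"
  using assms
proof (induction xs)
  case Nil
  then show ?case by (simp add: generate.one)
next
  case (Cons x xs)
  have sg: "subgroup (lower_central G 1) G" by (simp add: lower_central_normal normal_imp_subgroup del: lower_central.simps One_nat_def)
  have "commutator G g x \<in> lower_central G 1" if "g \<in> carrier G" for g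
    using lower_central_commutator[of g 0 x] that Cons.prems by simp
  then show ?case using Cons subgroup.m_closed[OF sg] by auto
qed

text \<open>In the abelian quotient by the derived subgroup, taking n-th powers is a homomorphism,
  so its image is already a subgroup and a single power suffices. This bounded form later exhibits
  the subgroup as a continuous image of a compact set.\<close>

lemma power_comm_subgroup_eq:
  "power_comm_subgroup G n = {l \<otimes> u [^] n | l u. l \<in> lower_central G 1 \<and> u \<in> carrier G}"
proof -
  define L where "L = lower_central G 1"
  have L: "L \<lhd> G" unfolding L_def by (rule lower_central_normal)
  then have Ls: "subgroup L G" by (rule normal_imp_subgroup)
  interpret Q: comm_group "G Mod L"
    unfolding L_def lower_central_1 by (rule derived_quot_is_comm_group)
  interpret pi: group_hom G "G Mod L" "\<lambda>x. L #> x" by (rule group_hom_Mod[OF L])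
  have piL: "L #> x = \<one>\<^bsub>G Mod L\<^esub>" if "x \<in> L" for x
    using that Ls by (metis coset_join2 one_FactGroup subgroup.mem_carrier)
  let ?A = "{u [^] n | u. u \<in> carrier G} \<union> {commutator G g y | g y. g \<in> carrier G \<and> y \<in> carrier G}"
  \<comment> \<open>The preimage of the group of n-th powers of the quotient.\<close>
  define S where "S = {x \<in> carrier G. \<exists>u\<in>carrier G. L #> x = (L #> u) [^]\<^bsub>G Mod L\<^esub> n}"
  have sgS: "subgroup S G"
  proof
    show "S \<subseteq> carrier G" unfolding S_def by blast
    show "\<one> \<in> S" unfolding S_def using pi.hom_one Q.nat_pow_one by (auto simp del: one_FactGroup mult_FactGroup intro!: bexI[of _ \<one>])
    show "x \<otimes> y \<in> S" if xy: "x \<in> S" "y \<in> S" for x y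
    proof -
      obtain u w where uw: "u \<in> carrier G" "L #> x = (L #> u) [^]\<^bsub>G Mod L\<^esub> n"
        "w \<in> carrier G" "L #> y = (L #> w) [^]\<^bsub>G Mod L\<^esub> n" using xy unfolding S_def by blast
      have c: "x \<in> carrier G" "y \<in> carrier G" using xy unfolding S_def by auto
      have "L #> (x \<otimes> y) = (L #> (u \<otimes> w)) [^]\<^bsub>G Mod L\<^esub> n"
        using uw c pi.hom_closed by (simp add: Q.nat_pow_distrib del: mult_FactGroup)
      then show ?thesis unfolding S_def using uw c by blast
    qed
    show "inv x \<in> S" if x: "x \<in> S" for x
    proof -
      obtain u where uw: "u \<in> carrier G" "L #> x = (L #> u) [^]\<^bsub>G Mod L\<^esub> n" using x unfolding S_def by blast
      have c: "x \<in> carrier G" using that unfolding S_def by auto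
      have "L #> inv x = inv\<^bsub>G Mod L\<^esub> ((L #> u) [^]\<^bsub>G Mod L\<^esub> n)"
        using pi.hom_inv[OF c] uw(2) by simp
      also have "\<dots> = (L #> inv u) [^]\<^bsub>G Mod L\<^esub> n"
        using Q.nat_pow_inv[OF pi.hom_closed[OF uw(1)], of n] pi.hom_inv[OF uw(1)] by simp
      finally have "L #> inv x = (L #> inv u) [^]\<^bsub>G Mod L\<^esub> n" .
      then show ?thesis unfolding S_def using uw c by blast
    qed
  qed
  have "?A \<subseteq> S"
  proof
    fix x assume "x \<in> ?A"
    then show "x \<in> S"
    proof
      assume "x \<in> {u [^] n | u. u \<in> carrier G}"
      then show ?thesis unfolding S_def using pi.hom_nat_pow by auto
    next
      assume x: "x \<in> {commutator G g y | g y. g \<in> carrier G \<and> y \<in> carrier G}"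
      then have "x \<in> L" unfolding L_def using lower_central_commutator[of _ 0] by auto
      then show ?thesis unfolding S_def using x pi.hom_one Q.nat_pow_one
        by (auto simp del: one_FactGroup mult_FactGroup simp: piL intro!: bexI[of _ \<one>])
    qed
  qed
  then have sub: "generate G ?A \<subseteq> S" by (rule generate_subgroup_incl[OF _ sgS])
  have S_eq: "S \<subseteq> {l \<otimes> u [^] n | l u. l \<in> L \<and> u \<in> carrier G}"
  proof
    fix x assume "x \<in> S"
    then obtain u where u: "u \<in> carrier G" "L #> x = (L #> u) [^]\<^bsub>G Mod L\<^esub> n" "x \<in> carrier G" unfolding S_def by blast
    then have "L #> x = L #> (u [^] n)" using pi.hom_nat_pow by metis
    then have "x \<otimes> inv (u [^] n) \<in> L" using r_coset_eq_iff[OF Ls] u by blast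
    moreover have "x = (x \<otimes> inv (u [^] n)) \<otimes> u [^] n" using u by (simp add: m_assoc)
    ultimately show "x \<in> {l \<otimes> u [^] n | l u. l \<in> L \<and> u \<in> carrier G}" using u by blast
  qed
  have Asub: "?A \<subseteq> carrier G" by auto
  have "l \<otimes> u [^] n \<in> generate G ?A" if "l \<in> L" "u \<in> carrier G" for l u
  proof -
    have "L \<subseteq> generate G ?A" unfolding L_def One_nat_def lower_central.simps by (intro mono_generate) auto
    moreover have "u [^] n \<in> generate G ?A" using that by (intro generate.incl) auto
    ultimately show ?thesis using that by (auto intro: generate.eng)
  qed
  then show ?thesis using sub S_eq unfolding power_comm_subgroup_def L_def[symmetric] by blast
qed

lemma finite_generate_singleton:
  assumes "x \<in> carrier G" "0 < (n::nat)" "x [^] n = \<one>"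
  shows "finite (generate G {x})"
proof -
  have "x [^] (k::int) \<in> (\<lambda>i. x [^] i) ` {0..<int n}" for k
  proof -
    have "x [^] k = (x [^] int n) [^] (k div int n) \<otimes> x [^] (k mod int n)"
      using int_pow_mult[OF assms(1), of "int n * (k div int n)" "k mod int n"]
        int_pow_pow[OF assms(1), of "int n" "k div int n"] by simp
    also have "\<dots> = x [^] (k mod int n)" using assms by (simp add: int_pow_int)
    finally show ?thesis using assms(2) by auto
  qed
  then have "generate G {x} \<subseteq> (\<lambda>i. x [^] i) ` {0..<int n}"
    unfolding generate_pow[OF assms(1)] by auto
  then show ?thesis by (rule finite_subset) simp
qed

text \<open>Schreier's rewriting: for representatives \<open>r g\<close> of the cosets
  \<open>U #> g\<close>, the elements
  \<open>r g \<otimes> x \<otimes> inv (r (g \<otimes> x))\<close> depend only on \<open>x\<close>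
  and the coset of \<open>g\<close>, and products of them telescope. The intersection with
  \<open>generate G S\<close> appears because in the application that subgroup is only
  dense.\<close>

lemma schreier_finitely_generated:
  assumes U: "subgroup U G" and fin: "finite (rcosets U)" and S: "finite S" "S \<subseteq> carrier G"
  shows "\<exists>S'. finite S' \<and> S' \<subseteq> U \<and> U \<inter> generate G S = generate G S'"
proof -
  define \<Gamma> where "\<Gamma> = generate G S"
  have \<Gamma>: "subgroup \<Gamma> G" unfolding \<Gamma>_def by (rule generate_is_subgroup[OF S(2)])
  have \<Gamma>c: "g \<in> carrier G" if "g \<in> \<Gamma>" for g using that \<Gamma> by (rule subgroup.mem_carrier[rotated])
  \<comment> \<open>The representative of \<open>U\<close> is the identity, so that an element of
    \<open>U\<close>, rewritten from the identity, is returned unchanged. The others are taken in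
    \<Gamma> to keep the new generators there.\<close>
  define \<rho> where "\<rho> C = (if C = U then \<one> else SOME x. x \<in> C \<and> x \<in> \<Gamma>)" for C
  define r where "r g = \<rho> (U #> g)" for g
  have r: "r g \<in> \<Gamma>" "U #> r g = U #> g" if g: "g \<in> \<Gamma>" for g
  proof -
    have "r g \<in> U #> g \<and> r g \<in> \<Gamma>"
    proof (cases "U #> g = U")
      case True
      then show ?thesis using U \<Gamma> by (simp add: r_def \<rho>_def subgroup.one_closed)
    next
      case False
      have "g \<in> U #> g \<and> g \<in> \<Gamma>" using g \<Gamma>c U rcos_self by blast
      then show ?thesis using False unfolding r_def \<rho>_def by (metis (mono_tags, lifting) someI_ex)
    qed
    then show "r g \<in> \<Gamma>" "U #> r g = U #> g"
      using repr_independence[OF _ \<Gamma>c[OF g] U] by auto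
  qed
  have rU: "r g = \<one>" if "g \<in> U" for g
    using that U unfolding r_def \<rho>_def by (simp add: coset_join2 subgroup.mem_carrier)
  define f where "f = (\<lambda>(C, x). \<rho> C \<otimes> x \<otimes> inv (\<rho> (C #> x)))"
  define Y where "Y = S \<union> (\<lambda>x. inv x) ` S"
  have Y\<Gamma>: "Y \<subseteq> \<Gamma>" unfolding Y_def \<Gamma>_def by (auto intro: generate.incl generate.inv)
  define S' where "S' = f ` ((\<lambda>g. U #> g) ` \<Gamma> \<times> Y)"
  have "(\<lambda>g. U #> g) ` \<Gamma> \<subseteq> rcosets U" using \<Gamma>c by (auto simp: RCOSETS_def)
  then have "finite ((\<lambda>g. U #> g) ` \<Gamma>)" using fin by (rule finite_subset)
  moreover have "finite Y" unfolding Y_def using S by simp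
  ultimately have finS': "finite S'" unfolding S'_def by blast
  have f_eq: "f (U #> g, x) = r g \<otimes> x \<otimes> inv (r (g \<otimes> x))" if "g \<in> \<Gamma>" "x \<in> \<Gamma>" for g x
    unfolding f_def r_def using that \<Gamma>c U by (simp add: coset_mult_assoc subgroup.subset)
  have in_U: "r g \<otimes> x \<otimes> inv (r (g \<otimes> x)) \<in> U" "r g \<otimes> x \<otimes> inv (r (g \<otimes> x)) \<in> \<Gamma>" if "g \<in> \<Gamma>" "x \<in> \<Gamma>" for g x
  proof -
    have gx: "g \<otimes> x \<in> \<Gamma>" using that \<Gamma> by (simp add: subgroup.m_closed)
    have "U #> (r g \<otimes> x) = (U #> r g) #> x"
      using coset_mult_assoc[OF subgroup.subset[OF U] \<Gamma>c[OF r(1)[OF that(1)]] \<Gamma>c[OF that(2)]] by simp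
    also have "\<dots> = U #> (g \<otimes> x)"
      using that r \<Gamma>c U by (simp add: coset_mult_assoc subgroup.subset)
    also have "\<dots> = U #> r (g \<otimes> x)" using r gx by simp
    finally show "r g \<otimes> x \<otimes> inv (r (g \<otimes> x)) \<in> U"
      using r_coset_eq_iff[OF U] r(1)[OF gx] r(1)[OF that(1)] \<Gamma>c that by simp
    show "r g \<otimes> x \<otimes> inv (r (g \<otimes> x)) \<in> \<Gamma>"
      using r(1)[OF gx] r(1)[OF that(1)] that \<Gamma> by (simp add: subgroup.m_closed subgroup.m_inv_closed)
  qed
  have S'U: "S' \<subseteq> U \<inter> \<Gamma>" unfolding S'_def using f_eq in_U Y\<Gamma> by auto
  have key: "y \<in> generate G S \<Longrightarrow> \<forall>g\<in>\<Gamma>. r g \<otimes> y \<otimes> inv (r (g \<otimes> y)) \<in> generate G S'" for y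
  proof (induction y rule: generate.induct)
    case one
    then show ?case using r \<Gamma>c by (simp add: generate.one)
  next
    case (incl h)
    show ?case
    proof
      fix g assume g: "g \<in> \<Gamma>"
      have h: "h \<in> Y" using incl Y_def by simp
      then have "f (U #> g, h) \<in> S'" unfolding S'_def using g by blast
      then show "r g \<otimes> h \<otimes> inv (r (g \<otimes> h)) \<in> generate G S'"
        using f_eq[OF g subsetD[OF Y\<Gamma> h]] generate.incl[of _ S' G] by metis
    qed
  next
    case (inv h)
    show ?case
    proof
      fix g assume g: "g \<in> \<Gamma>"
      have h: "inv h \<in> Y" using inv Y_def by simp
      then have "f (U #> g, inv h) \<in> S'" unfolding S'_def using g by blast
      then show "r g \<otimes> inv h \<otimes> inv (r (g \<otimes> inv h)) \<in> generate G S'"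
        using f_eq[OF g subsetD[OF Y\<Gamma> h]] generate.incl[of _ S' G] by metis
    qed
  next
    case (eng h1 h2)
    show ?case
    proof
      fix g assume g: "g \<in> \<Gamma>"
      have h: "h1 \<in> \<Gamma>" "h2 \<in> \<Gamma>" using eng unfolding \<Gamma>_def by auto
      have gh: "g \<otimes> h1 \<in> \<Gamma>" "g \<otimes> h1 \<otimes> h2 \<in> \<Gamma>" using g h \<Gamma> by (auto simp: subgroup.m_closed)
      note c = \<Gamma>c[OF g] \<Gamma>c[OF h(1)] \<Gamma>c[OF h(2)] \<Gamma>c[OF gh(1)] \<Gamma>c[OF gh(2)]
        \<Gamma>c[OF r(1)[OF g]] \<Gamma>c[OF r(1)[OF gh(1)]] \<Gamma>c[OF r(1)[OF gh(2)]]
      have "r g \<otimes> (h1 \<otimes> h2) \<otimes> inv (r (g \<otimes> h1 \<otimes> h2)) =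
        (r g \<otimes> h1 \<otimes> inv (r (g \<otimes> h1))) \<otimes> (r (g \<otimes> h1) \<otimes> h2 \<otimes> inv (r (g \<otimes> h1 \<otimes> h2)))"
        (is "_ = (?a \<otimes> ?b \<otimes> inv ?c) \<otimes> (?c \<otimes> ?d \<otimes> ?e)")
      proof -
        have "inv ?c \<otimes> (?c \<otimes> ?d \<otimes> ?e) = ?d \<otimes> ?e" using c by (simp add: m_assoc[symmetric])
        then show ?thesis using c by (simp add: m_assoc)
      qed
      moreover have "r g \<otimes> h1 \<otimes> inv (r (g \<otimes> h1)) \<in> generate G S'"
        "r (g \<otimes> h1) \<otimes> h2 \<otimes> inv (r (g \<otimes> h1 \<otimes> h2)) \<in> generate G S'" using eng g gh by auto
      ultimately show "r g \<otimes> (h1 \<otimes> h2) \<otimes> inv (r (g \<otimes> (h1 \<otimes> h2))) \<in> generate G S'"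
        using c generate.eng by (metis m_assoc)
    qed
  qed
  have "U \<inter> \<Gamma> \<subseteq> generate G S'"
  proof
    fix u assume u: "u \<in> U \<inter> \<Gamma>"
    then have "r \<one> \<otimes> u \<otimes> inv (r (\<one> \<otimes> u)) \<in> generate G S'"
      using key[of u] subgroup.one_closed[OF \<Gamma>] unfolding \<Gamma>_def by blast
    then show "u \<in> generate G S'"
      using u \<Gamma>c rU subgroup.one_closed[OF U] by simp
  qed
  moreover have "generate G S' \<subseteq> U \<inter> \<Gamma>"
    using S'U generate_subgroup_incl[OF _ U] generate_subgroup_incl[OF _ \<Gamma>] by blast
  ultimately show ?thesis using finS' S'U unfolding \<Gamma>_def by blast
qed

end

text \<open>By commutativity one more generator only multiplies the subgroup by a cyclic one, which
  is finite because its generator has finite order.\<close>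

lemma (in comm_group) finite_generate_exponent:
  assumes "finite S" "S \<subseteq> carrier G" "0 < (n::nat)" "\<And>x. x \<in> S \<Longrightarrow> x [^] n = \<one>"
  shows "finite (generate G S)"
  using assms(1,2,4)
proof (induction S rule: finite_induct)
  case empty
  then show ?case by (simp add: generate_empty)
next
  case (insert x S)
  let ?H = "generate G {x}" and ?K = "generate G S"
  have H: "subgroup ?H G" and K: "subgroup ?K G" using insert by (auto intro: generate_is_subgroup)
  have fin: "finite ?H" "finite ?K"
    using insert assms(3) finite_generate_singleton[of x n] by auto
  have "insert x S \<subseteq> ?H <#> ?K"
  proof
    fix y assume "y \<in> insert x S"
    then have "y = x \<and> y \<in> carrier G \<or> y \<in> S \<and> y \<in> carrier G" using insert by auto
    moreover have "x \<in> ?H" "\<one> \<in> ?H" "\<one> \<in> ?K" "S \<subseteq> ?K" by (auto intro: generate.incl generate.one)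
    ultimately show "y \<in> ?H <#> ?K" unfolding set_mult_def
      by (smt (verit) UN_I insertCI l_one r_one subsetD)
  qed
  then have "generate G (insert x S) \<subseteq> ?H <#> ?K"
    by (rule generate_subgroup_incl) (rule mult_subgroups[OF H K])
  moreover have "finite (?H <#> ?K)" unfolding set_mult_def using fin by simp
  ultimately show ?case by (rule finite_subset)
qed

section \<open>Compact groups and pro-p groups\<close>

locale compact_group = group G for G :: "('a, 'b) monoid_scheme" (structure) +
  fixes T :: "'a topology"
  assumes topspace_eq: "topspace T = carrier G"
    and compact: "compact_space T" and hausdorff: "Hausdorff_space T"
    and mult_cont: "continuous_map (prod_topology T T) T (\<lambda>x. fst x \<otimes> snd x)"
    and inv_cont: "continuous_map T T (\<lambda>x. inv x)"
begin

lemma continuous_map_mult: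
  assumes "continuous_map Y T f" "continuous_map Y T g"
  shows "continuous_map Y T (\<lambda>x. f x \<otimes> g x)"
  using continuous_map_compose[OF continuous_map_pairedI[OF assms] mult_cont] by (simp add: o_def)

lemma continuous_map_inv:
  assumes "continuous_map Y T f"
  shows "continuous_map Y T (\<lambda>x. inv (f x))"
  using continuous_map_compose[OF assms inv_cont] by (simp add: o_def)

lemma continuous_map_pow:
  assumes "continuous_map Y T f"
  shows "continuous_map Y T (\<lambda>x. f x [^] (n::nat))"
  by (induction n) (auto intro!: continuous_map_mult assms simp: topspace_eq)

lemma continuous_map_commutator:
  assumes "continuous_map Y T f" "continuous_map Y T g"
  shows "continuous_map Y T (\<lambda>x. commutator G (f x) (g x))"
  unfolding commutator_def by (intro continuous_map_mult continuous_map_inv assms)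

lemma continuous_map_const': "a \<in> carrier G \<Longrightarrow> continuous_map Y T (\<lambda>_. a)"
  by (simp add: topspace_eq)

lemma compactin_closedin: "compactin T S \<Longrightarrow> closedin T S"
  by (rule compactin_imp_closedin[OF hausdorff])

lemma r_coset_eq_preimage:
  assumes "S \<subseteq> carrier G" "a \<in> carrier G"
  shows "S #> a = {x \<in> topspace T. x \<otimes> inv a \<in> S}"
proof (intro subset_antisym subsetI)
  fix x assume "x \<in> S #> a"
  then obtain s where s: "s \<in> S" "x = s \<otimes> a" by (auto simp: r_coset_def)
  moreover have "s \<in> carrier G" using s assms by blast
  ultimately show "x \<in> {x \<in> topspace T. x \<otimes> inv a \<in> S}"
    using assms by (simp add: topspace_eq m_assoc)
next
  fix x assume "x \<in> {x \<in> topspace T. x \<otimes> inv a \<in> S}"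
  then have "x \<otimes> inv a \<in> S" "x = x \<otimes> inv a \<otimes> a" using assms by (auto simp: topspace_eq m_assoc)
  then show "x \<in> S #> a" unfolding r_coset_def by blast
qed

lemma continuous_map_translate:
  assumes "a \<in> carrier G" "b \<in> carrier G"
  shows "continuous_map T T (\<lambda>x. x \<otimes> b)" "continuous_map T T (\<lambda>x. a \<otimes> x)"
  by (intro continuous_map_mult continuous_map_const' assms continuous_map_id[unfolded id_def])+

lemma closedin_r_coset:
  assumes "closedin T S" "a \<in> carrier G"
  shows "closedin T (S #> a)"
  unfolding r_coset_eq_preimage[OF closedin_subset[OF assms(1), unfolded topspace_eq] assms(2)]
  by (rule closedin_continuous_map_preimage[OF continuous_map_translate(1)[OF _ inv_closed] assms(1)])
     (use assms in auto)

lemma openin_r_coset: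
  assumes "openin T S" "a \<in> carrier G"
  shows "openin T (S #> a)"
  unfolding r_coset_eq_preimage[OF openin_subset[OF assms(1), unfolded topspace_eq] assms(2)]
  by (rule openin_continuous_map_preimage[OF continuous_map_translate(1)[OF _ inv_closed] assms(1)])
     (use assms in auto)

lemma open_subgroup_finite_rcosets:
  assumes "openin T N" "subgroup N G"
  shows "finite (rcosets N)"
proof -
  have op: "\<And>C. C \<in> rcosets N \<Longrightarrow> openin T C"
    using openin_r_coset[OF assms(1)] by (auto simp: RCOSETS_def)
  have "compactin T (topspace T)" using compact by (simp add: compact_space_def)
  moreover have "topspace T \<subseteq> \<Union>(rcosets N)" using rcosets_part_G[OF assms(2)] topspace_eq by simp
  ultimately obtain F where F: "finite F" "F \<subseteq> rcosets N" "topspace T \<subseteq> \<Union>F"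
    using op unfolding compactin_def by meson
  have "rcosets N \<subseteq> F"
  proof
    fix C assume C: "C \<in> rcosets N"
    then obtain a where a: "a \<in> carrier G" "C = N #> a" by (auto simp: RCOSETS_def)
    have aC: "a \<in> C" using a rcos_self assms by blast
    then obtain D where D: "D \<in> F" "a \<in> D" using F a topspace_eq by blast
    have "C = D" using rcos_disjoint[OF assms(2)] C D F aC
      unfolding pairwise_def disjnt_def by blast
    then show "C \<in> F" using D by simp
  qed
  then show ?thesis using F finite_subset by blast
qed

lemma open_subgroup_closed:
  assumes "openin T N" "subgroup N G"
  shows "closedin T N"
proof -
  have "carrier G - N = \<Union>(rcosets N - {N})"
  proof -
    have "N \<in> rcosets N" using assms(2) by (simp add: subgroup.subgroup_in_rcosets)
    then show ?thesis using rcosets_part_G[OF assms(2)] rcos_disjoint[OF assms(2)]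
      unfolding pairwise_def disjnt_def by blast
  qed
  moreover have "openin T (\<Union>(rcosets N - {N}))"
    using openin_r_coset[OF assms(1)] by (intro openin_Union) (auto simp: RCOSETS_def)
  ultimately show ?thesis using topspace_eq assms
    by (simp add: closedin_def subgroup.subset)
qed

text \<open>The number of factors is fixed by \<open>xs\<close>, so the set is built by continuous
  maps from finitely many compact copies of the carrier.\<close>

lemma compactin_comm_products:
  assumes "set xs \<subseteq> carrier G"
  shows "compactin T (comm_products G (carrier G) xs)"
  using assms
proof (induction xs)
  case Nil
  then show ?case by (simp add: topspace_eq)
next
  case (Cons x xs)
  have "compactin (prod_topology T T) (carrier G \<times> comm_products G (carrier G) xs)"
    using Cons compact by (simp add: compactin_Times compact_space_def topspace_eq[symmetric])
  moreover have "continuous_map (prod_topology T T) T (\<lambda>z. commutator G (fst z) x \<otimes> snd z)"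
    using Cons.prems
    by (intro continuous_map_mult continuous_map_commutator continuous_map_const' continuous_map_fst continuous_map_snd) auto
  ultimately have "compactin T ((\<lambda>z. commutator G (fst z) x \<otimes> snd z) ` (carrier G \<times> comm_products G (carrier G) xs))"
    by (rule image_compactin)
  moreover have "(\<lambda>z. commutator G (fst z) x \<otimes> snd z) ` (carrier G \<times> comm_products G (carrier G) xs) = comm_products G (carrier G) (x # xs)"
    by force
  ultimately show ?case by simp
qed

end

text \<open>The pro-p property enters as a neighbourhood base of normal subgroups of
  \<open>p\<close>-power index, a form that passes easily to an open subgroup: subgroups normal in
  the ambient group can be reused there.\<close>

locale finitely_generated_pro_p = compact_group +
  fixes p :: nat and xs :: "'a list"
  assumes prime_p: "Factorial_Ring.prime p"
    and p_base: "\<And>W. openin T W \<Longrightarrow> \<one> \<in> W \<Longrightarrow>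
       \<exists>N k. openin T N \<and> N \<lhd> G \<and> N \<subseteq> W \<and> card (rcosets N) = p ^ k"
    and xs: "set xs \<subseteq> carrier G" and dense: "T closure_of (generate G (set xs)) = carrier G"
begin

text \<open>The set of products is closed, so an element outside it is separated from it by an open
  normal \<open>N\<close> of \<open>p\<close>-power index. This contradicts the nilpotent case in
  the finite quotient.\<close>

lemma derived_eq_comm_products: "lower_central G 1 = comm_products G (carrier G) xs"
proof
  show "lower_central G 1 \<subseteq> comm_products G (carrier G) xs"
  proof (rule ccontr)
    let ?C = "comm_products G (carrier G) xs"
    assume "\<not> ?thesis"
    then obtain h where h: "h \<in> lower_central G 1" "h \<notin> ?C" by blast
    have hc: "h \<in> carrier G" using h lower_central_subset by blast
    have "closedin T ?C" using compactin_comm_products[OF xs] compactin_closedin by blast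
    then have "openin T (topspace T - ?C)" by blast
    then have "openin T {x \<in> topspace T. h \<otimes> x \<in> topspace T - ?C}"
      by (rule openin_continuous_map_preimage[OF continuous_map_translate(2)[OF hc hc]])
    moreover have "\<one> \<in> {x \<in> topspace T. h \<otimes> x \<in> topspace T - ?C}"
      using h hc by (simp add: topspace_eq)
    ultimately obtain N k where N: "openin T N" "N \<lhd> G"
      "N \<subseteq> {x \<in> topspace T. h \<otimes> x \<in> topspace T - ?C}" "card (rcosets N) = p ^ k"
      using p_base by meson
    have Ns: "subgroup N G" using N by (simp add: normal_imp_subgroup)
    interpret Q: group "G Mod N" by (rule normal.factorgroup_is_group[OF N(2)])
    interpret pi: group_hom G "G Mod N" "\<lambda>x. N #> x" by (rule group_hom_Mod[OF N(2)])
    let ?ys = "map (\<lambda>x. N #> x) xs"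
    have ord: "order (G Mod N) = p ^ k" using N(4) by (simp add: order_def FactGroup_def)
    have surj: "(\<lambda>x. N #> x) ` carrier G = carrier (G Mod N)" by (simp add: carrier_FactGroup)
    \<comment> \<open>Cosets of \<open>N\<close> are open, so each meets the dense subgroup; hence
      the images of \<open>xs\<close> generate the finite quotient.\<close>
    have "carrier (G Mod N) \<subseteq> (\<lambda>x. N #> x) ` generate G (set xs)"
    proof
      fix c assume "c \<in> carrier (G Mod N)"
      then obtain g where g: "g \<in> carrier G" "c = N #> g" unfolding surj[symmetric] by blast
      have "g \<in> T closure_of (generate G (set xs))" using g dense by simp
      moreover have "openin T c" "g \<in> c" using g openin_r_coset[OF N(1)] rcos_self Ns by auto
      ultimately obtain y where y: "y \<in> generate G (set xs)" "y \<in> c" unfolding in_closure_of by blast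
      then have "N #> y = c" using g repr_independence[OF _ g(1) Ns] by auto
      then show "c \<in> (\<lambda>x. N #> x) ` generate G (set xs)" using y by blast
    qed
    then have gen: "generate (G Mod N) (set ?ys) = carrier (G Mod N)"
      using pi.generate_img[OF xs] generate_incl[OF xs] surj by auto
    obtain m where m: "lower_central (G Mod N) m \<subseteq> {\<one>\<^bsub>G Mod N\<^esub>}"
      using Q.p_group_nilpotent[OF ord prime_p] by blast
    have "set ?ys \<subseteq> carrier (G Mod N)" using xs pi.hom_closed by auto
    then have "lower_central (G Mod N) 1 \<subseteq> comm_products (G Mod N) (carrier (G Mod N)) ?ys"
      by (rule Q.nilpotent_derived_comm_products[OF _ gen m])
    moreover have "N #> h \<in> lower_central (G Mod N) 1" using pi.lower_central_img[of 1] h by blast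
    moreover have "comm_products (G Mod N) (carrier (G Mod N)) ?ys = (\<lambda>x. N #> x) ` ?C"
      using pi.comm_products_img[of "carrier G" xs] xs surj by simp
    ultimately obtain c where c: "c \<in> ?C" "N #> h = N #> c" by auto
    have cc: "c \<in> carrier G" using c comm_products_subset xs by blast
    \<comment> \<open>The coset equation puts \<open>c \<otimes> inv h\<close> in \<open>N\<close>,
      whereas \<open>N\<close> was chosen for products with \<open>h\<close> on the left;
      conjugation changes sides.\<close>
    have "c \<otimes> inv h \<in> N" using r_coset_eq_iff[OF Ns cc hc] c by simp
    then have "inv h \<otimes> (c \<otimes> inv h) \<otimes> h \<in> N" using normal.inv_op_closed1[OF N(2) hc] by blast
    moreover have "inv h \<otimes> (c \<otimes> inv h) \<otimes> h = inv h \<otimes> c" using hc cc by (simp add: m_assoc)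
    ultimately have "h \<otimes> (inv h \<otimes> c) \<notin> ?C" using N(3) by auto
    then show False using c hc cc by (simp add: m_assoc[symmetric])
  qed
  show "comm_products G (carrier G) xs \<subseteq> lower_central G 1" by (rule comm_products_derived[OF xs])
qed

theorem openin_power_comm_subgroup:
  assumes "0 < n"
  shows "openin T (power_comm_subgroup G n)"
proof -
  define V where "V = power_comm_subgroup G n"
  let ?C = "comm_products G (carrier G) xs"
  have V_eq: "V = (\<lambda>z. fst z \<otimes> snd z [^] n) ` (?C \<times> carrier G)"
    unfolding V_def power_comm_subgroup_eq derived_eq_comm_products by force
  have "compactin (prod_topology T T) (?C \<times> carrier G)"
    using compactin_comm_products[OF xs] compact by (simp add: compactin_Times compact_space_def topspace_eq[symmetric])
  moreover have "continuous_map (prod_topology T T) T (\<lambda>z. fst z \<otimes> snd z [^] n)"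
    by (intro continuous_map_mult continuous_map_pow continuous_map_fst continuous_map_snd)
  ultimately have "compactin T V" unfolding V_eq by (rule image_compactin)
  then have closed: "closedin T V" by (rule compactin_closedin)
  let ?A = "{u [^] n | u. u \<in> carrier G} \<union> {commutator G g y | g y. g \<in> carrier G \<and> y \<in> carrier G}"
  have V_gen: "V = generate G ?A" unfolding V_def power_comm_subgroup_def ..
  have A: "?A \<subseteq> carrier G" by auto
  have Vs: "subgroup V G" unfolding V_gen by (rule generate_is_subgroup[OF A])
  have VL: "lower_central G 1 \<subseteq> V"
    unfolding V_gen One_nat_def lower_central.simps by (intro mono_generate) auto
  have V: "V \<lhd> G"
  proof -
    have "x \<otimes> h \<otimes> inv x \<in> V" if x: "x \<in> carrier G" and h: "h \<in> V" for x h
    proof -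
      have hc: "h \<in> carrier G" using h Vs by (simp add: subgroup.mem_carrier)
      \<comment> \<open>Since x h x^-1 = [x, h] h, containing all commutators already forces
        normality.\<close>
      have "commutator G x h \<in> V" using VL lower_central_commutator[of x 0 h] x hc by auto
      then have "commutator G x h \<otimes> h \<in> V" using h Vs by (simp add: subgroup.m_closed)
      then show ?thesis using x hc by (simp add: commutator_def m_assoc)
    qed
    then show ?thesis using Vs by (simp add: normal_inv_iff)
  qed
  interpret Q: group "G Mod V" by (rule normal.factorgroup_is_group[OF V])
  interpret pi: group_hom G "G Mod V" "\<lambda>x. V #> x" by (rule group_hom_Mod[OF V])
  have piV: "V #> x = \<one>\<^bsub>G Mod V\<^esub>" if "x \<in> V" for x
    using that Vs by (metis coset_join2 one_FactGroup subgroup.mem_carrier)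
  have surj: "(\<lambda>x. V #> x) ` carrier G = carrier (G Mod V)" by (simp add: carrier_FactGroup)
  have comm: "comm_group (G Mod V)"
  proof (rule Q.group_comm_groupI)
    fix a b assume "a \<in> carrier (G Mod V)" "b \<in> carrier (G Mod V)"
    then obtain x y where xy: "x \<in> carrier G" "a = V #> x" "y \<in> carrier G" "b = V #> y"
      unfolding surj[symmetric] by blast
    have "commutator G x y \<in> V" unfolding V_gen using xy by (intro generate.incl) auto
    then have "commutator (G Mod V) a b = \<one>\<^bsub>G Mod V\<^esub>"
      using piV pi.hom_commutator[of x y] xy by simp
    then show "a \<otimes>\<^bsub>G Mod V\<^esub> b = b \<otimes>\<^bsub>G Mod V\<^esub> a"
      using Q.commutator_eq_one_iff[of a b] pi.hom_closed xy by simp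
  qed
  have "finite (generate (G Mod V) ((\<lambda>x. V #> x) ` set xs))"
  proof (rule comm_group.finite_generate_exponent[OF comm _ _ assms])
    show "(\<lambda>x. V #> x) ` set xs \<subseteq> carrier (G Mod V)" using xs pi.hom_closed by blast
    fix a assume "a \<in> (\<lambda>x. V #> x) ` set xs"
    then obtain x where x: "x \<in> carrier G" "a = V #> x" using xs by blast
    have "x [^] n \<in> V" unfolding V_gen using x by (intro generate.incl) auto
    then show "a [^]\<^bsub>G Mod V\<^esub> n = \<one>\<^bsub>G Mod V\<^esub>" using piV x pi.hom_nat_pow by metis
  qed simp
  moreover define F where "F = (\<lambda>x. V #> x) ` generate G (set xs)"
  ultimately have fin: "finite F" using pi.generate_img[OF xs] by simp
  have Fr: "F \<subseteq> rcosets V" using generate_incl[OF xs] unfolding F_def by (auto simp: RCOSETS_def)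
  have cl: "closedin T c" if "c \<in> F" for c
    using that closedin_r_coset[OF closed] generate_incl[OF xs] unfolding F_def by blast
  \<comment> \<open>The finitely many cosets in \<open>F\<close> are closed and cover a dense
    subgroup, so they cover the group; \<open>V\<close> is then the complement of the remaining
    ones.\<close>
  have "generate G (set xs) \<subseteq> \<Union>F"
  proof
    fix x assume x: "x \<in> generate G (set xs)"
    then have "x \<in> V #> x" using generate_incl[OF xs] by (intro rcos_self[OF _ Vs]) blast
    then show "x \<in> \<Union>F" using x unfolding F_def by blast
  qed
  moreover have "closedin T (\<Union>F)" using fin cl by (rule closedin_Union)
  ultimately have "T closure_of (generate G (set xs)) \<subseteq> \<Union>F" by (rule closure_of_minimal)
  then have cov: "carrier G \<subseteq> \<Union>F" using dense by simp
  have "V \<in> rcosets V" using Vs by (simp add: subgroup.subgroup_in_rcosets)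
  then have disj: "c \<inter> V = {}" if "c \<in> F - {V}" for c
    using that Fr rcos_disjoint[OF Vs] \<open>V \<in> rcosets V\<close> unfolding pairwise_def disjnt_def by blast
  have "V = carrier G - \<Union>(F - {V})"
  proof (intro subset_antisym subsetI)
    fix x assume "x \<in> V"
    then show "x \<in> carrier G - \<Union>(F - {V})" using disj subgroup.mem_carrier[OF Vs] by blast
  next
    fix x assume x: "x \<in> carrier G - \<Union>(F - {V})"
    then obtain c where "c \<in> F" "x \<in> c" using cov by blast
    then show "x \<in> V" using x by blast
  qed
  moreover have "closedin T (\<Union>(F - {V}))" using fin cl by (intro closedin_Union) auto
  ultimately show ?thesis unfolding V_def[symmetric] by (metis openin_diff openin_topspace topspace_eq)
qed

end

text \<open>The syntactic congruence class of the identity: two-sided translations make it normal, not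
  merely a subgroup.\<close>
definition translation_stabilizer :: "('a, 'b) monoid_scheme \<Rightarrow> 'a set \<Rightarrow> 'a set" where
  "translation_stabilizer G B = {g \<in> carrier G. \<forall>a\<in>carrier G. \<forall>b\<in>carrier G.
     a \<otimes>\<^bsub>G\<^esub> b \<in> B \<longleftrightarrow> a \<otimes>\<^bsub>G\<^esub> g \<otimes>\<^bsub>G\<^esub> b \<in> B}"

lemma (in group) translation_stabilizer_normal: "translation_stabilizer G B \<lhd> G"
proof -
  let ?N = "translation_stabilizer G B"
  have D: "a \<otimes> g \<otimes> b \<in> B \<longleftrightarrow> a \<otimes> b \<in> B"
    if "g \<in> ?N" "a \<in> carrier G" "b \<in> carrier G" for g a b
    using that unfolding translation_stabilizer_def by blast
  have I: "g \<in> ?N" if "g \<in> carrier G" "\<And>a b. a \<in> carrier G \<Longrightarrow> b \<in> carrier G \<Longrightarrow> a \<otimes> g \<otimes> b \<in> B \<longleftrightarrow> a \<otimes> b \<in> B" for g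
    using that unfolding translation_stabilizer_def by blast
  have Nc: "g \<in> carrier G" if "g \<in> ?N" for g using that unfolding translation_stabilizer_def by blast
  have "subgroup ?N G"
  proof
    show "?N \<subseteq> carrier G" using Nc by blast
    show "\<one> \<in> ?N" by (rule I) auto
    show "g \<otimes> h \<in> ?N" if "g \<in> ?N" "h \<in> ?N" for g h
    proof (rule I)
      show "g \<otimes> h \<in> carrier G" using that Nc by simp
      fix a b assume ab: "a \<in> carrier G" "b \<in> carrier G"
      have "a \<otimes> (g \<otimes> h) \<otimes> b = a \<otimes> g \<otimes> h \<otimes> b" using ab that Nc by (simp add: m_assoc)
      then show "a \<otimes> (g \<otimes> h) \<otimes> b \<in> B \<longleftrightarrow> a \<otimes> b \<in> B" using D[of h "a \<otimes> g" b] D[of g a b] ab that Nc by simp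
    qed
    show "inv g \<in> ?N" if g: "g \<in> ?N" for g
    proof (rule I)
      show "inv g \<in> carrier G" using g Nc by simp
      fix a b assume ab: "a \<in> carrier G" "b \<in> carrier G"
      have "a \<otimes> inv g \<otimes> g \<otimes> b = a \<otimes> b" using ab g Nc by (simp add: m_assoc)
      then show "a \<otimes> inv g \<otimes> b \<in> B \<longleftrightarrow> a \<otimes> b \<in> B" using D[of g "a \<otimes> inv g" b] ab g Nc by simp
    qed
  qed
  moreover have "x \<otimes> g \<otimes> inv x \<in> ?N" if x: "x \<in> carrier G" and g: "g \<in> ?N" for x g
  proof (rule I)
    show "x \<otimes> g \<otimes> inv x \<in> carrier G" using g x Nc by simp
    fix a b assume ab: "a \<in> carrier G" "b \<in> carrier G"
    have "a \<otimes> (x \<otimes> g \<otimes> inv x) \<otimes> b = (a \<otimes> x) \<otimes> g \<otimes> (inv x \<otimes> b)" using ab x g Nc by (simp add: m_assoc)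
    moreover have "(a \<otimes> x) \<otimes> (inv x \<otimes> b) = a \<otimes> b" using ab x by (metis inv_closed l_one m_assoc m_closed r_inv)
    ultimately show "a \<otimes> (x \<otimes> g \<otimes> inv x) \<otimes> b \<in> B \<longleftrightarrow> a \<otimes> b \<in> B"
      using D[of g "a \<otimes> x" "inv x \<otimes> b"] ab g x Nc by simp
  qed
  ultimately show ?thesis by (simp add: normal_inv_iff)
qed

lemma (in group) translation_stabilizer_mult:
  assumes "B \<subseteq> carrier G" "x \<in> carrier G" "g \<in> translation_stabilizer G B"
  shows "x \<otimes> g \<in> B \<longleftrightarrow> x \<in> B"
proof -
  have "x \<otimes> \<one> \<in> B \<longleftrightarrow> x \<otimes> g \<otimes> \<one> \<in> B" "g \<in> carrier G"
    using assms unfolding translation_stabilizer_def by blast+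
  then show ?thesis using assms by simp
qed

text \<open>The complement is the projection of the closed set \<open>Z\<close> of triples ((a, b),
  g) violating the condition, and projection along a compact factor is a closed map. Closedness of
  \<open>Z\<close> uses that both \<open>B\<close> and its complement are closed.\<close>

lemma (in compact_group) openin_translation_stabilizer:
  assumes "openin T B" "closedin T B"
  shows "openin T (translation_stabilizer G B)"
proof -
  let ?TT = "prod_topology (prod_topology T T) T"
  let ?f = "\<lambda>z. fst (fst z) \<otimes> snd (fst z)" and ?h = "\<lambda>z. fst (fst z) \<otimes> snd z \<otimes> snd (fst z)"
  have c1: "continuous_map ?TT T (\<lambda>z. fst (fst z))" "continuous_map ?TT T (\<lambda>z. snd (fst z))" "continuous_map ?TT T (\<lambda>z. snd z)"
    using continuous_map_compose[OF continuous_map_fst continuous_map_fst, of T T T, unfolded o_def]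
      continuous_map_compose[OF continuous_map_fst continuous_map_snd, of T T T, unfolded o_def]
      continuous_map_snd[of "prod_topology T T" T] by auto
  have f: "continuous_map ?TT T ?f" and h: "continuous_map ?TT T ?h"
    by (intro continuous_map_mult c1)+
  have B': "closedin T (topspace T - B)" using assms by blast
  define Z where "Z = ({z \<in> topspace ?TT. ?f z \<in> B} \<inter> {z \<in> topspace ?TT. ?h z \<in> topspace T - B})
      \<union> ({z \<in> topspace ?TT. ?f z \<in> topspace T - B} \<inter> {z \<in> topspace ?TT. ?h z \<in> B})"
  have "closedin ?TT Z" unfolding Z_def
    by (intro closedin_Un closedin_Int closedin_continuous_map_preimage[OF f] closedin_continuous_map_preimage[OF h] assms B')
  moreover have "compact_space (prod_topology T T)" using compact by (simp add: compact_space_prod_topology)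
  ultimately have cl: "closedin T (snd ` Z)" using closed_map_snd closed_map_def by blast
  have "translation_stabilizer G B = topspace T - snd ` Z"
  proof (intro subset_antisym subsetI)
    fix g assume "g \<in> translation_stabilizer G B"
    then show "g \<in> topspace T - snd ` Z"
      unfolding translation_stabilizer_def Z_def by (auto simp: topspace_eq)
  next
    fix g assume g: "g \<in> topspace T - snd ` Z"
    then have gc: "g \<in> carrier G" by (simp add: topspace_eq)
    have "a \<otimes> b \<in> B \<longleftrightarrow> a \<otimes> g \<otimes> b \<in> B" if ab: "a \<in> carrier G" "b \<in> carrier G" for a b
    proof -
      have "((a, b), g) \<notin> Z" using g by force
      then show ?thesis using ab gc unfolding Z_def by (auto simp: topspace_eq)
    qed
    then show "g \<in> translation_stabilizer G B" unfolding translation_stabilizer_def using gc by blast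
  qed
  then show ?thesis using cl by auto
qed

section \<open>Neighbourhood bases of pro-p groups and their open subgroups\<close>

text \<open>In a compact Hausdorff space components are quasi-components, so clopen sets separate
  \<open>x\<close> from every other point; compactness of the complement of \<open>W\<close> leaves
  finitely many of them to intersect.\<close>

lemma clopen_neighbourhood:
  assumes T: "compact_space T" "Hausdorff_space T"
    and td: "connected_component_of_set T x = {x}" and W: "openin T W" "x \<in> W"
  shows "\<exists>B. openin T B \<and> closedin T B \<and> x \<in> B \<and> B \<subseteq> W"
proof -
  define \<C> where "\<C> = {C. openin T C \<and> closedin T C \<and> x \<in> C}"
  have x: "x \<in> topspace T" using W openin_subset by blast
  have q: "quasi_component_of T x = connected_component_of T x"
    using T by (intro quasi_eq_connected_component_of) auto
  have sep: "\<exists>C\<in>\<C>. y \<notin> C" if "y \<in> topspace T" "y \<noteq> x" for y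
  proof -
    have "y \<notin> connected_component_of_set T x" using td that by simp
    then have "\<not> quasi_component_of T x y" using q by simp
    then obtain C where C: "closedin T C" "openin T C" "(x \<in> C) \<noteq> (y \<in> C)"
      unfolding quasi_component_of_def using x that by blast
    show ?thesis
    proof (cases "x \<in> C")
      case True
      then show ?thesis using C unfolding \<C>_def by blast
    next
      case False
      then have "topspace T - C \<in> \<C>" "y \<notin> topspace T - C" using C x unfolding \<C>_def by auto
      then show ?thesis by blast
    qed
  qed
  have "compactin T (topspace T - W)" using T W by (intro closedin_compact_space) auto
  moreover have "topspace T - W \<subseteq> \<Union>((\<lambda>C. topspace T - C) ` \<C>)"
  proof
    fix y assume y: "y \<in> topspace T - W"
    then obtain C where "C \<in> \<C>" "y \<notin> C" using sep W by blast
    then show "y \<in> \<Union>((\<lambda>C. topspace T - C) ` \<C>)" using y by blast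
  qed
  moreover have "\<And>U. U \<in> (\<lambda>C. topspace T - C) ` \<C> \<Longrightarrow> openin T U" unfolding \<C>_def by auto
  ultimately obtain F where F: "finite F" "F \<subseteq> (\<lambda>C. topspace T - C) ` \<C>" "topspace T - W \<subseteq> \<Union>F"
    unfolding compactin_def by meson
  then obtain D where D: "finite D" "D \<subseteq> \<C>" "F = (\<lambda>C. topspace T - C) ` D"
    by (meson finite_subset_image)
  \<comment> \<open>\<open>D\<close> may be empty, and then \<open>\<Inter>D\<close> is
    \<open>UNIV\<close>; hence the intersection with the space.\<close>
  define B where "B = topspace T \<inter> \<Inter>D"
  have B_eq: "B = \<Inter>(insert (topspace T) D)" unfolding B_def by blast
  have "openin T B" unfolding B_eq using D unfolding \<C>_def by (intro openin_Inter) auto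
  moreover have "closedin T B" unfolding B_eq using D unfolding \<C>_def by (intro closedin_Inter) auto
  moreover have "x \<in> B" unfolding B_def using D x unfolding \<C>_def by blast
  moreover have "B \<subseteq> W"
  proof
    fix y assume y: "y \<in> B"
    then show "y \<in> W" using F(3) D(3) unfolding B_def by blast
  qed
  ultimately show ?thesis by blast
qed

lemma profinite_compact_group:
  "profinite_group G T \<Longrightarrow> compact_group G T"
  unfolding profinite_group_def compact_group_def compact_group_axioms_def by simp

text \<open>The translation stabilizer of a clopen \<open>B\<close> around the identity lies in
  \<open>B\<close>, because translating the identity by it does not leave \<open>B\<close>. It is
  open and normal, so the pro-p hypothesis supplies its index.\<close>

lemma pro_p_open_normal_basis:
  assumes G: "pro_p_group p G T" and W: "openin T W" "\<one>\<^bsub>G\<^esub> \<in> W"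
  shows "\<exists>N k. openin T N \<and> N \<lhd> G \<and> N \<subseteq> W \<and> card (rcosets\<^bsub>G\<^esub> N) = p ^ k"
proof -
  have pf: "profinite_group G T" using G by (simp add: pro_p_group_def)
  interpret compact_group G T using profinite_compact_group[OF pf] .
  have "connected_component_of_set T \<one>\<^bsub>G\<^esub> = {\<one>\<^bsub>G\<^esub>}"
    using pf one_closed unfolding profinite_group_def by blast
  then obtain B where B: "openin T B" "closedin T B" "\<one>\<^bsub>G\<^esub> \<in> B" "B \<subseteq> W"
    using clopen_neighbourhood[OF compact hausdorff _ W] by blast
  have Bc: "B \<subseteq> carrier G" using B(1) openin_subset topspace_eq by metis
  let ?N = "translation_stabilizer G B"
  have "?N \<subseteq> W"
  proof
    fix g assume g: "g \<in> ?N"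
    then have "g \<in> carrier G" unfolding translation_stabilizer_def by blast
    then show "g \<in> W" using translation_stabilizer_mult[OF Bc one_closed g] B by auto
  qed
  moreover have "openin T ?N" using openin_translation_stabilizer[OF B(1,2)] .
  moreover have "?N \<lhd> G" by (rule translation_stabilizer_normal)
  ultimately show ?thesis using G unfolding pro_p_group_def by blast
qed

lemma (in compact_group) compact_group_open_subgroup:
  assumes "openin T U" "subgroup U G"
  shows "compact_group (G\<lparr>carrier := U\<rparr>) (subtopology T U)"
proof -
  have U: "U \<subseteq> topspace T" using assms openin_subset by blast
  have "compactin T U" using closedin_compact_space[OF compact] open_subgroup_closed[OF assms] by blast
  moreover have "group (G\<lparr>carrier := U\<rparr>)" using assms by (simp add: subgroup_imp_group)
  moreover have "continuous_map (prod_topology (subtopology T U) (subtopology T U)) (subtopology T U) (\<lambda>x. fst x \<otimes> snd x)"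
    unfolding continuous_map_in_subtopology prod_topology_subtopology subtopology_subtopology
    using mult_cont U assms(2)
    by (auto intro!: continuous_map_from_subtopology simp: subgroup.m_closed)
  moreover have "continuous_map (subtopology T U) (subtopology T U) (\<lambda>x. inv\<^bsub>G\<lparr>carrier := U\<rparr>\<^esub> x)"
  proof (rule continuous_map_eq)
    show "continuous_map (subtopology T U) (subtopology T U) (\<lambda>x. inv x)"
      unfolding continuous_map_in_subtopology
      using inv_cont U assms(2) by (auto intro: continuous_map_from_subtopology simp: subgroup.m_inv_closed)
    show "inv x = inv\<^bsub>G\<lparr>carrier := U\<rparr>\<^esub> x" if "x \<in> topspace (subtopology T U)" for x
      using that U assms(2) by simp
  qed
  ultimately show ?thesis using U hausdorff
    by (simp add: compact_group_def compact_group_axioms_def compact_space_subtopology Hausdorff_space_subtopology inf.absorb2)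
qed

text \<open>The minimality clause is the form in which \<open>V\<close> is applied: \<open>K\<close>
  will be the subgroup of \<open>U\<close> where a given cocycle vanishes, or where u \<otimes> m is
  a boundary, and nothing topological is known about it.\<close>

theorem pro_p_open_power_comm:
  fixes G (structure) and n :: nat
  assumes G: "pro_p_group p G T" and fg: "topologically_finitely_generated G T"
    and U: "openin T U" "U \<lhd> G" and n: "0 < n"
  shows "\<exists>V. openin T V \<and> V \<lhd> G \<and> V \<subseteq> U \<and>
    (\<forall>K. subgroup K G \<longrightarrow> (\<forall>u\<in>U. u [^]\<^bsub>G\<^esub> n \<in> K) \<longrightarrow> (\<forall>u\<in>U. \<forall>w\<in>U. commutator G u w \<in> K) \<longrightarrow> V \<subseteq> K)"
proof -
  have pf: "profinite_group G T" and p: "Factorial_Ring.prime p" using G by (simp_all add: pro_p_group_def)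
  interpret compact_group G T using profinite_compact_group[OF pf] .
  have Us: "subgroup U G" using U by (simp add: normal_imp_subgroup)
  have UT: "U \<subseteq> topspace T" and Uc: "U \<subseteq> carrier G" using U(1) openin_subset topspace_eq by metis+
  let ?H = "G\<lparr>carrier := U\<rparr>" and ?T = "subtopology T U"
  obtain S where S: "finite S" "S \<subseteq> carrier G" "T closure_of (generate G S) = carrier G"
    using fg unfolding topologically_finitely_generated_def by blast
  obtain S' where S': "finite S'" "S' \<subseteq> U" "U \<inter> generate G S = generate G S'"
    using schreier_finitely_generated[OF Us open_subgroup_finite_rcosets[OF U(1) Us] S(1,2)] by blast
  obtain xs where xs: "set xs = S'" using S'(1) finite_list by blast
  interpret H: compact_group ?H ?T by (rule compact_group_open_subgroup[OF U(1) Us])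
  interpret H: finitely_generated_pro_p ?H ?T p xs
  proof
    show "Factorial_Ring.prime p" by fact
    show "set xs \<subseteq> carrier ?H" using xs S' by simp
    \<comment> \<open>Density is inherited by \<open>U\<close> because \<open>U\<close> is
      open.\<close>
    have "U \<subseteq> T closure_of (U \<inter> generate G S)"
      using openin_Int_closure_of_subset[OF U(1), of "generate G S"] S(3) Uc by blast
    then show "?T closure_of (generate ?H (set xs)) = carrier ?H"
      using generate_consistent[OF S'(2) Us] S'(3) closure_of_subtopology_open[of T U] U(1) xs by auto
    fix W assume W: "openin ?T W" "\<one>\<^bsub>?H\<^esub> \<in> W"
    have WT: "openin T W" "W \<subseteq> U" using W U(1) by (auto simp: openin_open_subtopology)
    then obtain N k where N: "openin T N" "N \<lhd> G" "N \<subseteq> W" "card (rcosets N) = p ^ k"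
      using pro_p_open_normal_basis[OF G WT(1)] W by auto
    have NU: "N \<subseteq> U" using N WT by blast
    interpret Q: group "G Mod N" by (rule normal.factorgroup_is_group[OF N(2)])
    interpret pi: group_hom G "G Mod N" "\<lambda>x. N #> x" by (rule group_hom_Mod[OF N(2)])
    \<comment> \<open>The index of \<open>N\<close> in \<open>U\<close> is the order of a subgroup
      of \<open>G Mod N\<close>, hence divides a power of \<open>p\<close>.\<close>
    have "subgroup ((\<lambda>x. N #> x) ` U) (G Mod N)" by (rule pi.subgroup_img_is_subgroup[OF Us])
    then have "card ((\<lambda>x. N #> x) ` U) dvd order (G Mod N)"
      using Q.lagrange by (metis dvd_triv_right)
    moreover have "order (G Mod N) = p ^ k" using N(4) by (simp add: order_def FactGroup_def)
    moreover have "rcosets\<^bsub>?H\<^esub> N = (\<lambda>x. N #> x) ` U" by (auto simp: RCOSETS_def r_coset_def)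
    ultimately have "\<exists>j. card (rcosets\<^bsub>?H\<^esub> N) = p ^ j" using divides_primepow_nat[OF p] by auto
    moreover have "openin ?T N" using N NU U(1) by (simp add: openin_open_subtopology)
    moreover have "N \<lhd> ?H" using normal_restrict_supergroup[OF Us N(2) NU] .
    ultimately show "\<exists>N k. openin ?T N \<and> N \<lhd> ?H \<and> N \<subseteq> W \<and> card (rcosets\<^bsub>?H\<^esub> N) = p ^ k"
      using N by blast
  qed
  define V where "V = power_comm_subgroup ?H n"
  let ?A = "{u [^] n | u. u \<in> U} \<union> {commutator G g y | g y. g \<in> U \<and> y \<in> U}"
  have Vopen: "openin T V"
    using H.openin_power_comm_subgroup[OF n] U(1) unfolding V_def by (simp add: openin_open_subtopology)
  have comm_eq: "commutator ?H g y = commutator G g y" if "g \<in> U" "y \<in> U" for g y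
    using that Us by (simp add: commutator_def)
  have A: "?A \<subseteq> U"
  proof -
    have "commutator G g y \<in> U" if "g \<in> U" "y \<in> U" for g y
      using that Us by (simp add: commutator_def subgroup.m_closed subgroup.m_inv_closed)
    moreover have "u [^] n \<in> U" if "u \<in> U" for u
      using H.nat_pow_closed[of u n] that by (simp add: nat_pow_consistent[symmetric])
    ultimately show ?thesis by blast
  qed
  have "V = generate ?H ?A"
  proof -
    have "{commutator ?H g y | g y. g \<in> U \<and> y \<in> U} = {commutator G g y | g y. g \<in> U \<and> y \<in> U}"
      using comm_eq by metis
    then show ?thesis unfolding V_def power_comm_subgroup_def by (simp add: nat_pow_consistent[symmetric])
  qed
  then have V: "V = generate G ?A" using generate_consistent[OF A Us] by simp
  have "V \<lhd> G" unfolding V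
  proof (rule normal_generateI)
    show "?A \<subseteq> carrier G" using A Uc by blast
    fix h x assume h: "h \<in> ?A" and x: "x \<in> carrier G"
    \<comment> \<open>Conjugation by any element of \<open>G\<close> is an endomorphism preserving
      \<open>U\<close>, so it preserves the shape of the generators. This gives normality in
      \<open>G\<close>, not just in \<open>U\<close>.\<close>
    interpret c: group_hom G G "\<lambda>y. x \<otimes> y \<otimes> inv x"
    proof
      show "(\<lambda>y. x \<otimes> y \<otimes> inv x) \<in> hom G G"
      proof (rule homI)
        fix a b assume ab: "a \<in> carrier G" "b \<in> carrier G"
        have "inv x \<otimes> (x \<otimes> (b \<otimes> inv x)) = b \<otimes> inv x"
          using ab x by (metis inv_closed l_inv l_one m_assoc m_closed)
        then show "x \<otimes> (a \<otimes> b) \<otimes> inv x = x \<otimes> a \<otimes> inv x \<otimes> (x \<otimes> b \<otimes> inv x)"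
          using ab x by (simp add: m_assoc)
      qed (use x in auto)
    qed
    have cU: "x \<otimes> u \<otimes> inv x \<in> U" if "u \<in> U" for u
      using normal.inv_op_closed2[OF U(2) x that] .
    from h show "x \<otimes> h \<otimes> inv x \<in> ?A"
    proof
      assume "h \<in> {u [^] n | u. u \<in> U}"
      then obtain u where u: "u \<in> U" "h = u [^] n" by blast
      then have "x \<otimes> h \<otimes> inv x = (x \<otimes> u \<otimes> inv x) [^] n" using c.hom_nat_pow[of u n] Uc by auto
      then show ?thesis using cU[OF u(1)] by blast
    next
      assume "h \<in> {commutator G g y | g y. g \<in> U \<and> y \<in> U}"
      then obtain g y where gy: "g \<in> U" "y \<in> U" "h = commutator G g y" by blast
      then have "x \<otimes> h \<otimes> inv x = commutator G (x \<otimes> g \<otimes> inv x) (x \<otimes> y \<otimes> inv x)"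
        using c.hom_commutator[of g y] Uc by auto
      then show ?thesis using cU gy by blast
    qed
  qed
  moreover have "V \<subseteq> U" unfolding V by (rule generate_subgroup_incl[OF A Us])
  moreover have "V \<subseteq> K" if "subgroup K G" "\<forall>u\<in>U. u [^] n \<in> K" "\<forall>u\<in>U. \<forall>w\<in>U. commutator G u w \<in> K" for K
    unfolding V using that by (intro generate_subgroup_incl) auto
  ultimately show ?thesis using Vopen by blast
qed

section \<open>Finite modules and first cohomology\<close>

definition add_subgroup :: "'b::ab_group_add set \<Rightarrow> bool" where
  "add_subgroup B \<longleftrightarrow> 0 \<in> B \<and> (\<forall>x\<in>B. \<forall>y\<in>B. x - y \<in> B)"

lemma add_subgroupD:
  assumes "add_subgroup B"
  shows "0 \<in> B" "x \<in> B \<Longrightarrow> y \<in> B \<Longrightarrow> x - y \<in> B" "x \<in> B \<Longrightarrow> - x \<in> B"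
    "x \<in> B \<Longrightarrow> y \<in> B \<Longrightarrow> x + y \<in> B"
proof -
  show 0: "0 \<in> B" and d: "x \<in> B \<Longrightarrow> y \<in> B \<Longrightarrow> x - y \<in> B" for x y
    using assms by (auto simp: add_subgroup_def)
  show m: "x \<in> B \<Longrightarrow> - x \<in> B" for x using d[OF 0] by simp
  show "x \<in> B \<Longrightarrow> y \<in> B \<Longrightarrow> x + y \<in> B" using d[OF _ m] by fastforce
qed

lemma add_subgroup_sum:
  assumes "add_subgroup B" "\<And>i. i \<in> I \<Longrightarrow> f i \<in> B"
  shows "sum f I \<in> B"
  using assms(2) by (induction I rule: infinite_finite_induct) (auto intro: add_subgroupD[OF assms(1)])

lemma add_coset_eq_iff:
  assumes "add_subgroup B"
  shows "(\<lambda>b. z + b) ` B = (\<lambda>b. z' + b) ` B \<longleftrightarrow> z - z' \<in> B"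
proof
  assume "(\<lambda>b. z + b) ` B = (\<lambda>b. z' + b) ` B"
  moreover have "z + 0 \<in> (\<lambda>b. z + b) ` B" using add_subgroupD(1)[OF assms] by blast
  ultimately obtain b where "b \<in> B" "z = z' + b" by auto
  then show "z - z' \<in> B" by simp
next
  have *: "(\<lambda>b. z + b) ` B \<subseteq> (\<lambda>b. z' + b) ` B" if "z - z' \<in> B" for z z'
  proof
    fix w assume "w \<in> (\<lambda>b. z + b) ` B"
    then obtain b where b: "b \<in> B" "w = z + b" by blast
    then have "w = z' + ((z - z') + b)" by simp
    moreover have "(z - z') + b \<in> B" using b that add_subgroupD[OF assms] by blast
    ultimately show "w \<in> (\<lambda>b. z' + b) ` B" by blast
  qed
  assume zz: "z - z' \<in> B"
  moreover have "z' - z \<in> B" using add_subgroupD(3)[OF assms zz] by simp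
  ultimately show "(\<lambda>b. z + b) ` B = (\<lambda>b. z' + b) ` B" using * by blast
qed

text \<open>\<open>SOME\<close> picks an arbitrary representative; \<open>compat\<close> makes the
  choice irrelevant. The hypotheses speak of differences because \<open>D\<close> is not assumed
  additive: for \<open>dirac1\<close> additivity is established only on functions of finite
  support.\<close>

lemma bij_betw_add_cosets:
  assumes A: "add_subgroup A" and B: "add_subgroup B"
    and dom: "\<And>z. z \<in> Z \<Longrightarrow> D z \<in> Y"
    and compat: "\<And>z a. z \<in> Z \<Longrightarrow> a \<in> A \<Longrightarrow> D (z + a) - D z \<in> B"
    and inj: "\<And>z z'. z \<in> Z \<Longrightarrow> z' \<in> Z \<Longrightarrow> D z - D z' \<in> B \<Longrightarrow> z - z' \<in> A"
    and surj: "\<And>y. y \<in> Y \<Longrightarrow> \<exists>z\<in>Z. y - D z \<in> B"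
  shows "bij_betw (\<lambda>C. (\<lambda>b. D (SOME c. c \<in> C) + b) ` B) ((\<lambda>z. (\<lambda>a. z + a) ` A) ` Z) ((\<lambda>y. (\<lambda>b. y + b) ` B) ` Y)"
    (is "bij_betw ?\<phi> ?X ?W")
proof -
  have eq: "?\<phi> ((\<lambda>a. z + a) ` A) = (\<lambda>b. D z + b) ` B" if z: "z \<in> Z" for z
  proof -
    have "z + 0 \<in> (\<lambda>a. z + a) ` A" using add_subgroupD(1)[OF A] by blast
    then have "(SOME c. c \<in> (\<lambda>a. z + a) ` A) \<in> (\<lambda>a. z + a) ` A" by (rule someI)
    then obtain a where "a \<in> A" "(SOME c. c \<in> (\<lambda>a. z + a) ` A) = z + a" by blast
    then show ?thesis using compat[OF z] add_coset_eq_iff[OF B] by simp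
  qed
  show ?thesis
  proof (rule bij_betw_imageI)
    show "inj_on ?\<phi> ?X"
    proof (rule inj_onI)
      fix C C' assume "C \<in> ?X" "C' \<in> ?X" and e: "?\<phi> C = ?\<phi> C'"
      then obtain z z' where z: "z \<in> Z" "C = (\<lambda>a. z + a) ` A" "z' \<in> Z" "C' = (\<lambda>a. z' + a) ` A" by blast
      have "(\<lambda>b. D z + b) ` B = (\<lambda>b. D z' + b) ` B" using e eq[OF z(1)] eq[OF z(3)] unfolding z(2,4) by simp
      then have "z - z' \<in> A" using inj z add_coset_eq_iff[OF B] by blast
      then show "C = C'" unfolding z(2,4) using add_coset_eq_iff[OF A] by blast
    qed
    have "?\<phi> ` ?X = (\<lambda>z. (\<lambda>b. D z + b) ` B) ` Z" unfolding image_image using eq by (rule image_cong[OF refl])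
    also have "\<dots> = ?W"
    proof (intro subset_antisym subsetI)
      fix w assume "w \<in> (\<lambda>z. (\<lambda>b. D z + b) ` B) ` Z"
      then show "w \<in> ?W" using dom by blast
    next
      fix w assume "w \<in> ?W"
      then obtain y where y: "y \<in> Y" "w = (\<lambda>b. y + b) ` B" by blast
      then obtain z where "z \<in> Z" "y - D z \<in> B" using surj by blast
      then show "w \<in> (\<lambda>z. (\<lambda>b. D z + b) ` B) ` Z" using y add_coset_eq_iff[OF B] by blast
    qed
    finally show "?\<phi> ` ?X = ?W" .
  qed
qed

text \<open>Translation by \<open>m\<close> permutes the finite type; comparing the sums over all
  elements cancels everything but |M| m. The multiple is written as a constant sum, since
  \<open>ab_group_add\<close> has no scalars.\<close>

lemma sum_const_card_UNIV: "(\<Sum>i<CARD('m). m) = (0 :: 'm::{finite,ab_group_add})"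
proof -
  have "(\<Sum>x\<in>UNIV. x) = (\<Sum>x\<in>UNIV. x + m)"
    by (rule sum.reindex_bij_witness[of _ "\<lambda>x. x + m" "\<lambda>x. x - m"]) auto
  then have "(\<Sum>x\<in>(UNIV::'m set). m) = 0" by (simp add: sum.distrib)
  moreover obtain h where "bij_betw h {0..<CARD('m)} (UNIV::'m set)"
    using ex_bij_betw_nat_finite[of "UNIV::'m set"] by auto
  then have "(\<Sum>i\<in>{0..<CARD('m)}. m) = (\<Sum>x\<in>(UNIV::'m set). m)"
    by (rule sum.reindex_bij_betw)
  ultimately show ?thesis by (simp add: lessThan_atLeast0)
qed

text \<open>Modulo \<open>B\<close> the map \<open>F\<close> is a homomorphism from \<open>U\<close>
  to an abelian group, with image killed by \<open>n\<close>. Working modulo \<open>B\<close> covers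
  cocycles, with \<open>B\<close> trivial, and 1-chains, with \<open>B\<close> the
  boundaries.\<close>

lemma (in group) additive_mod_subset:
  fixes F :: "'a \<Rightarrow> 'c::ab_group_add" and n :: nat
  assumes B: "add_subgroup B" and U: "subgroup U G"
    and F: "\<And>u w. u \<in> U \<Longrightarrow> w \<in> U \<Longrightarrow> F (u \<otimes> w) - F u - F w \<in> B"
    and n: "\<And>u. u \<in> U \<Longrightarrow> (\<Sum>i<n. F u) \<in> B"
  shows "subgroup {u \<in> U. F u \<in> B} G" "\<forall>u\<in>U. u [^] n \<in> {u \<in> U. F u \<in> B}"
    "\<forall>u\<in>U. \<forall>w\<in>U. commutator G u w \<in> {u \<in> U. F u \<in> B}"
proof -
  note U' = subgroup.m_closed[OF U] subgroup.m_inv_closed[OF U] subgroup.one_closed[OF U]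
  note Uc = subgroup.mem_carrier[OF U]
  note B' = add_subgroupD[OF B]
  have one: "F \<one> \<in> B" using B'(3)[OF F[OF U'(3) U'(3)]] by simp
  show "subgroup {u \<in> U. F u \<in> B} G"
  proof
    show "{u \<in> U. F u \<in> B} \<subseteq> carrier G" using Uc by blast
    show "\<one> \<in> {u \<in> U. F u \<in> B}" using one U' by simp
    show "x \<otimes> y \<in> {u \<in> U. F u \<in> B}" if "x \<in> {u \<in> U. F u \<in> B}" "y \<in> {u \<in> U. F u \<in> B}" for x y
    proof -
      have "F (x \<otimes> y) = (F (x \<otimes> y) - F x - F y) + (F x + F y)" by simp
      then have "F (x \<otimes> y) \<in> B" using that F[of x y] B'(4) by (metis (no_types, lifting) mem_Collect_eq)
      then show ?thesis using that U' by simp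
    qed
    show "inv x \<in> {u \<in> U. F u \<in> B}" if "x \<in> {u \<in> U. F u \<in> B}" for x
    proof -
      have "F \<one> - F x - F (inv x) \<in> B" using F[of x "inv x"] that U' Uc by simp
      moreover have "F \<one> - F x \<in> B" using that one B' by blast
      ultimately have "(F \<one> - F x) - (F \<one> - F x - F (inv x)) \<in> B" using B'(2) by blast
      then have "F (inv x) \<in> B" by simp
      then show ?thesis using that U' by simp
    qed
  qed
  show "\<forall>u\<in>U. u [^] n \<in> {u \<in> U. F u \<in> B}"
  proof
    fix u assume u: "u \<in> U"
    have "u [^] k \<in> U \<and> F (u [^] k) - (\<Sum>i<k. F u) \<in> B" for k :: nat
    proof (induction k)
      case 0
      then show ?case using one U' by simp
    next
      case (Suc k)
      then have "(F (u [^] k \<otimes> u) - F (u [^] k) - F u) + (F (u [^] k) - (\<Sum>i<k. F u)) \<in> B"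
        using F u B'(4) by blast
      then show ?case using Suc u U' by (simp add: algebra_simps)
    qed
    then have "u [^] n \<in> U" "F (u [^] n) - (\<Sum>i<n. F u) \<in> B" by auto
    then have "u [^] n \<in> U" "(F (u [^] n) - (\<Sum>i<n. F u)) + (\<Sum>i<n. F u) \<in> B"
      using B'(4)[OF _ n[OF u]] by blast+
    then show "u [^] n \<in> {u \<in> U. F u \<in> B}" by simp
  qed
  show "\<forall>u\<in>U. \<forall>w\<in>U. commutator G u w \<in> {u \<in> U. F u \<in> B}"
  proof (intro ballI)
    fix u w assume uw: "u \<in> U" "w \<in> U"
    let ?c = "commutator G u w"
    have c: "?c \<in> U" using uw U' by (simp add: commutator_def)
    \<comment> \<open>From uw = [u, w] wu, the value at the commutator is F(uw) - F(wu) modulo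
      \<open>B\<close>, which vanishes because addition commutes.\<close>
    have "F (u \<otimes> w) - F ?c - F (w \<otimes> u) \<in> B"
      using F[OF c U'(1)[OF uw(2,1)]] commutator_mult_swap[of u w] uw Uc by simp
    moreover have "(F (u \<otimes> w) - F u - F w) - (F (w \<otimes> u) - F w - F u) \<in> B"
      using F uw B'(2) by blast
    ultimately have "((F (u \<otimes> w) - F u - F w) - (F (w \<otimes> u) - F w - F u)) - (F (u \<otimes> w) - F ?c - F (w \<otimes> u)) \<in> B"
      using B'(2) by blast
    then show "?c \<in> {u \<in> U. F u \<in> B}" using c by (simp add: algebra_simps)
  qed
qed

locale compact_module = compact_group P T for P :: "'a monoid" (structure) and T +
  fixes act :: "'a \<Rightarrow> 'm::{finite,ab_group_add} \<Rightarrow> 'm"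
  assumes module: "finite_G_module P T act"
begin

lemma act_add: "g \<in> carrier P \<Longrightarrow> act g (x + y) = act g x + act g y"
  and act_one: "act \<one> x = x"
  and act_mult: "g \<in> carrier P \<Longrightarrow> h \<in> carrier P \<Longrightarrow> act (g \<otimes> h) x = act g (act h x)"
  using module unfolding finite_G_module_def by auto

lemma act_0: "g \<in> carrier P \<Longrightarrow> act g 0 = 0"
  using act_add[of g 0 0] by simp

lemma act_minus: "g \<in> carrier P \<Longrightarrow> act g (- x) = - act g x"
  using act_add[of g x "- x"] act_0[of g] by (simp add: eq_neg_iff_add_eq_0 add.commute)

lemma act_diff: "g \<in> carrier P \<Longrightarrow> act g (x - y) = act g x - act g y"
  using act_add[of g x "- y"] act_minus[of g y] by simp

definition act_kernel :: "'a set" where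
  "act_kernel = {g \<in> carrier P. \<forall>x. act g x = x}"

lemma act_kernel_normal: "act_kernel \<lhd> P"
proof -
  have inv: "act (inv g) x = x" if "g \<in> carrier P" "\<forall>x. act g x = x" for g x
    using act_mult[of "inv g" g x] that act_one by simp
  have "subgroup act_kernel P"
    by unfold_locales (auto simp: act_kernel_def act_one act_mult inv)
  moreover have "x \<otimes> h \<otimes> inv x \<in> act_kernel" if "x \<in> carrier P" "h \<in> act_kernel" for x h
    using that act_mult[of x "inv x"] act_one unfolding act_kernel_def by (auto simp: act_mult)
  ultimately show ?thesis by (simp add: normal_inv_iff)
qed

text \<open>Finiteness of the module makes this a finite intersection of stabilizers, each open by
  continuity of the action.\<close>

lemma openin_act_kernel: "openin T act_kernel"
proof -
  have "openin T {g \<in> topspace T. act g x = x}" for x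
  proof -
    have "continuous_map T (prod_topology T (discrete_topology UNIV)) (\<lambda>g. (g, x))"
      by (intro continuous_map_pairedI continuous_map_id[unfolded id_def]) simp
    then have "continuous_map T (discrete_topology UNIV) (\<lambda>g. act g x)"
      using continuous_map_compose[of T _ "\<lambda>g. (g, x)" "discrete_topology UNIV" "\<lambda>x. act (fst x) (snd x)"] module
      unfolding finite_G_module_def by (auto simp: o_def)
    then have "openin T {g \<in> topspace T. act g x \<in> {x}}"
      by (rule openin_continuous_map_preimage) simp
    then show ?thesis by simp
  qed
  then have "openin T (\<Inter>x\<in>UNIV. {g \<in> topspace T. act g x = x})" by (intro openin_INT2) auto
  moreover have "act_kernel = (\<Inter>x\<in>UNIV. {g \<in> topspace T. act g x = x})"
    unfolding act_kernel_def topspace_eq by blast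
  ultimately show ?thesis by simp
qed

end

context compact_group
begin

lemma coset_invariant_openin:
  assumes "openin T N" "subgroup N G" "B \<subseteq> carrier G" "\<And>v x. v \<in> N \<Longrightarrow> x \<in> B \<Longrightarrow> v \<otimes> x \<in> B"
  shows "openin T B"
proof (subst openin_subopen, intro ballI)
  fix x assume x: "x \<in> B"
  then have "x \<in> carrier G" using assms by blast
  then have "openin T (N #> x)" "x \<in> N #> x" using openin_r_coset[OF assms(1)] rcos_self assms(2) by auto
  moreover have "N #> x \<subseteq> B" using assms(4) x by (auto simp: r_coset_def)
  ultimately show "\<exists>W. openin T W \<and> x \<in> W \<and> W \<subseteq> B" by blast
qed

lemma coset_invariant_clopen:
  assumes "openin T N" "subgroup N G" "B \<subseteq> carrier G" "\<And>v x. v \<in> N \<Longrightarrow> x \<in> B \<Longrightarrow> v \<otimes> x \<in> B"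
  shows "openin T B \<and> closedin T B"
proof -
  have "v \<otimes> x \<in> carrier G - B" if v: "v \<in> N" and x: "x \<in> carrier G - B" for v x
  proof -
    have vc: "v \<in> carrier G" using v assms(2) by (simp add: subgroup.mem_carrier)
    have "inv v \<otimes> (v \<otimes> x) \<in> B" if "v \<otimes> x \<in> B"
      using assms(2,4) v that by (simp add: subgroup.m_inv_closed)
    moreover have "inv v \<otimes> (v \<otimes> x) = x" using vc x by (simp add: m_assoc[symmetric])
    ultimately show ?thesis using x vc by auto
  qed
  then have "openin T (carrier G - B)" by (intro coset_invariant_openin[OF assms(1,2)]) auto
  then show ?thesis using coset_invariant_openin[OF assms] assms(3) by (simp add: closedin_def topspace_eq)
qed

end

context compact_module
begin

lemma coboundaries1_add_subgroup: "add_subgroup (coboundaries1 P act)"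
proof -
  let ?b = "\<lambda>m g. if g \<in> carrier P then act g m - m else 0"
  have "0 = ?b 0" by (auto simp: act_0 fun_eq_iff)
  moreover have "?b m - ?b m' = ?b (m - m')" for m m' by (auto simp: act_diff fun_eq_iff)
  ultimately show ?thesis unfolding add_subgroup_def coboundaries1_def by blast
qed

lemma cocycle_continuous:
  assumes f: "f \<in> cocycles1_d P act" and V: "openin T V" "V \<lhd> P" "V \<subseteq> act_kernel"
    and min: "\<And>K. subgroup K P \<Longrightarrow> \<forall>u\<in>act_kernel. u [^] CARD('m) \<in> K \<Longrightarrow>
      \<forall>u\<in>act_kernel. \<forall>w\<in>act_kernel. commutator P u w \<in> K \<Longrightarrow> V \<subseteq> K"
  shows "continuous_map T (discrete_topology UNIV) f"
proof -
  have coc: "f (g \<otimes> h) = act g (f h) + f g" if "g \<in> carrier P" "h \<in> carrier P" for g h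
  proof -
    have "act g (f h) - f (g \<otimes> h) + f g = 0" using f that unfolding cocycles1_d_def by blast
    then show ?thesis by (simp add: algebra_simps)
  qed
  have z: "add_subgroup {0::'m}" by (simp add: add_subgroup_def)
  have "f (u \<otimes> w) - f u - f w \<in> {0}" if "u \<in> act_kernel" "w \<in> act_kernel" for u w
    using coc[of u w] that unfolding act_kernel_def by simp
  moreover have "(\<Sum>i<CARD('m). f u) \<in> {0}" for u by (simp add: sum_const_card_UNIV)
  ultimately have "V \<subseteq> {u \<in> act_kernel. f u \<in> {0}}"
    using additive_mod_subset[OF z normal_imp_subgroup[OF act_kernel_normal], of f "CARD('m)"] by (intro min) auto
  \<comment> \<open>In f(vx) = v f(x) + f(v) the element \<open>v\<close> acts trivially and f(v) =
    0, so \<open>f\<close> is constant on right cosets of \<open>V\<close>.\<close>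
  then have inv: "f (v \<otimes> x) = f x" if "v \<in> V" "x \<in> carrier P" for v x
    using coc[of v x] that unfolding act_kernel_def by auto
  have "openin T {x \<in> topspace T. f x \<in> W}" for W
    using coset_invariant_openin[OF V(1) normal_imp_subgroup[OF V(2)], of "{x \<in> topspace T. f x \<in> W}"]
      inv V(3) unfolding act_kernel_def by (auto simp: topspace_eq)
  then show ?thesis by (simp add: continuous_map_def)
qed

text \<open>Once all cocycles are continuous both sides are the same quotient, as the coboundaries
  are the same set in either theory. Only the choice of representative in \<open>phi_up1\<close>
  remains to be handled.\<close>

lemma phi_up1_bij:
  assumes "\<And>f. f \<in> cocycles1_d P act \<Longrightarrow> continuous_map T (discrete_topology UNIV) f"
  shows "bij_betw (phi_up1 P act) (H1_c P T act) (H1_d P act)"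
proof -
  have cls: "coh_class P act f = (\<lambda>b. f + b) ` coboundaries1 P act" for f
    unfolding coh_class_def plus_fun_def by auto
  have "cocycles1_c P T act = cocycles1_d P act" using assms unfolding cocycles1_c_def by blast
  moreover have "bij_betw (\<lambda>C. (\<lambda>b. (SOME c. c \<in> C) + b) ` coboundaries1 P act)
    ((\<lambda>z. (\<lambda>b. z + b) ` coboundaries1 P act) ` cocycles1_d P act)
    ((\<lambda>z. (\<lambda>b. z + b) ` coboundaries1 P act) ` cocycles1_d P act)"
  proof (rule bij_betw_add_cosets[OF coboundaries1_add_subgroup coboundaries1_add_subgroup])
    fix y assume "y \<in> cocycles1_d P act"
    then show "\<exists>z\<in>cocycles1_d P act. y - z \<in> coboundaries1 P act"
      using add_subgroupD(1)[OF coboundaries1_add_subgroup] by (intro bexI[of _ y]) auto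
  next
    fix z a :: "'a \<Rightarrow> 'm" assume "a \<in> coboundaries1 P act"
    then show "z + a - z \<in> coboundaries1 P act" by (metis add_diff_cancel_left')
  qed assumption+
  ultimately show ?thesis unfolding phi_up1_def[abs_def] H1_c_def H1_d_def cls by simp
qed

end

section \<open>Finitely supported chains and clopen measures\<close>

text \<open>The elementary tensor g \<otimes> m of the bar complex, as a function of finite support;
  pairs in degree 2 are covered by the same definition.\<close>

definition single :: "'x \<Rightarrow> 'm \<Rightarrow> 'x \<Rightarrow> 'm::zero" where
  "single g m = (\<lambda>x. if x = g then m else 0)"

lemma single_add: "single g (m + m') = single g m + single g (m' :: 'm::ab_group_add)"
  and single_diff: "single g (m - m') = single g m - single g (m' :: 'm::ab_group_add)"
  by (auto simp: single_def fun_eq_iff)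

lemma single_0: "single g 0 = (0 :: 'x \<Rightarrow> 'm::ab_group_add)"
  by (auto simp: single_def fun_eq_iff)

lemma single_sum: "single g (sum f I) = (\<Sum>i\<in>I. single g (f i :: 'm::ab_group_add))"
  by (induction I rule: infinite_finite_induct) (auto simp: single_0 single_add)

lemma sum_fun_apply: "(sum f I) x = (\<Sum>i\<in>I. f i x)" for f :: "'i \<Rightarrow> 'x \<Rightarrow> 'm::ab_group_add"
  by (induction I rule: infinite_finite_induct) auto

lemma sum_single:
  assumes "finite S" "\<And>x. c x \<noteq> 0 \<Longrightarrow> x \<in> S"
  shows "(\<Sum>x\<in>S. single x (c x)) = (c :: 'x \<Rightarrow> 'm::ab_group_add)"
proof
  fix y
  have "(\<Sum>x\<in>S. single x (c x)) y = (\<Sum>x\<in>S. if y = x then c x else 0)"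
    by (simp add: sum_fun_apply single_def)
  also have "\<dots> = c y" using assms by auto
  finally show "(\<Sum>x\<in>S. single x (c x)) y = c y" .
qed

lemma finite_support_sum:
  assumes "finite S" "\<And>x. c x \<noteq> 0 \<Longrightarrow> x \<in> S"
  shows "(\<Sum>x\<in>{x. c x \<noteq> 0 \<and> Q x}. f x) = (\<Sum>x\<in>S. if c x \<noteq> 0 \<and> Q x then f x else 0 :: 'm::ab_group_add)"
proof -
  have "{x. c x \<noteq> 0 \<and> Q x} = {x \<in> S. c x \<noteq> 0 \<and> Q x}" using assms by blast
  then show ?thesis using sum.inter_filter[OF assms(1)] by simp
qed

lemma dirac1_eq:
  assumes "finite S" "\<And>x. c x \<noteq> 0 \<Longrightarrow> x \<in> S" "openin Y A" "closedin Y A"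
  shows "dirac1 Y c A = (\<Sum>x\<in>S. if x \<in> A then c x else 0)"
proof -
  have "dirac1 Y c A = (\<Sum>x\<in>{x. c x \<noteq> 0 \<and> x \<in> A}. c x)"
    using assms(3,4) unfolding dirac1_def by (simp add: conj_commute)
  also have "\<dots> = (\<Sum>x\<in>S. if c x \<noteq> 0 \<and> x \<in> A then c x else 0)"
    by (rule finite_support_sum[OF assms(1,2)])
  also have "\<dots> = (\<Sum>x\<in>S. if x \<in> A then c x else 0)" by (rule sum.cong) auto
  finally show ?thesis .
qed

lemma dirac1_not_clopen: "\<not> (openin Y A \<and> closedin Y A) \<Longrightarrow> dirac1 Y c A = 0"
  by (auto simp: dirac1_def)

lemma dirac1_diff:
  assumes "finite {x. c x \<noteq> 0}" "finite {x. c' x \<noteq> 0}"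
  shows "dirac1 Y (c - c') = dirac1 Y c - dirac1 Y c'"
proof
  fix A
  let ?S = "{x. c x \<noteq> 0} \<union> {x. c' x \<noteq> 0}"
  show "dirac1 Y (c - c') A = (dirac1 Y c - dirac1 Y c') A"
  proof (cases "openin Y A \<and> closedin Y A")
    case True
    have fin: "finite ?S" using assms by simp
    have "dirac1 Y (c - c') A = (\<Sum>x\<in>?S. if x \<in> A then (c - c') x else 0)"
      by (rule dirac1_eq[OF fin]) (use True in auto)
    moreover have "dirac1 Y c A = (\<Sum>x\<in>?S. if x \<in> A then c x else 0)"
      by (rule dirac1_eq[OF fin]) (use True in auto)
    moreover have "dirac1 Y c' A = (\<Sum>x\<in>?S. if x \<in> A then c' x else 0)"
      by (rule dirac1_eq[OF fin]) (use True in auto)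
    ultimately show ?thesis by (simp add: sum_subtractf[symmetric] if_distrib cong: if_cong sum.cong)
  qed (simp add: dirac1_not_clopen)
qed

lemma dirac1_measure:
  assumes "finite {x. c x \<noteq> 0}"
  shows "dirac1 Y c \<in> clopen_measures Y"
  unfolding clopen_measures_def
proof (intro CollectI conjI allI impI)
  fix A show "dirac1 Y c A \<noteq> 0 \<Longrightarrow> openin Y A" "dirac1 Y c A \<noteq> 0 \<Longrightarrow> closedin Y A"
    using dirac1_not_clopen[of Y A c] by blast+
next
  fix A B assume AB: "openin Y A \<and> closedin Y A \<and> openin Y B \<and> closedin Y B \<and> A \<inter> B = {}"
  let ?S = "{x. c x \<noteq> 0}"
  have "dirac1 Y c (A \<union> B) = (\<Sum>x\<in>?S. if x \<in> A \<union> B then c x else 0)"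
    by (rule dirac1_eq[OF assms]) (use AB in auto)
  also have "\<dots> = (\<Sum>x\<in>?S. (if x \<in> A then c x else 0) + (if x \<in> B then c x else 0))"
    using AB by (intro sum.cong) auto
  also have "\<dots> = dirac1 Y c A + dirac1 Y c B"
    using AB by (simp add: sum.distrib dirac1_eq[OF assms])
  finally show "dirac1 Y c (A \<union> B) = dirac1 Y c A + dirac1 Y c B" .
qed

text \<open>Sorting the points of the support by the value of \<phi> and swapping the sums gives the
  pointwise formula. The level sets must be clopen, since \<open>dirac1\<close> returns 0 on other
  sets.\<close>

lemma mint_dirac1:
  fixes c :: "'x \<Rightarrow> 'm::{finite,ab_group_add}"
  assumes "finite S" "\<And>x. c x \<noteq> 0 \<Longrightarrow> x \<in> S"
    and clopen: "\<And>e. openin Y {x \<in> A. \<phi> x = e} \<and> closedin Y {x \<in> A. \<phi> x = e}"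
    and add: "\<And>x a b. x \<in> A \<Longrightarrow> \<phi> x (a + b) = \<phi> x a + \<phi> x b"
  shows "mint (dirac1 Y c) \<phi> A = (\<Sum>x\<in>S. if x \<in> A then \<phi> x (c x) else 0)"
proof -
  have zero: "\<phi> x 0 = 0" if "x \<in> A" for x using add[OF that, of 0 0] by simp
  have add_sum: "e (sum f I) = (\<Sum>i\<in>I. e (f i))" if "e \<in> \<phi> ` A" for e I and f :: "'x \<Rightarrow> 'm"
    using that zero add by (induction I rule: infinite_finite_induct) auto
  have fin: "finite (\<phi> ` A)" by (rule finite_subset[of _ UNIV]) auto
  have "dirac1 Y c {x \<in> A. \<phi> x = e} = (\<Sum>x\<in>S. if x \<in> {x \<in> A. \<phi> x = e} then c x else 0)" for e
    by (rule dirac1_eq[OF assms(1)]) (use assms(2) clopen in auto)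
  then have "mint (dirac1 Y c) \<phi> A = (\<Sum>e\<in>\<phi> ` A. e (\<Sum>x\<in>S. if x \<in> {x \<in> A. \<phi> x = e} then c x else 0))"
    unfolding mint_def by simp
  also have "\<dots> = (\<Sum>e\<in>\<phi> ` A. \<Sum>x\<in>S. if x \<in> A \<and> \<phi> x = e then \<phi> x (c x) else 0)"
  proof (rule sum.cong[OF refl])
    fix e assume e: "e \<in> \<phi> ` A"
    then have "e 0 = 0" using zero by blast
    then show "e (\<Sum>x\<in>S. if x \<in> {x \<in> A. \<phi> x = e} then c x else 0) = (\<Sum>x\<in>S. if x \<in> A \<and> \<phi> x = e then \<phi> x (c x) else 0)"
      unfolding add_sum[OF e] by (intro sum.cong) auto
  qed
  also have "\<dots> = (\<Sum>x\<in>S. \<Sum>e\<in>\<phi> ` A. if x \<in> A \<and> \<phi> x = e then \<phi> x (c x) else 0)" by (rule sum.swap)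
  also have "\<dots> = (\<Sum>x\<in>S. if x \<in> A then \<phi> x (c x) else 0)"
    using fin by (intro sum.cong) (auto simp: sum.delta)
  finally show ?thesis .
qed

lemma clopen_measures_Un:
  assumes "\<mu> \<in> clopen_measures Y" "openin Y A" "closedin Y A" "openin Y B" "closedin Y B" "A \<inter> B = {}"
  shows "\<mu> (A \<union> B) = \<mu> A + \<mu> B"
  using assms by (simp add: clopen_measures_def)

lemma clopen_measures_empty:
  assumes "\<mu> \<in> clopen_measures Y" shows "\<mu> {} = 0"
proof -
  have "\<mu> ({} \<union> {}) = \<mu> {} + \<mu> {}" by (rule clopen_measures_Un[OF assms]) auto
  then show ?thesis by simp
qed

lemma clopen_measures_sum:
  assumes \<mu>: "\<mu> \<in> clopen_measures Y" and "finite I"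
    and "\<And>i. i \<in> I \<Longrightarrow> openin Y (A i) \<and> closedin Y (A i)"
    and "\<And>i j. i \<in> I \<Longrightarrow> j \<in> I \<Longrightarrow> i \<noteq> j \<Longrightarrow> A i \<inter> A j = {}"
  shows "\<mu> (\<Union>i\<in>I. A i) = (\<Sum>i\<in>I. \<mu> (A i))"
  using assms(2-)
proof (induction I rule: finite_induct)
  case empty
  then show ?case using clopen_measures_empty[OF \<mu>] by simp
next
  case (insert i I)
  have "openin Y (\<Union>i\<in>I. A i)" using insert.prems by (intro openin_Union) auto
  moreover have "closedin Y (\<Union>i\<in>I. A i)" using insert.prems insert.hyps by (intro closedin_Union) auto
  moreover have "A i \<inter> (\<Union>i\<in>I. A i) = {}" using insert.prems insert.hyps by fastforce
  moreover have "openin Y (A i) \<and> closedin Y (A i)" using insert.prems by simp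
  ultimately have "\<mu> (A i \<union> (\<Union>i\<in>I. A i)) = \<mu> (A i) + \<mu> (\<Union>i\<in>I. A i)"
    by (intro clopen_measures_Un[OF \<mu>]) auto
  then show ?case using insert by simp
qed

text \<open>\<open>mint\<close> sums over the values of \<phi>, so pieces with equal
  \<open>e i\<close> are merged and split again by additivity. Nonempty pieces ensure that each
  \<open>e i\<close> is a value of \<phi>.\<close>

lemma mint_partition:
  fixes \<mu> :: "'x set \<Rightarrow> 'm::{finite,ab_group_add}" and A :: "'i \<Rightarrow> 'x set"
  assumes \<mu>: "\<mu> \<in> clopen_measures Y" and I: "finite I"
    and cl: "\<And>i. i \<in> I \<Longrightarrow> openin Y (A i) \<and> closedin Y (A i)"
    and disj: "\<And>i j. i \<in> I \<Longrightarrow> j \<in> I \<Longrightarrow> i \<noteq> j \<Longrightarrow> A i \<inter> A j = {}"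
    and ne: "\<And>i. i \<in> I \<Longrightarrow> A i \<noteq> {}"
    and \<phi>: "\<And>i x. i \<in> I \<Longrightarrow> x \<in> A i \<Longrightarrow> \<phi> x = e i"
    and add: "\<And>i a b. i \<in> I \<Longrightarrow> e i (a + b) = e i a + e i b"
  shows "mint \<mu> \<phi> (\<Union>i\<in>I. A i) = (\<Sum>i\<in>I. e i (\<mu> (A i)))"
proof -
  have img: "\<phi> ` (\<Union>i\<in>I. A i) = e ` I"
  proof (intro subset_antisym subsetI)
    fix k assume "k \<in> \<phi> ` (\<Union>i\<in>I. A i)"
    then show "k \<in> e ` I" using \<phi> by auto
  next
    fix k assume "k \<in> e ` I"
    then obtain i where i: "i \<in> I" "k = e i" by blast
    then obtain x where "x \<in> A i" using ne by blast
    then show "k \<in> \<phi> ` (\<Union>i\<in>I. A i)" using \<phi> i by (metis UN_I imageI)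
  qed
  have zero: "e i 0 = 0" if "i \<in> I" for i using add[OF that, of 0 0] by simp
  have add_sum: "e i (sum f J) = (\<Sum>j\<in>J. e i (f j))" if "i \<in> I" for i J and f :: "'i \<Rightarrow> 'm"
    using that zero add by (induction J rule: infinite_finite_induct) auto
  have "mint \<mu> \<phi> (\<Union>i\<in>I. A i) = (\<Sum>k\<in>e ` I. k (\<mu> {x \<in> (\<Union>i\<in>I. A i). \<phi> x = k}))"
    unfolding mint_def img ..
  also have "\<dots> = (\<Sum>k\<in>e ` I. \<Sum>i\<in>{i \<in> I. e i = k}. e i (\<mu> (A i)))"
  proof (rule sum.cong[OF refl])
    fix k assume "k \<in> e ` I"
    then obtain j where j: "j \<in> I" "k = e j" by blast
    have "{x \<in> (\<Union>i\<in>I. A i). \<phi> x = k} = (\<Union>i\<in>{i \<in> I. e i = k}. A i)" using \<phi> by auto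
    moreover have "\<mu> (\<Union>i\<in>{i \<in> I. e i = k}. A i) = (\<Sum>i\<in>{i \<in> I. e i = k}. \<mu> (A i))"
      using I cl disj by (intro clopen_measures_sum[OF \<mu>]) auto
    ultimately have "k (\<mu> {x \<in> (\<Union>i\<in>I. A i). \<phi> x = k}) = (\<Sum>i\<in>{i \<in> I. e i = k}. k (\<mu> (A i)))"
      using add_sum[OF j(1)] j(2) by simp
    also have "\<dots> = (\<Sum>i\<in>{i \<in> I. e i = k}. e i (\<mu> (A i)))" by (intro sum.cong) auto
    finally show "k (\<mu> {x \<in> (\<Union>i\<in>I. A i). \<phi> x = k}) = (\<Sum>i\<in>{i \<in> I. e i = k}. e i (\<mu> (A i)))" .
  qed
  also have "\<dots> = (\<Sum>i\<in>I. e i (\<mu> (A i)))" using sum.image_gen[OF I, of "\<lambda>i. e i (\<mu> (A i))" e] by simp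
  finally show ?thesis .
qed

section \<open>Compactness of the space of measures\<close>

text \<open>Fixing the coordinates in \<open>J\<close> gives a basic open box on which
  \<open>Q\<close> is constant, so the complement is open.\<close>

lemma finitary_closedin:
  assumes "finite J" and dep: "\<And>\<nu> \<nu>'. (\<And>j. j \<in> J \<Longrightarrow> \<nu> j = \<nu>' j) \<Longrightarrow> Q \<nu> \<longleftrightarrow> Q \<nu>'"
  shows "closedin (product_topology (\<lambda>_::'i. discrete_topology (UNIV::'m set)) UNIV) {\<nu>. Q \<nu>}"
proof -
  let ?X = "product_topology (\<lambda>_::'i. discrete_topology (UNIV::'m set)) UNIV"
  have "openin ?X {\<nu>. \<not> Q \<nu>}"
  proof (subst openin_subopen, intro ballI)
    fix \<nu> assume \<nu>: "\<nu> \<in> {\<nu>. \<not> Q \<nu>}"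
    define Bx where "Bx = (\<lambda>i. if i \<in> J then {\<nu> i} else UNIV)"
    have "openin ?X (Pi\<^sub>E UNIV Bx)"
      unfolding openin_PiE_gen Bx_def using assms(1) by (auto intro: finite_subset)
    moreover have "\<nu> \<in> Pi\<^sub>E UNIV Bx" unfolding Bx_def by auto
    moreover have "Pi\<^sub>E UNIV Bx \<subseteq> {\<nu>. \<not> Q \<nu>}"
    proof
      fix \<nu>' assume "\<nu>' \<in> Pi\<^sub>E UNIV Bx"
      then have "\<nu> j = \<nu>' j" if "j \<in> J" for j using that unfolding Bx_def by (auto simp: PiE_iff split: if_splits)
      then show "\<nu>' \<in> {\<nu>. \<not> Q \<nu>}" using dep[of \<nu> \<nu>'] \<nu> by simp
    qed
    ultimately show "\<exists>W. openin ?X W \<and> \<nu> \<in> W \<and> W \<subseteq> {\<nu>. \<not> Q \<nu>}" by blast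
  qed
  moreover have "topspace ?X - {\<nu>. Q \<nu>} = {\<nu>. \<not> Q \<nu>}" by (auto simp: PiE_UNIV_domain)
  ultimately show ?thesis by (simp add: closedin_def PiE_UNIV_domain)
qed

text \<open>Each axiom for a measure involves at most three sets. For a finite module the product is
  compact, and so is the set of measures.\<close>

lemma closedin_clopen_measures:
  fixes Y :: "'x topology"
  shows
  "closedin (product_topology (\<lambda>_. discrete_topology (UNIV::'m::ab_group_add set)) UNIV) (clopen_measures Y)"
proof -
  let ?X = "product_topology (\<lambda>_::'x set. discrete_topology (UNIV::'m set)) UNIV"
  define C1 where "C1 A = {\<nu> :: 'x set \<Rightarrow> 'm. \<nu> A \<noteq> 0 \<longrightarrow> openin Y A \<and> closedin Y A}" for A
  define C2 where "C2 A B = {\<nu> :: 'x set \<Rightarrow> 'm. openin Y A \<and> closedin Y A \<and> openin Y B \<and> closedin Y B \<and> A \<inter> B = {}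
        \<longrightarrow> \<nu> (A \<union> B) = \<nu> A + \<nu> B}" for A B
  have "closedin ?X (C1 A)" for A
    unfolding C1_def by (rule finitary_closedin[of "{A}"]) auto
  moreover have "closedin ?X (C2 A B)" for A B
    unfolding C2_def by (rule finitary_closedin[of "{A, B, A \<union> B}"]) auto
  ultimately have "closedin ?X ((\<Inter>A. C1 A) \<inter> (\<Inter>AB. C2 (fst AB) (snd AB)))"
    by (intro closedin_Int closedin_INT) auto
  moreover have "clopen_measures Y = (\<Inter>A. C1 A) \<inter> (\<Inter>AB. C2 (fst AB) (snd AB))"
    unfolding clopen_measures_def C1_def C2_def by auto
  ultimately show ?thesis by simp
qed

section \<open>First homology\<close>

context compact_module
begin

text \<open>The boundary of the elementary 2-chain x \<otimes> m. Writing \<open>hd2\<close> as a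
  sum of such terms replaces its three separate index sets by one.\<close>

definition bar2 :: "'a \<times> 'a \<Rightarrow> 'm \<Rightarrow> 'a \<Rightarrow> 'm" where
  "bar2 x m = single (snd x) (act (inv (fst x)) m) - single (fst x \<otimes> snd x) m + single (fst x) m"

abbreviation boundaries :: "('a \<Rightarrow> 'm) set" where
  "boundaries \<equiv> hd2 P act ` chains2 P"

lemma bar2_diff:
  "x \<in> carrier P \<times> carrier P \<Longrightarrow> bar2 x (m - m') = bar2 x m - bar2 x m'"
  unfolding bar2_def by (auto simp: act_diff single_diff)

lemma hd2_eq_sum:
  assumes S: "finite S" "S \<subseteq> carrier P \<times> carrier P" and c: "\<And>x. c x \<noteq> 0 \<Longrightarrow> x \<in> S"
  shows "hd2 P act c = (\<Sum>x\<in>S. bar2 x (c x))"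
proof
  fix h
  have "(\<Sum>g\<in>{g. c (g, h) \<noteq> 0}. act (inv g) (c (g, h))) =
      (\<Sum>x\<in>{x. c x \<noteq> 0 \<and> snd x = h}. act (inv (fst x)) (c x))"
    by (rule sum.reindex_bij_witness[of _ fst "\<lambda>g. (g, h)"]) auto
  also have "\<dots> = (\<Sum>x\<in>S. if c x \<noteq> 0 \<and> snd x = h then act (inv (fst x)) (c x) else 0)"
    by (rule finite_support_sum[OF S(1) c])
  also have "\<dots> = (\<Sum>x\<in>S. single (snd x) (act (inv (fst x)) (c x)) h)"
    using S(2) by (intro sum.cong) (auto simp: single_def act_0)
  finally have 1: "(\<Sum>g\<in>{g. c (g, h) \<noteq> 0}. act (inv g) (c (g, h))) = \<dots>" .
  have "(\<Sum>x\<in>{x. c x \<noteq> 0 \<and> fst x \<otimes> snd x = h}. c x) =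
      (\<Sum>x\<in>S. if c x \<noteq> 0 \<and> fst x \<otimes> snd x = h then c x else 0)"
    by (rule finite_support_sum[OF S(1) c])
  also have "\<dots> = (\<Sum>x\<in>S. single (fst x \<otimes> snd x) (c x) h)"
    by (intro sum.cong) (auto simp: single_def)
  finally have 2: "(\<Sum>x\<in>{x. c x \<noteq> 0 \<and> fst x \<otimes> snd x = h}. c x) = \<dots>" .
  have "(\<Sum>b\<in>{b. c (h, b) \<noteq> 0}. c (h, b)) = (\<Sum>x\<in>{x. c x \<noteq> 0 \<and> fst x = h}. c x)"
    by (rule sum.reindex_bij_witness[of _ snd "\<lambda>b. (h, b)"]) auto
  also have "\<dots> = (\<Sum>x\<in>S. if c x \<noteq> 0 \<and> fst x = h then c x else 0)"
    by (rule finite_support_sum[OF S(1) c])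
  also have "\<dots> = (\<Sum>x\<in>S. single (fst x) (c x) h)"
    by (intro sum.cong) (auto simp: single_def)
  finally have 3: "(\<Sum>b\<in>{b. c (h, b) \<noteq> 0}. c (h, b)) = \<dots>" .
  show "hd2 P act c h = (\<Sum>x\<in>S. bar2 x (c x)) h"
    unfolding hd2_def 1 2 3 sum_fun_apply bar2_def by (simp add: sum_subtractf sum.distrib)
qed

lemma hd2_support:
  assumes e: "e \<in> chains2 P" and g: "hd2 P act e g \<noteq> 0"
  shows "g \<in> snd ` {x. e x \<noteq> 0} \<union> (\<lambda>x. fst x \<otimes> snd x) ` {x. e x \<noteq> 0} \<union> fst ` {x. e x \<noteq> 0}"
proof -
  let ?S = "{x. e x \<noteq> 0}"
  have S: "finite ?S" "?S \<subseteq> carrier P \<times> carrier P" using e unfolding chains2_def by auto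
  have "hd2 P act e = (\<Sum>x\<in>?S. bar2 x (e x))" by (rule hd2_eq_sum[OF S]) simp
  then have "(\<Sum>x\<in>?S. bar2 x (e x) g) \<noteq> 0" using g by (simp add: sum_fun_apply)
  then obtain x where "x \<in> ?S" "bar2 x (e x) g \<noteq> 0" by (meson sum.not_neutral_contains_not_neutral)
  then show ?thesis unfolding bar2_def single_def by (auto split: if_splits)
qed

lemma boundaries_add_subgroup: "add_subgroup boundaries"
  unfolding add_subgroup_def
proof (intro conjI ballI)
  have "hd2 P act 0 = (\<Sum>x\<in>{}. bar2 x ((0 :: 'a \<times> 'a \<Rightarrow> 'm) x))"
    by (rule hd2_eq_sum) auto
  moreover have "(0 :: 'a \<times> 'a \<Rightarrow> 'm) \<in> chains2 P" by (auto simp: chains2_def)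
  ultimately show "0 \<in> boundaries" by (metis image_eqI sum.empty)
next
  fix x y assume "x \<in> boundaries" "y \<in> boundaries"
  then obtain c d where cd: "c \<in> chains2 P" "x = hd2 P act c" "d \<in> chains2 P" "y = hd2 P act d" by blast
  let ?S = "{x. c x \<noteq> 0} \<union> {x. d x \<noteq> 0}"
  have S: "finite ?S" "?S \<subseteq> carrier P \<times> carrier P" using cd unfolding chains2_def by auto
  have ch: "c - d \<in> chains2 P"
  proof -
    have "{x. (c - d) x \<noteq> 0} \<subseteq> ?S" by auto
    then show ?thesis using S unfolding chains2_def by (auto intro: finite_subset)
  qed
  have "hd2 P act (c - d) = (\<Sum>x\<in>?S. bar2 x ((c - d) x))" by (rule hd2_eq_sum[OF S]) auto
  also have "\<dots> = (\<Sum>x\<in>?S. bar2 x (c x) - bar2 x (d x))"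
    using S(2) bar2_diff by (intro sum.cong) auto
  also have "\<dots> = (\<Sum>x\<in>?S. bar2 x (c x)) - (\<Sum>x\<in>?S. bar2 x (d x))" by (rule sum_subtractf)
  also have "(\<Sum>x\<in>?S. bar2 x (c x)) = x" unfolding cd(2) by (rule hd2_eq_sum[OF S, symmetric]) auto
  also have "(\<Sum>x\<in>?S. bar2 x (d x)) = y" unfolding cd(4) by (rule hd2_eq_sum[OF S, symmetric]) auto
  finally have "hd2 P act (c - d) = x - y" .
  then show "x - y \<in> boundaries" using ch by (metis imageI)
qed

lemmas boundariesD = add_subgroupD[OF boundaries_add_subgroup]

lemma bar2_in_boundaries:
  assumes "a \<in> carrier P" "b \<in> carrier P"
  shows "bar2 (a, b) m \<in> boundaries"
proof -
  have "hd2 P act (single (a, b) m) = (\<Sum>x\<in>{(a, b)}. bar2 x (single (a, b) m x))"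
    using assms by (intro hd2_eq_sum) (auto simp: single_def split: if_splits)
  then have "bar2 (a, b) m = hd2 P act (single (a, b) m)" by (simp add: single_def)
  moreover have "single (a, b) m \<in> chains2 P" using assms unfolding chains2_def single_def by (auto split: if_splits)
  ultimately show ?thesis by blast
qed

text \<open>For \<open>u\<close> in the kernel of the action the boundary of (u, w) \<otimes> m is w
  \<otimes> m - uw \<otimes> m + u \<otimes> m, so u \<otimes> m is additive in \<open>u\<close>
  modulo boundaries.\<close>

lemma single_kernel_in_boundaries:
  assumes V: "V \<subseteq> act_kernel"
    and min: "\<And>K. subgroup K P \<Longrightarrow> \<forall>u\<in>act_kernel. u [^] CARD('m) \<in> K \<Longrightarrow>
      \<forall>u\<in>act_kernel. \<forall>w\<in>act_kernel. commutator P u w \<in> K \<Longrightarrow> V \<subseteq> K"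
    and v: "v \<in> V"
  shows "single v m \<in> boundaries"
proof -
  have U: "subgroup act_kernel P" using act_kernel_normal by (rule normal_imp_subgroup)
  have "single (u \<otimes> w) m - single u m - single w m \<in> boundaries"
    if uw: "u \<in> act_kernel" "w \<in> act_kernel" for u w
  proof -
    have c: "u \<in> carrier P" "w \<in> carrier P" using uw U by (auto simp: subgroup.mem_carrier)
    have "act (inv u) m = m"
      using subgroup.m_inv_closed[OF U uw(1)] unfolding act_kernel_def by blast
    then have "- bar2 (u, w) m = single (u \<otimes> w) m - single u m - single w m"
      unfolding bar2_def by (simp add: algebra_simps)
    then show ?thesis using boundariesD(3)[OF bar2_in_boundaries[OF c, of m]] by metis
  qed
  moreover have "(\<Sum>i<CARD('m). single u m) \<in> boundaries" for u
    using boundariesD(1) by (simp add: single_sum[symmetric] sum_const_card_UNIV single_0)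
  ultimately have "V \<subseteq> {u \<in> act_kernel. single u m \<in> boundaries}"
    using additive_mod_subset[OF boundaries_add_subgroup U, of "\<lambda>u. single u m" "CARD('m)"]
    by (intro min) blast+
  then show ?thesis using v by blast
qed

end

section \<open>Discretization of measures on cosets\<close>

text \<open>The facts about powers and commutators enter only through the last assumption, that v
  \<otimes> m is a boundary.\<close>

locale compact_module_trivial = compact_module P T act
  for P :: "'a monoid" (structure) and T and act :: "'a \<Rightarrow> 'm::{finite,ab_group_add} \<Rightarrow> 'm" +
  fixes V :: "'a set"
  assumes V_open: "openin T V" and V_normal: "V \<lhd> P" and V_kernel: "V \<subseteq> act_kernel"
    and V_single: "\<And>v m. v \<in> V \<Longrightarrow> single v m \<in> boundaries"
begin

text \<open>Levels below \<open>V\<close> are needed because a given clopen set may be a union of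
  cosets only of a smaller subgroup.\<close>

definition level :: "'a set \<Rightarrow> bool" where
  "level N \<longleftrightarrow> openin T N \<and> N \<lhd> P \<and> N \<subseteq> V"

lemma level_V: "level V" using V_open V_normal by (simp add: level_def)

lemma levelD:
  assumes "level N"
  shows "openin T N" "N \<lhd> P" "subgroup N P" "N \<subseteq> V" "finite (rcosets N)"
  using assms open_subgroup_finite_rcosets unfolding level_def by (auto simp: normal_imp_subgroup)

definition rep :: "'a set \<Rightarrow> 'a" where
  "rep C = (SOME x. x \<in> C)"

text \<open>Replaces a measure by a chain supported on coset representatives; modulo boundaries it is a
  left inverse of \<open>dirac1\<close> and independent of \<open>N\<close>.\<close>
definition discretize :: "'a set \<Rightarrow> ('a set \<Rightarrow> 'm) \<Rightarrow> 'a \<Rightarrow> 'm" where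
  "discretize N \<mu> = (\<Sum>C\<in>rcosets N. single (rep C) (\<mu> C))"

lemma rcosets_clopen:
  assumes "level N" "C \<in> rcosets N"
  shows "openin T C" "closedin T C" "C \<subseteq> carrier P"
proof -
  obtain a where a: "a \<in> carrier P" "C = N #> a" using assms(2) by (auto simp: RCOSETS_def)
  show "openin T C" unfolding a(2) by (rule openin_r_coset[OF levelD(1)[OF assms(1)] a(1)])
  show "closedin T C" unfolding a(2)
    by (rule closedin_r_coset[OF open_subgroup_closed[OF levelD(1,3)[OF assms(1)]] a(1)])
  show "C \<subseteq> carrier P" using \<open>openin T C\<close> openin_subset topspace_eq by metis
qed

lemma rep:
  assumes "level N" "C \<in> rcosets N"
  shows "rep C \<in> C" "rep C \<in> carrier P" "N #> rep C = C"
proof -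
  obtain a where a: "a \<in> carrier P" "C = N #> a" using assms(2) by (auto simp: RCOSETS_def)
  have "a \<in> C" using a rcos_self levelD(3)[OF assms(1)] by blast
  then show C: "rep C \<in> C" unfolding rep_def by (rule someI)
  then show "rep C \<in> carrier P" using rcosets_clopen(3)[OF assms] by blast
  show "N #> rep C = C" using repr_independence[of "rep C" N a] C a levelD(3)[OF assms(1)] by simp
qed

lemma rcosets_eq:
  assumes "level N" "C \<in> rcosets N" "x \<in> C"
  shows "C = N #> x"
proof -
  obtain a where a: "a \<in> carrier P" "C = N #> a" using assms(2) by (auto simp: RCOSETS_def)
  then show ?thesis using repr_independence[of x N a] assms(3) levelD(3)[OF assms(1)] by simp
qed

lemma rcosets_mem_iff:
  assumes "level N" "C \<in> rcosets N" "x \<in> carrier P"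
  shows "x \<in> C \<longleftrightarrow> C = N #> x"
  using rcosets_eq[OF assms(1,2)] rcos_self[OF assms(3) levelD(3)[OF assms(1)]] by blast

lemma rcosets_disj:
  assumes "level N" "C \<in> rcosets N" "D \<in> rcosets N" "C \<noteq> D"
  shows "C \<inter> D = {}"
  using rcosets_eq[OF assms(1,2)] rcosets_eq[OF assms(1,3)] assms(4) by blast

lemma r_coset_in_rcosets: "x \<in> carrier P \<Longrightarrow> N #> x \<in> rcosets N"
  by (auto simp: RCOSETS_def)

lemma inj_on_rep: "level N \<Longrightarrow> inj_on rep (rcosets N)"
  by (rule inj_onI) (metis rep(3))

text \<open>With x = vy, and \<open>v\<close> acting trivially, the boundary of (v, y) \<otimes> m
  is y \<otimes> m - x \<otimes> m + v \<otimes> m, and v \<otimes> m is itself a boundary.\<close>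

lemma single_coset_diff:
  assumes N: "level N" and C: "C \<in> rcosets N" and "x \<in> C" "y \<in> C"
  shows "single x m - single y m \<in> boundaries"
proof -
  have xy: "x \<in> carrier P" "y \<in> carrier P" using assms rcosets_clopen(3)[OF N C] by blast+
  define v where "v = x \<otimes> inv y"
  have "N #> x = N #> y" using rcosets_eq[OF N C] assms by metis
  then have "v \<in> N" unfolding v_def using r_coset_eq_iff[OF levelD(3)[OF N] xy] by blast
  then have v: "v \<in> V" using levelD(4)[OF N] by blast
  then have k: "v \<in> act_kernel" using V_kernel by blast
  have vc: "v \<in> carrier P" unfolding v_def using xy by simp
  have x: "v \<otimes> y = x" unfolding v_def using xy by (simp add: m_assoc)
  have "act (inv v) m = m"
    using subgroup.m_inv_closed[OF normal_imp_subgroup[OF act_kernel_normal] k] unfolding act_kernel_def by blast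
  then have "single x m - single y m = single v m - bar2 (v, y) m"
    unfolding bar2_def using x by (simp add: algebra_simps)
  then show ?thesis using boundariesD(2)[OF V_single[OF v] bar2_in_boundaries[OF vc xy(2)]] by metis
qed

lemma discretize_support:
  assumes "level N" "discretize N \<mu> g \<noteq> 0" shows "g \<in> rep ` (rcosets N)"
proof -
  have "(\<Sum>C\<in>rcosets N. single (rep C) (\<mu> C) g) \<noteq> 0" using assms(2) by (simp add: discretize_def sum_fun_apply)
  then obtain C where "C \<in> rcosets N" "single (rep C) (\<mu> C) g \<noteq> 0" by (meson sum.not_neutral_contains_not_neutral)
  then show "g \<in> rep ` (rcosets N)" by (auto simp: single_def split: if_splits)
qed

lemma discretize_chains1:
  assumes "level N" shows "discretize N \<mu> \<in> chains1 P"
proof -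
  have "{g. discretize N \<mu> g \<noteq> 0} \<subseteq> rep ` (rcosets N)" using discretize_support[OF assms] by blast
  moreover have "rep ` (rcosets N) \<subseteq> carrier P" using rep(2)[OF assms] by blast
  ultimately show ?thesis using levelD(5)[OF assms] unfolding chains1_def
    by (auto intro: finite_subset)
qed

lemma discretize_rep:
  assumes "level N" "C \<in> rcosets N"
  shows "discretize N \<mu> (rep C) = \<mu> C"
proof -
  have "discretize N \<mu> (rep C) = (\<Sum>D\<in>rcosets N. if D = C then \<mu> D else 0)"
    unfolding discretize_def sum_fun_apply
  proof (rule sum.cong[OF refl])
    fix D assume D: "D \<in> rcosets N"
    have "rep C = rep D \<longleftrightarrow> D = C" using inj_on_eq_iff[OF inj_on_rep[OF assms(1)] D assms(2)] by metis
    then show "single (rep D) (\<mu> D) (rep C) = (if D = C then \<mu> D else 0)" by (simp add: single_def)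
  qed
  then show ?thesis using assms levelD(5) by simp
qed

text \<open>Discretizing a Dirac measure moves each point of the support to the representative of
  its coset, at the cost of a boundary.\<close>

lemma discretize_dirac1:
  assumes N: "level N" and c: "c \<in> chains1 P"
  shows "c - discretize N (dirac1 T c) \<in> boundaries"
proof -
  let ?S = "{x. c x \<noteq> 0}"
  have S: "finite ?S" "?S \<subseteq> carrier P" using c unfolding chains1_def by auto
  have "discretize N (dirac1 T c) = (\<Sum>C\<in>rcosets N. \<Sum>x\<in>?S. if x \<in> C then single (rep C) (c x) else 0)"
    unfolding discretize_def
  proof (rule sum.cong[OF refl])
    fix C assume C: "C \<in> rcosets N"
    have "dirac1 T c C = (\<Sum>x\<in>?S. if x \<in> C then c x else 0)"
      using rcosets_clopen[OF N C] by (intro dirac1_eq[OF S(1)]) auto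
    then have "single (rep C) (dirac1 T c C) = (\<Sum>x\<in>?S. single (rep C) (if x \<in> C then c x else 0))"
      by (simp only: single_sum)
    also have "\<dots> = (\<Sum>x\<in>?S. if x \<in> C then single (rep C) (c x) else 0)"
      by (intro sum.cong) (auto simp: single_0)
    finally show "single (rep C) (dirac1 T c C) = \<dots>" .
  qed
  also have "\<dots> = (\<Sum>x\<in>?S. \<Sum>C\<in>rcosets N. if x \<in> C then single (rep C) (c x) else 0)" by (rule sum.swap)
  also have "\<dots> = (\<Sum>x\<in>?S. single (rep (N #> x)) (c x))"
  proof (rule sum.cong[OF refl])
    fix x assume "x \<in> ?S"
    then have x: "x \<in> carrier P" using S(2) by blast
    have "(\<Sum>C\<in>rcosets N. if x \<in> C then single (rep C) (c x) else 0) =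
        (\<Sum>C\<in>rcosets N. if C = N #> x then single (rep C) (c x) else 0)"
      using rcosets_mem_iff[OF N _ x] by (intro sum.cong) auto
    then show "(\<Sum>C\<in>rcosets N. if x \<in> C then single (rep C) (c x) else 0) = single (rep (N #> x)) (c x)"
      using levelD(5)[OF N] r_coset_in_rcosets[OF x] by simp
  qed
  finally have d: "discretize N (dirac1 T c) = (\<Sum>x\<in>?S. single (rep (N #> x)) (c x))" .
  have "(\<Sum>x\<in>?S. single x (c x)) = c" by (rule sum_single[OF S(1)]) simp
  then have "c - discretize N (dirac1 T c) = (\<Sum>x\<in>?S. single x (c x) - single (rep (N #> x)) (c x))"
    by (simp only: d sum_subtractf)
  also have "\<dots> \<in> boundaries"
  proof (rule add_subgroup_sum[OF boundaries_add_subgroup])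
    fix x assume "x \<in> ?S"
    then have x: "x \<in> carrier P" using S(2) by blast
    show "single x (c x) - single (rep (N #> x)) (c x) \<in> boundaries"
      using single_coset_diff[OF N r_coset_in_rcosets[OF x]] rep(1)[OF N r_coset_in_rcosets[OF x]]
        rcos_self[OF x levelD(3)[OF N]] by blast
  qed
  finally show ?thesis .
qed

text \<open>A coset lies in the \<open>N\<close>-invariant set \<open>B\<close> exactly if its
  representative does, so no mass crosses the edge of \<open>B\<close> and the value is
  exact.\<close>

lemma dirac1_discretize:
  assumes N: "level N" and \<mu>: "\<mu> \<in> clopen_measures T" and B: "openin T B" "closedin T B"
    and inv: "\<And>v x. v \<in> N \<Longrightarrow> x \<in> B \<Longrightarrow> v \<otimes> x \<in> B"
  shows "dirac1 T (discretize N \<mu>) B = \<mu> B"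
proof -
  have Bc: "B \<subseteq> carrier P" using B openin_subset topspace_eq by metis
  have sub: "C \<subseteq> B" if C: "C \<in> rcosets N" and "rep C \<in> B" for C
  proof
    fix x assume "x \<in> C"
    then have "x \<in> N #> rep C" using rep(3)[OF N C] by simp
    then show "x \<in> B" using inv that(2) by (auto simp: r_coset_def)
  qed
  have "dirac1 T (discretize N \<mu>) B = (\<Sum>x\<in>rep ` (rcosets N). if x \<in> B then discretize N \<mu> x else 0)"
    using discretize_support[OF N] levelD(5)[OF N] B by (intro dirac1_eq) auto
  also have "\<dots> = (\<Sum>C\<in>rcosets N. if rep C \<in> B then discretize N \<mu> (rep C) else 0)"
    using sum.reindex[OF inj_on_rep[OF N]] by (simp add: o_def)
  also have "\<dots> = (\<Sum>C\<in>rcosets N. if rep C \<in> B then \<mu> C else 0)"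
    using discretize_rep[OF N] by (intro sum.cong) auto
  also have "\<dots> = (\<Sum>C\<in>{C \<in> rcosets N. rep C \<in> B}. \<mu> C)"
    using sum.inter_filter[OF levelD(5)[OF N], symmetric] by simp
  also have "\<dots> = \<mu> (\<Union>C\<in>{C \<in> rcosets N. rep C \<in> B}. C)"
    using levelD(5)[OF N] rcosets_clopen[OF N] rcosets_disj[OF N]
    by (intro clopen_measures_sum[OF \<mu>, symmetric]) auto
  also have "(\<Union>C\<in>{C \<in> rcosets N. rep C \<in> B}. C) = B"
  proof (intro subset_antisym subsetI)
    fix x assume x: "x \<in> B"
    then have xc: "x \<in> carrier P" using Bc by blast
    have C: "N #> x \<in> rcosets N" using r_coset_in_rcosets[OF xc] .
    have "rep (N #> x) \<in> N #> x" using rep(1)[OF N C] .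
    then have "rep (N #> x) \<in> B" using inv x by (auto simp: r_coset_def)
    then show "x \<in> (\<Union>C\<in>{C \<in> rcosets N. rep C \<in> B}. C)"
      using C rcos_self[OF xc levelD(3)[OF N]] by blast
  qed (use sub in blast)
  finally show ?thesis .
qed

text \<open>Cosets of \<open>N\<close> are invariant under \<open>N'\<close>, so the coarse
  discretization cannot tell \<mu> from the Dirac measure of its fine discretization. This reduces
  the claim to \<open>discretize_dirac1\<close>.\<close>

lemma discretize_refine:
  assumes N: "level N" and N': "level N'" "N' \<subseteq> N" and \<mu>: "\<mu> \<in> clopen_measures T"
  shows "discretize N' \<mu> - discretize N \<mu> \<in> boundaries"
proof -
  have "dirac1 T (discretize N' \<mu>) C = \<mu> C" if C: "C \<in> rcosets N" for C
  proof (rule dirac1_discretize[OF N'(1) \<mu> rcosets_clopen(1,2)[OF N C]])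
    fix v x assume v: "v \<in> N'" and x: "x \<in> C"
    then have xc: "x \<in> carrier P" using rcosets_clopen(3)[OF N C] by blast
    have "v \<otimes> x \<in> N #> x" using v N'(2) by (auto simp: r_coset_def)
    then show "v \<otimes> x \<in> C" using rcosets_eq[OF N C x] by simp
  qed
  then have "discretize N (dirac1 T (discretize N' \<mu>)) = discretize N \<mu>"
    unfolding discretize_def[of N] by (intro sum.cong) auto
  then show ?thesis using discretize_dirac1[OF N discretize_chains1[OF N'(1), of \<mu>]] by simp
qed

lemma act_inv_coset:
  assumes N: "level N" and C: "C \<in> rcosets N" and "x \<in> C"
  shows "act (inv x) = act (inv (rep C))"
proof -
  have xc: "x \<in> carrier P" and rc: "rep C \<in> carrier P" using assms rcosets_clopen(3)[OF N C] rep(2)[OF N C] by blast+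
  have "x \<otimes> inv (rep C) \<in> N"
    using r_coset_eq_iff[OF levelD(3)[OF N] xc rc] rcosets_eq[OF N C] assms(3) rep(3)[OF N C] by metis
  then have "x \<otimes> inv (rep C) \<in> act_kernel" using levelD(4)[OF N] V_kernel by blast
  then have k: "act (x \<otimes> inv (rep C)) m = m" for m unfolding act_kernel_def by blast
  have "inv x \<otimes> (x \<otimes> inv (rep C)) = inv (rep C)" using xc rc by (simp add: m_assoc[symmetric])
  then have "act (inv (rep C)) m = act (inv x) (act (x \<otimes> inv (rep C)) m)" for m
    using act_mult[of "inv x" "x \<otimes> inv (rep C)" m] xc rc by simp
  then show ?thesis using k by (simp add: fun_eq_iff)
qed

lemma Union_rcosets: "level N \<Longrightarrow> (\<Union>C\<in>rcosets N. C) = carrier P"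
  using rcosets_part_G[OF levelD(3)] by simp

text \<open>The action is constant on cosets of \<open>N\<close>, so both sides are the same finite
  sum over cosets. Equality is exact, hence cycles go to cycles.\<close>

lemma hd1_discretize:
  assumes N: "level N" and \<mu>: "\<mu> \<in> clopen_measures T"
  shows "hd1 P act (discretize N \<mu>) = cd1 P act \<mu>"
proof -
  let ?c = "discretize N \<mu>"
  have rc: "rep C \<in> carrier P" if "C \<in> rcosets N" for C using rep(2)[OF N that] .
  have "hd1 P act ?c = (\<Sum>g\<in>rep ` (rcosets N). act (inv g) (?c g) - ?c g)"
    unfolding hd1_def
    using discretize_support[OF N] levelD(5)[OF N] rc
    by (intro sum.mono_neutral_left) (auto simp: act_0)
  also have "\<dots> = (\<Sum>C\<in>rcosets N. act (inv (rep C)) (\<mu> C) - \<mu> C)"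
    using discretize_rep[OF N] by (simp add: sum.reindex[OF inj_on_rep[OF N]] o_def)
  also have "\<dots> = (\<Sum>C\<in>rcosets N. act (inv (rep C)) (\<mu> C)) - (\<Sum>C\<in>rcosets N. \<mu> C)" by (rule sum_subtractf)
  also have "(\<Sum>C\<in>rcosets N. act (inv (rep C)) (\<mu> C)) = mint \<mu> (\<lambda>g. act (inv g)) (\<Union>C\<in>rcosets N. C)"
  proof (rule mint_partition[OF \<mu> levelD(5)[OF N], symmetric])
    fix C a b assume C: "C \<in> rcosets N"
    show "openin T C \<and> closedin T C" using rcosets_clopen[OF N C] by blast
    show "C \<noteq> {}" using rep(1)[OF N C] by blast
    show "act (inv (rep C)) (a + b) = act (inv (rep C)) a + act (inv (rep C)) b"
      using rc[OF C] by (simp add: act_add)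
  qed (use rcosets_disj[OF N] act_inv_coset[OF N] in blast)+
  also have "(\<Sum>C\<in>rcosets N. \<mu> C) = \<mu> (\<Union>C\<in>rcosets N. C)"
    using levelD(5)[OF N] rcosets_clopen[OF N] rcosets_disj[OF N]
    by (intro clopen_measures_sum[OF \<mu>, symmetric]) auto
  finally show ?thesis unfolding Union_rcosets[OF N] cd1_def .
qed

end

section \<open>The continuous boundary map and its compatibility with Dirac measures\<close>

lemma mint_diff:
  assumes "\<And>x a b. x \<in> A \<Longrightarrow> \<phi> x (a - b) = \<phi> x a - \<phi> x b"
  shows "mint (\<mu> - \<mu>') \<phi> A = mint \<mu> \<phi> A - mint \<mu>' \<phi> A"
proof -
  have "mint (\<mu> - \<mu>') \<phi> A = (\<Sum>e\<in>\<phi> ` A. e (\<mu> {x \<in> A. \<phi> x = e}) - e (\<mu>' {x \<in> A. \<phi> x = e}))"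
    unfolding mint_def using assms by (intro sum.cong) auto
  then show ?thesis by (simp add: mint_def sum_subtractf)
qed

context compact_module
begin

lemma cd2_diff: "cd2 P T act (\<nu> - \<nu>') = cd2 P T act \<nu> - cd2 P T act \<nu>'"
proof
  fix B
  have "mint (\<nu> - \<nu>') (\<lambda>x. act (inv (fst x))) {x \<in> carrier P \<times> carrier P. snd x \<in> B} =
    mint \<nu> (\<lambda>x. act (inv (fst x))) {x \<in> carrier P \<times> carrier P. snd x \<in> B} -
    mint \<nu>' (\<lambda>x. act (inv (fst x))) {x \<in> carrier P \<times> carrier P. snd x \<in> B}"
    by (rule mint_diff) (auto simp: act_diff)
  then show "cd2 P T act (\<nu> - \<nu>') B = (cd2 P T act \<nu> - cd2 P T act \<nu>') B"
    by (simp add: cd2_def)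
qed

lemma continuous_boundaries_add_subgroup:
  "add_subgroup (cd2 P T act ` clopen_measures (prod_topology T T))"
  unfolding add_subgroup_def
proof (intro conjI ballI)
  have d: "\<nu> - \<nu>' \<in> clopen_measures (prod_topology T T)"
    if "\<nu> \<in> clopen_measures (prod_topology T T)" "\<nu>' \<in> clopen_measures (prod_topology T T)"
    for \<nu> \<nu>' :: "('a \<times> 'a) set \<Rightarrow> 'm"
  proof -
    have "openin (prod_topology T T) A \<and> closedin (prod_topology T T) A" if "(\<nu> - \<nu>') A \<noteq> 0" for A
    proof -
      have "\<nu> A \<noteq> 0 \<or> \<nu>' A \<noteq> 0" using that by auto
      then show ?thesis using \<open>\<nu> \<in> _\<close> \<open>\<nu>' \<in> _\<close> unfolding clopen_measures_def by auto
    qed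
    moreover have "(\<nu> - \<nu>') (A \<union> B) = (\<nu> - \<nu>') A + (\<nu> - \<nu>') B"
      if "openin (prod_topology T T) A \<and> closedin (prod_topology T T) A \<and> openin (prod_topology T T) B \<and>
        closedin (prod_topology T T) B \<and> A \<inter> B = {}" for A B
      using that clopen_measures_Un[OF \<open>\<nu> \<in> _\<close>, of A B] clopen_measures_Un[OF \<open>\<nu>' \<in> _\<close>, of A B] by simp
    ultimately show ?thesis unfolding clopen_measures_def by blast
  qed
  have "(0 :: ('a \<times> 'a) set \<Rightarrow> 'm) \<in> clopen_measures (prod_topology T T)" by (simp add: clopen_measures_def)
  moreover have "cd2 P T act 0 = 0" using cd2_diff[of 0 0] by simp
  ultimately show "0 \<in> cd2 P T act ` clopen_measures (prod_topology T T)" by (metis imageI)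
  fix x y assume "x \<in> cd2 P T act ` clopen_measures (prod_topology T T)" "y \<in> cd2 P T act ` clopen_measures (prod_topology T T)"
  then obtain \<nu> \<nu>' where "\<nu> \<in> clopen_measures (prod_topology T T)" "\<nu>' \<in> clopen_measures (prod_topology T T)"
    "x = cd2 P T act \<nu>" "y = cd2 P T act \<nu>'" by blast
  then show "x - y \<in> cd2 P T act ` clopen_measures (prod_topology T T)" using d cd2_diff by (metis imageI)
qed

lemma act_inv_clopen:
  "openin T {g \<in> carrier P. act (inv g) = k} \<and> closedin T {g \<in> carrier P. act (inv g) = k}"
proof (rule coset_invariant_clopen[OF openin_act_kernel normal_imp_subgroup[OF act_kernel_normal]])
  fix v x assume v: "v \<in> act_kernel" and x: "x \<in> {g \<in> carrier P. act (inv g) = k}"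
  have vc: "v \<in> carrier P" using v unfolding act_kernel_def by blast
  have "act (inv v) m = m" for m
    using subgroup.m_inv_closed[OF normal_imp_subgroup[OF act_kernel_normal] v] unfolding act_kernel_def by blast
  then have "act (inv (v \<otimes> x)) m = act (inv x) m" for m
    using x vc act_mult[of "inv x" "inv v" m] by (simp add: inv_mult_group)
  then show "v \<otimes> x \<in> {g \<in> carrier P. act (inv g) = k}" using x vc by (auto simp: fun_eq_iff)
qed auto

lemma cd1_dirac1:
  assumes "c \<in> chains1 P"
  shows "cd1 P act (dirac1 T c) = hd1 P act c"
proof -
  let ?S = "{g. c g \<noteq> 0}"
  have S: "finite ?S" "?S \<subseteq> carrier P" using assms unfolding chains1_def by auto
  have "mint (dirac1 T c) (\<lambda>g. act (inv g)) (carrier P) = (\<Sum>g\<in>?S. if g \<in> carrier P then act (inv g) (c g) else 0)"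
    using act_inv_clopen by (intro mint_dirac1[OF S(1)]) (auto simp: act_add)
  also have "\<dots> = (\<Sum>g\<in>?S. act (inv g) (c g))" using S(2) by (intro sum.cong) auto
  finally have 1: "mint (dirac1 T c) (\<lambda>g. act (inv g)) (carrier P) = \<dots>" .
  have "dirac1 T c (carrier P) = (\<Sum>g\<in>?S. if g \<in> carrier P then c g else 0)"
    by (rule dirac1_eq[OF S(1)]) (auto simp: topspace_eq[symmetric])
  also have "\<dots> = (\<Sum>g\<in>?S. c g)" using S(2) by (intro sum.cong) auto
  finally show ?thesis unfolding cd1_def hd1_def 1 by (simp add: sum_subtractf)
qed

text \<open>The comparison is a chain map, with \<open>dirac1\<close> on the product space serving
  in degree 2. Each term of \<open>cd2\<close> transports a measure along \<open>snd\<close>,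
  multiplication or \<open>fst\<close>, and matches one term of \<open>bar2\<close>.\<close>

lemma dirac1_hd2:
  assumes "e \<in> chains2 P"
  shows "dirac1 T (hd2 P act e) = cd2 P T act (dirac1 (prod_topology T T) e)"
proof
  fix B
  let ?TT = "prod_topology T T" and ?S = "{x. e x \<noteq> 0}"
  have S: "finite ?S" "?S \<subseteq> carrier P \<times> carrier P" using assms unfolding chains2_def by auto
  show "dirac1 T (hd2 P act e) B = cd2 P T act (dirac1 ?TT e) B"
  proof (cases "openin T B \<and> closedin T B")
    case False
    then show ?thesis by (auto simp: dirac1_def cd2_def)
  next
    case True
    then have B: "openin T B" "closedin T B" "B \<subseteq> carrier P" using openin_subset topspace_eq by auto
    define R where "R = snd ` ?S \<union> (\<lambda>x. fst x \<otimes> snd x) ` ?S \<union> fst ` ?S"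
    have R: "finite R" unfolding R_def using S(1) by simp
    have hd2: "hd2 P act e = (\<Sum>x\<in>?S. bar2 x (e x))" by (rule hd2_eq_sum[OF S]) simp
    have supp: "g \<in> R" if "hd2 P act e g \<noteq> 0" for g
      unfolding R_def by (rule hd2_support[OF assms that])
    have ind: "(\<Sum>g\<in>R. if g \<in> B then single h m g else 0) = (if h \<in> B then m else 0)" if "h \<in> R" for h and m :: 'm
    proof -
      have "(\<Sum>g\<in>R. if g \<in> B then single h m g else 0) = (\<Sum>g\<in>R. if g = h then (if h \<in> B then m else 0) else 0)"
        by (intro sum.cong) (auto simp: single_def)
      then show ?thesis using R that by simp
    qed
    have "dirac1 T (hd2 P act e) B = (\<Sum>g\<in>R. if g \<in> B then hd2 P act e g else 0)"
      by (rule dirac1_eq[OF R supp B(1,2)])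
    also have "\<dots> = (\<Sum>g\<in>R. \<Sum>x\<in>?S. if g \<in> B then bar2 x (e x) g else 0)"
      unfolding hd2 sum_fun_apply by (intro sum.cong) auto
    also have "\<dots> = (\<Sum>x\<in>?S. \<Sum>g\<in>R. if g \<in> B then bar2 x (e x) g else 0)" by (rule sum.swap)
    also have "\<dots> = (\<Sum>x\<in>?S. (if snd x \<in> B then act (inv (fst x)) (e x) else 0)
        - (if fst x \<otimes> snd x \<in> B then e x else 0) + (if fst x \<in> B then e x else 0))"
    proof (rule sum.cong[OF refl])
      fix x assume x: "x \<in> ?S"
      have "(\<Sum>g\<in>R. if g \<in> B then bar2 x (e x) g else 0) =
        (\<Sum>g\<in>R. (if g \<in> B then single (snd x) (act (inv (fst x)) (e x)) g else 0)
         - (if g \<in> B then single (fst x \<otimes> snd x) (e x) g else 0) + (if g \<in> B then single (fst x) (e x) g else 0))"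
        unfolding bar2_def by (intro sum.cong) auto
      also have "\<dots> = (if snd x \<in> B then act (inv (fst x)) (e x) else 0)
        - (if fst x \<otimes> snd x \<in> B then e x else 0) + (if fst x \<in> B then e x else 0)"
        unfolding sum.distrib sum_subtractf using x by (subst ind ind ind, simp add: R_def)+ simp
      finally show "(\<Sum>g\<in>R. if g \<in> B then bar2 x (e x) g else 0) = \<dots>" .
    qed
    also have "\<dots> = (\<Sum>x\<in>?S. if snd x \<in> B then act (inv (fst x)) (e x) else 0)
        - (\<Sum>x\<in>?S. if fst x \<otimes> snd x \<in> B then e x else 0) + (\<Sum>x\<in>?S. if fst x \<in> B then e x else 0)"
      by (simp add: sum.distrib sum_subtractf)
    finally have L: "dirac1 T (hd2 P act e) B = \<dots>" .
    have "mint (dirac1 ?TT e) (\<lambda>x. act (inv (fst x))) {x \<in> carrier P \<times> carrier P. snd x \<in> B} =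
      (\<Sum>x\<in>?S. if x \<in> {x \<in> carrier P \<times> carrier P. snd x \<in> B} then act (inv (fst x)) (e x) else 0)"
    proof (rule mint_dirac1[OF S(1)])
      fix k
      have "{x \<in> {x \<in> carrier P \<times> carrier P. snd x \<in> B}. act (inv (fst x)) = k} = {g \<in> carrier P. act (inv g) = k} \<times> B"
        using B(3) by auto
      then show "openin ?TT {x \<in> {x \<in> carrier P \<times> carrier P. snd x \<in> B}. act (inv (fst x)) = k} \<and>
          closedin ?TT {x \<in> {x \<in> carrier P \<times> carrier P. snd x \<in> B}. act (inv (fst x)) = k}"
        using act_inv_clopen[of k] B by (simp add: openin_prod_Times_iff closedin_prod_Times_iff)
    qed (auto simp: act_add)
    also have "\<dots> = (\<Sum>x\<in>?S. if snd x \<in> B then act (inv (fst x)) (e x) else 0)"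
      using S(2) by (intro sum.cong) auto
    finally have 1: "mint (dirac1 ?TT e) (\<lambda>x. act (inv (fst x))) {x \<in> carrier P \<times> carrier P. snd x \<in> B} = \<dots>" .
    have tt: "topspace ?TT = carrier P \<times> carrier P" by (simp add: topspace_eq)
    have "dirac1 ?TT e {x \<in> carrier P \<times> carrier P. fst x \<otimes> snd x \<in> B} =
      (\<Sum>x\<in>?S. if x \<in> {x \<in> carrier P \<times> carrier P. fst x \<otimes> snd x \<in> B} then e x else 0)"
      using openin_continuous_map_preimage[OF mult_cont B(1)] closedin_continuous_map_preimage[OF mult_cont B(2)]
      unfolding tt by (intro dirac1_eq[OF S(1)]) auto
    also have "\<dots> = (\<Sum>x\<in>?S. if fst x \<otimes> snd x \<in> B then e x else 0)"
      using S(2) by (intro sum.cong) auto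
    finally have 2: "dirac1 ?TT e {x \<in> carrier P \<times> carrier P. fst x \<otimes> snd x \<in> B} = \<dots>" .
    have "dirac1 ?TT e {x \<in> carrier P \<times> carrier P. fst x \<in> B} =
      (\<Sum>x\<in>?S. if x \<in> {x \<in> carrier P \<times> carrier P. fst x \<in> B} then e x else 0)"
      using openin_continuous_map_preimage[OF continuous_map_fst[of T T] B(1)]
        closedin_continuous_map_preimage[OF continuous_map_fst[of T T] B(2)]
      unfolding tt by (intro dirac1_eq[OF S(1)]) auto
    also have "\<dots> = (\<Sum>x\<in>?S. if fst x \<in> B then e x else 0)"
      using S(2) by (intro sum.cong) auto
    finally have 3: "dirac1 ?TT e {x \<in> carrier P \<times> carrier P. fst x \<in> B} = \<dots>" .
    show ?thesis unfolding L cd2_def if_P[OF True] 1 2 3 ..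
  qed
qed

text \<open>A finite module has finitely many self-maps, so the integral in \<open>cd2\<close> reads
  only finitely many values of \<nu>.\<close>

lemma closedin_cd2:
  "closedin (product_topology (\<lambda>_. discrete_topology (UNIV::'m set)) UNIV) {\<nu>. cd2 P T act \<nu> B = m}"
proof -
  let ?A = "{x \<in> carrier P \<times> carrier P. snd x \<in> B}" and ?\<phi> = "\<lambda>x. act (inv (fst x))"
  let ?J = "(\<lambda>e. {x \<in> ?A. ?\<phi> x = e}) ` (?\<phi> ` ?A) \<union>
    {{x \<in> carrier P \<times> carrier P. fst x \<otimes> snd x \<in> B}, {x \<in> carrier P \<times> carrier P. fst x \<in> B}}"
  show ?thesis
  proof (rule finitary_closedin[of ?J])
    have "finite (?\<phi> ` ?A)" by (rule finite_subset[of _ UNIV]) auto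
    then show "finite ?J" by blast
    fix \<nu> \<nu>' :: "('a \<times> 'a) set \<Rightarrow> 'm" assume eq: "\<And>j. j \<in> ?J \<Longrightarrow> \<nu> j = \<nu>' j"
    have "mint \<nu> ?\<phi> ?A = mint \<nu>' ?\<phi> ?A"
      unfolding mint_def
    proof (rule sum.cong[OF refl])
      fix e assume "e \<in> ?\<phi> ` ?A"
      then have "\<nu> {x \<in> ?A. ?\<phi> x = e} = \<nu>' {x \<in> ?A. ?\<phi> x = e}" by (intro eq) blast
      then show "e (\<nu> {x \<in> ?A. ?\<phi> x = e}) = e (\<nu>' {x \<in> ?A. ?\<phi> x = e})" by simp
    qed
    then show "cd2 P T act \<nu> B = m \<longleftrightarrow> cd2 P T act \<nu>' B = m"
      unfolding cd2_def using eq by simp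
  qed
qed

end

context compact_module_trivial
begin

lemma mult_r_coset:
  assumes N: "level N" and D: "D \<in> rcosets N" and E: "E \<in> rcosets N" and "a \<in> D" "b \<in> E"
  shows "N #> (a \<otimes> b) = N #> (rep D \<otimes> rep E)"
proof -
  have c: "a \<in> carrier P" "b \<in> carrier P" using assms rcosets_clopen(3)[OF N] by blast+
  have "N #> (a \<otimes> b) = (N #> a) <#> (N #> b)" using normal.rcos_sum[OF levelD(2)[OF N] c] by simp
  also have "\<dots> = (N #> rep D) <#> (N #> rep E)"
    using rcosets_eq[OF N D] rcosets_eq[OF N E] rep[OF N D] rep[OF N E] assms by metis
  also have "\<dots> = N #> (rep D \<otimes> rep E)"
    using normal.rcos_sum[OF levelD(2)[OF N] rep(2)[OF N D] rep(2)[OF N E]] .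
  finally show ?thesis .
qed

text \<open>All three sets in \<open>cd2\<close> are unions of rectangles of cosets; for the middle
  one this is normality of \<open>N\<close>, by which the coset of a product depends only on the
  cosets of its factors.\<close>

lemma cd2_coset:
  assumes N: "level N" and \<nu>: "\<nu> \<in> clopen_measures (prod_topology T T)" and C: "C \<in> rcosets N"
  shows "cd2 P T act \<nu> C = (\<Sum>D\<in>rcosets N. act (inv (rep D)) (\<nu> (D \<times> C)))
    - (\<Sum>x\<in>{x \<in> (rcosets N) \<times> (rcosets N). N #> (rep (fst x) \<otimes> rep (snd x)) = C}. \<nu> (fst x \<times> snd x))
    + (\<Sum>D\<in>rcosets N. \<nu> (C \<times> D))"
proof -
  let ?TT = "prod_topology T T"
  have cl: "openin ?TT (D \<times> E) \<and> closedin ?TT (D \<times> E)" if "D \<in> rcosets N" "E \<in> rcosets N" for D E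
    using that rcosets_clopen[OF N] by (simp add: openin_prod_Times_iff closedin_prod_Times_iff)
  note fin = levelD(5)[OF N]
  have Cc: "C \<subseteq> carrier P" using rcosets_clopen(3)[OF N C] .
  have "{x \<in> carrier P \<times> carrier P. snd x \<in> C} = (\<Union>D\<in>rcosets N. D) \<times> C"
    unfolding Union_rcosets[OF N] using Cc by auto
  then have "{x \<in> carrier P \<times> carrier P. snd x \<in> C} = (\<Union>D\<in>rcosets N. D \<times> C)" by blast
  moreover have "mint \<nu> (\<lambda>x. act (inv (fst x))) (\<Union>D\<in>rcosets N. D \<times> C) = (\<Sum>D\<in>rcosets N. act (inv (rep D)) (\<nu> (D \<times> C)))"
  proof (rule mint_partition[OF \<nu> fin])
    fix D assume D: "D \<in> rcosets N"
    show "openin ?TT (D \<times> C) \<and> closedin ?TT (D \<times> C)" using cl[OF D C] .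
    show "D \<times> C \<noteq> {}" using rep(1)[OF N D] rep(1)[OF N C] by blast
    show "act (inv (fst x)) = act (inv (rep D))" if "x \<in> D \<times> C" for x
      using act_inv_coset[OF N D] that by auto
    show "act (inv (rep D)) (a + b) = act (inv (rep D)) a + act (inv (rep D)) b" for a b
      using rep(2)[OF N D] by (simp add: act_add)
    show "(D \<times> C) \<inter> (E \<times> C) = {}" if "E \<in> rcosets N" "D \<noteq> E" for E
      using rcosets_disj[OF N D that] by blast
  qed
  ultimately have 1: "mint \<nu> (\<lambda>x. act (inv (fst x))) {x \<in> carrier P \<times> carrier P. snd x \<in> C} =
    (\<Sum>D\<in>rcosets N. act (inv (rep D)) (\<nu> (D \<times> C)))" by simp
  let ?I = "{x \<in> (rcosets N) \<times> (rcosets N). N #> (rep (fst x) \<otimes> rep (snd x)) = C}"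
  have "{x \<in> carrier P \<times> carrier P. fst x \<otimes> snd x \<in> C} = (\<Union>x\<in>?I. fst x \<times> snd x)"
  proof (intro subset_antisym subsetI)
    fix z assume z: "z \<in> {x \<in> carrier P \<times> carrier P. fst x \<otimes> snd x \<in> C}"
    then have zc: "fst z \<in> carrier P" "snd z \<in> carrier P" by auto
    let ?D = "N #> fst z" and ?E = "N #> snd z"
    have DE: "?D \<in> rcosets N" "?E \<in> rcosets N" using zc r_coset_in_rcosets by auto
    have m: "fst z \<in> ?D" "snd z \<in> ?E" using zc rcos_self levelD(3)[OF N] by auto
    have "N #> (rep ?D \<otimes> rep ?E) = N #> (fst z \<otimes> snd z)" using mult_r_coset[OF N DE m] by simp
    also have "\<dots> = C" using z rcosets_eq[OF N C] by blast
    finally have "(?D, ?E) \<in> ?I" using DE by simp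
    moreover have "z \<in> fst (?D, ?E) \<times> snd (?D, ?E)" using m by (simp add: mem_Times_iff)
    ultimately show "z \<in> (\<Union>x\<in>?I. fst x \<times> snd x)" by (rule UN_I)
  next
    fix z assume "z \<in> (\<Union>x\<in>?I. fst x \<times> snd x)"
    then obtain D E where DE: "D \<in> rcosets N" "E \<in> rcosets N" "N #> (rep D \<otimes> rep E) = C" "fst z \<in> D" "snd z \<in> E" by auto
    have zc: "fst z \<in> carrier P" "snd z \<in> carrier P" using DE rcosets_clopen(3)[OF N] by blast+
    have "N #> (fst z \<otimes> snd z) = C" using mult_r_coset[OF N DE(1,2,4,5)] DE(3) by simp
    then have "fst z \<otimes> snd z \<in> C" using rcos_self[OF _ levelD(3)[OF N]] zc by (metis m_closed)
    then show "z \<in> {x \<in> carrier P \<times> carrier P. fst x \<otimes> snd x \<in> C}" using zc by (simp add: mem_Times_iff)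
  qed
  moreover have "\<nu> (\<Union>x\<in>?I. fst x \<times> snd x) = (\<Sum>x\<in>?I. \<nu> (fst x \<times> snd x))"
  proof (rule clopen_measures_sum[OF \<nu>])
    show "finite ?I" using fin by simp
    show "openin ?TT (fst x \<times> snd x) \<and> closedin ?TT (fst x \<times> snd x)" if "x \<in> ?I" for x using that cl by auto
    fix x y assume x: "x \<in> ?I" and y: "y \<in> ?I" and xy: "x \<noteq> y"
    then have "fst x \<noteq> fst y \<or> snd x \<noteq> snd y" by (auto simp: prod_eq_iff)
    moreover have "fst x \<in> rcosets N" "fst y \<in> rcosets N" "snd x \<in> rcosets N" "snd y \<in> rcosets N"
      using x y by auto
    ultimately have "fst x \<inter> fst y = {} \<or> snd x \<inter> snd y = {}" using rcosets_disj[OF N] by metis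
    then show "(fst x \<times> snd x) \<inter> (fst y \<times> snd y) = {}" by blast
  qed
  ultimately have 2: "\<nu> {x \<in> carrier P \<times> carrier P. fst x \<otimes> snd x \<in> C} = (\<Sum>x\<in>?I. \<nu> (fst x \<times> snd x))" by simp
  have "{x \<in> carrier P \<times> carrier P. fst x \<in> C} = C \<times> (\<Union>D\<in>rcosets N. D)"
    unfolding Union_rcosets[OF N] using Cc by auto
  then have "{x \<in> carrier P \<times> carrier P. fst x \<in> C} = (\<Union>D\<in>rcosets N. C \<times> D)" by blast
  moreover have "\<nu> (\<Union>D\<in>rcosets N. C \<times> D) = (\<Sum>D\<in>rcosets N. \<nu> (C \<times> D))"
  proof (rule clopen_measures_sum[OF \<nu> fin])
    fix D E assume "D \<in> rcosets N" "E \<in> rcosets N" "D \<noteq> E"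
    then show "(C \<times> D) \<inter> (C \<times> E) = {}" using rcosets_disj[OF N] by blast
  qed (rule cl[OF C])
  ultimately have 3: "\<nu> {x \<in> carrier P \<times> carrier P. fst x \<in> C} = (\<Sum>D\<in>rcosets N. \<nu> (C \<times> D))" by simp
  show ?thesis unfolding cd2_def if_P[OF conjI[OF rcosets_clopen(1,2)[OF N C]]] 1 2 3 ..
qed

text \<open>The discretization is the boundary of the 2-chain with mass \<nu>(D \<times> E) at the
  pair of representatives of \<open>D\<close> and \<open>E\<close>, except that the product of the
  two is replaced by the representative of its coset, which costs another boundary.\<close>

lemma discretize_cd2:
  assumes N: "level N" and \<nu>: "\<nu> \<in> clopen_measures (prod_topology T T)"
  shows "discretize N (cd2 P T act \<nu>) \<in> boundaries"
proof -
  note fin = levelD(5)[OF N]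
  define R where "R = rcosets N"
  define pr where "pr = (\<lambda>x. N #> (rep (fst x) \<otimes> rep (snd x)))"
  define w where "w x = \<nu> (fst x \<times> snd x)" for x
  have finR: "finite R" "finite (R \<times> R)" using fin unfolding R_def by auto
  have prR: "pr x \<in> R" if "x \<in> R \<times> R" for x
    using that rep(2)[OF N] unfolding pr_def R_def by (intro r_coset_in_rcosets) auto
  have "(\<Sum>C\<in>R. single (rep C) (cd2 P T act \<nu> C)) =
    (\<Sum>C\<in>R. \<Sum>D\<in>R. single (rep C) (act (inv (rep D)) (\<nu> (D \<times> C))))
    - (\<Sum>C\<in>R. \<Sum>x\<in>{x \<in> R \<times> R. pr x = C}. single (rep (pr x)) (w x))
    + (\<Sum>C\<in>R. \<Sum>D\<in>R. single (rep C) (\<nu> (C \<times> D)))" (is "?L = ?A - ?B + ?C")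
  proof -
    have "single (rep C) (cd2 P T act \<nu> C) = (\<Sum>D\<in>R. single (rep C) (act (inv (rep D)) (\<nu> (D \<times> C))))
      - (\<Sum>x\<in>{x \<in> R \<times> R. pr x = C}. single (rep (pr x)) (w x)) + (\<Sum>D\<in>R. single (rep C) (\<nu> (C \<times> D)))"
      if C: "C \<in> R" for C
    proof -
      have "(\<Sum>x\<in>{x \<in> R \<times> R. pr x = C}. single (rep (pr x)) (w x)) = (\<Sum>x\<in>{x \<in> R \<times> R. pr x = C}. single (rep C) (w x))"
        by (intro sum.cong) auto
      then show ?thesis
        using cd2_coset[OF N \<nu> C[unfolded R_def]] unfolding R_def pr_def w_def
        by (simp add: single_add single_diff single_sum)
    qed
    then show ?thesis by (simp add: sum.distrib sum_subtractf)
  qed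
  also have "?A = (\<Sum>x\<in>R \<times> R. single (rep (snd x)) (act (inv (rep (fst x))) (w x)))"
    by (subst sum.swap) (simp add: sum.cartesian_product case_prod_beta w_def)
  also have "?B = (\<Sum>x\<in>R \<times> R. single (rep (pr x)) (w x))"
    using prR by (intro sum.group finR) auto
  also have "?C = (\<Sum>x\<in>R \<times> R. single (rep (fst x)) (w x))"
    by (simp add: sum.cartesian_product case_prod_beta w_def)
  also have "(\<Sum>x\<in>R \<times> R. single (rep (snd x)) (act (inv (rep (fst x))) (w x))) - (\<Sum>x\<in>R \<times> R. single (rep (pr x)) (w x))
      + (\<Sum>x\<in>R \<times> R. single (rep (fst x)) (w x))
    = (\<Sum>x\<in>R \<times> R. bar2 (rep (fst x), rep (snd x)) (w x)
      + (single (rep (fst x) \<otimes> rep (snd x)) (w x) - single (rep (pr x)) (w x)))"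
    unfolding bar2_def by (simp add: sum.distrib sum_subtractf)
  also have "\<dots> \<in> boundaries"
  proof (rule add_subgroup_sum[OF boundaries_add_subgroup], rule boundariesD(4))
    fix x assume x: "x \<in> R \<times> R"
    then have c: "rep (fst x) \<in> carrier P" "rep (snd x) \<in> carrier P" using rep(2)[OF N] unfolding R_def by auto
    show "bar2 (rep (fst x), rep (snd x)) (w x) \<in> boundaries" by (rule bar2_in_boundaries[OF c])
    have pr: "pr x \<in> rcosets N" using prR[OF x] unfolding R_def .
    have "rep (fst x) \<otimes> rep (snd x) \<in> pr x"
      unfolding pr_def by (rule rcos_self[OF m_closed[OF c] levelD(3)[OF N]])
    then show "single (rep (fst x) \<otimes> rep (snd x)) (w x) - single (rep (pr x)) (w x) \<in> boundaries"
      using single_coset_diff[OF N pr] rep(1)[OF N pr] by blast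
  qed
  finally show ?thesis unfolding discretize_def R_def .
qed

text \<open>Each clopen set is invariant under its translation stabilizer, an open normal subgroup;
  finitely many of these are intersected with \<open>V\<close>.\<close>

lemma common_level:
  assumes "finite \<B>" "\<And>B. B \<in> \<B> \<Longrightarrow> openin T B \<and> closedin T B"
  shows "\<exists>N. level N \<and> (\<forall>B\<in>\<B>. \<forall>v\<in>N. \<forall>x\<in>B. v \<otimes> x \<in> B)"
  using assms
proof (induction \<B> rule: finite_induct)
  case empty
  then show ?case using level_V by blast
next
  case (insert B \<B>)
  then obtain N where N: "level N" "\<forall>B\<in>\<B>. \<forall>v\<in>N. \<forall>x\<in>B. v \<otimes> x \<in> B" by auto
  have B: "openin T B" "closedin T B" "B \<subseteq> carrier P"
    using insert.prems[of B] openin_subset topspace_eq by auto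
  let ?M = "N \<inter> translation_stabilizer P B"
  have "level ?M"
    using levelD[OF N(1)] openin_translation_stabilizer[OF B(1,2)] translation_stabilizer_normal[of B]
      normal_subgroup_intersect[of N "translation_stabilizer P B"]
    unfolding level_def by auto
  moreover have "v \<otimes> x \<in> B" if v: "v \<in> translation_stabilizer P B" and x: "x \<in> B" for v x
  proof -
    have xc: "x \<in> carrier P" and vc: "v \<in> carrier P" using x v B(3) unfolding translation_stabilizer_def by blast+
    have "\<one> \<otimes> x \<in> B \<longleftrightarrow> \<one> \<otimes> v \<otimes> x \<in> B"
      using v xc unfolding translation_stabilizer_def by blast
    then show ?thesis using x xc vc by simp
  qed
  ultimately show ?case using N(2) by (intro exI[of _ ?M]) auto
qed

text \<open>For each clopen \<open>B\<close> the measures solving the boundary equation at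
  \<open>B\<close> form a closed subset \<open>K B\<close> of a compact space, so solving finitely
  many equations at once suffices. Unless \<mu> is a finite sum of Dirac measures no finite chain
  solves them all, hence the passage to a limit.\<close>

lemma measure_diff_dirac1_boundary:
  assumes \<mu>: "\<mu> \<in> clopen_measures T"
  shows "\<mu> - dirac1 T (discretize V \<mu>) \<in> cd2 P T act ` clopen_measures (prod_topology T T)"
proof -
  let ?X = "product_topology (\<lambda>_::('a \<times> 'a) set. discrete_topology (UNIV::'m set)) UNIV"
  let ?M = "clopen_measures (prod_topology T T) :: (('a \<times> 'a) set \<Rightarrow> 'm) set"
  define \<mu>' where "\<mu>' = \<mu> - dirac1 T (discretize V \<mu>)"
  define Cl where "Cl = {B. openin T B \<and> closedin T B}"
  define K where "K B = ?M \<inter> {\<nu>. cd2 P T act \<nu> B = \<mu>' B}" for B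
  have finsupp: "finite {x. discretize N \<mu> x \<noteq> 0}" if "level N" for N
    using discretize_chains1[OF that, of \<mu>] unfolding chains1_def by blast
  have cmp: "compact_space ?X" by (simp add: compact_space_product_topology compact_space_discrete_topology)
  have "closedin ?X (K B)" for B
    unfolding K_def by (intro closedin_Int closedin_clopen_measures closedin_cd2)
  then have 1: "\<forall>C\<in>K ` Cl. closedin ?X C" by blast
  have 2: "\<Inter>\<F> \<noteq> {}" if \<F>: "finite \<F>" "\<F> \<subseteq> K ` Cl" for \<F>
  proof -
    obtain \<B> where \<B>: "finite \<B>" "\<B> \<subseteq> Cl" "\<F> = K ` \<B>" using \<F> by (meson finite_subset_image)
    have "\<exists>N. level N \<and> (\<forall>B\<in>\<B>. \<forall>v\<in>N. \<forall>x\<in>B. v \<otimes> x \<in> B)"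
      using \<B>(2) unfolding Cl_def by (intro common_level[OF \<B>(1)]) blast
    then obtain N where N: "level N" "\<And>B v x. B \<in> \<B> \<Longrightarrow> v \<in> N \<Longrightarrow> x \<in> B \<Longrightarrow> v \<otimes> x \<in> B"
      by blast
    \<comment> \<open>On the chosen clopen sets \<mu> agrees with the Dirac measure of its
      discretization at level \<open>N\<close>; passing to level \<open>V\<close> costs the boundary
      of \<open>e\<close>, so the Dirac measure of \<open>e\<close> solves these equations.\<close>
    obtain e where e: "e \<in> chains2 P" "discretize N \<mu> - discretize V \<mu> = hd2 P act e"
      using discretize_refine[OF level_V N(1) levelD(4)[OF N(1)] \<mu>] by blast
    let ?\<nu> = "dirac1 (prod_topology T T) e"
    have "?\<nu> \<in> ?M" using e(1) unfolding chains2_def by (intro dirac1_measure) blast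
    moreover have "cd2 P T act ?\<nu> B = \<mu>' B" if B: "B \<in> \<B>" for B
    proof -
      have "cd2 P T act ?\<nu> = dirac1 T (discretize N \<mu>) - dirac1 T (discretize V \<mu>)"
        using dirac1_hd2[OF e(1)] e(2)[symmetric] dirac1_diff[OF finsupp[OF N(1)] finsupp[OF level_V]] by simp
      moreover have "dirac1 T (discretize N \<mu>) B = \<mu> B"
        using B \<B>(2) N(2)[OF B] unfolding Cl_def by (intro dirac1_discretize[OF N(1) \<mu>]) auto
      ultimately show ?thesis unfolding \<mu>'_def by simp
    qed
    ultimately have "?\<nu> \<in> \<Inter>\<F>" unfolding \<B>(3) K_def by blast
    then show ?thesis by blast
  qed
  have "\<Inter>(K ` Cl) \<noteq> {}" using cmp[unfolded compact_space_fip] 1 2 by simp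
  then obtain \<nu> where \<nu>: "\<And>B. B \<in> Cl \<Longrightarrow> \<nu> \<in> K B" by blast
  \<comment> \<open>That \<nu> is a measure is read off from some \<open>K B\<close>; the empty set
    provides one.\<close>
  have "{} \<in> Cl" unfolding Cl_def by simp
  then have M: "\<nu> \<in> ?M" using \<nu> unfolding K_def by blast
  have "cd2 P T act \<nu> B = \<mu>' B" for B
  proof (cases "B \<in> Cl")
    case True
    then show ?thesis using \<nu> unfolding K_def by blast
  next
    case False
    \<comment> \<open>Off the clopen sets all the functions involved are 0 by convention.\<close>
    then have "\<mu> B = 0" using \<mu> unfolding Cl_def clopen_measures_def by blast
    then show ?thesis using False unfolding Cl_def \<mu>'_def cd2_def by (auto simp: dirac1_def)
  qed
  then have "\<mu>' = cd2 P T act \<nu>" by (simp add: fun_eq_iff)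
  then show ?thesis using M unfolding \<mu>'_def by blast
qed

text \<open>Discretization at level \<open>V\<close> inverts the Dirac map:
  \<open>discretize_dirac1\<close> with \<open>discretize_cd2\<close> gives injectivity,
  \<open>hd1_discretize\<close> with \<open>measure_diff_dirac1_boundary\<close>
  surjectivity.\<close>

lemma phi_low1_bij: "bij_betw (phi_low1 P T act) (H1_hom_d P act) (H1_hom_c P T act)"
proof -
  let ?A = boundaries and ?B = "cd2 P T act ` clopen_measures (prod_topology T T)"
  have cls_d: "hom_class_d P act z = (\<lambda>a. z + a) ` ?A" for z
    unfolding hom_class_d_def plus_fun_def by auto
  have cls_c: "hom_class_c P T act z = (\<lambda>b. z + b) ` ?B" for z
    unfolding hom_class_c_def plus_fun_def by auto
  let ?Z = "{c \<in> chains1 P. hd1 P act c = 0}" and ?Y = "{\<mu> \<in> clopen_measures T. cd1 P act \<mu> = 0}"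
  have "bij_betw (\<lambda>C. (\<lambda>b. dirac1 T (SOME c. c \<in> C) + b) ` ?B)
    ((\<lambda>z. (\<lambda>a. z + a) ` ?A) ` ?Z) ((\<lambda>y. (\<lambda>b. y + b) ` ?B) ` ?Y)"
  proof (rule bij_betw_add_cosets[OF boundaries_add_subgroup continuous_boundaries_add_subgroup])
    fix z assume "z \<in> ?Z"
    then show "dirac1 T z \<in> ?Y" using cd1_dirac1[of z] dirac1_measure[of z T] unfolding chains1_def by simp
  next
    fix z a assume z: "z \<in> ?Z" and a: "a \<in> ?A"
    obtain e where e: "e \<in> chains2 P" "a = hd2 P act e" using a by blast
    have finz: "finite {x. z x \<noteq> 0}" using z unfolding chains1_def by blast
    have "finite {x. e x \<noteq> 0}" using e(1) unfolding chains2_def by blast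
    moreover have "{x. a x \<noteq> 0} \<subseteq> snd ` {x. e x \<noteq> 0} \<union> (\<lambda>x. fst x \<otimes> snd x) ` {x. e x \<noteq> 0} \<union> fst ` {x. e x \<noteq> 0}"
      unfolding e(2) using hd2_support[OF e(1)] by blast
    ultimately have "finite {x. a x \<noteq> 0}" by (meson finite_Un finite_imageI finite_subset)
    moreover have "{x. (z + a) x \<noteq> 0} \<subseteq> {x. z x \<noteq> 0} \<union> {x. a x \<noteq> 0}" by auto
    ultimately have "finite {x. (z + a) x \<noteq> 0}" using finz by (auto intro: finite_subset)
    then have "dirac1 T (z + a) - dirac1 T z = dirac1 T (z + a - z)" using dirac1_diff[of "z + a" z T] finz by simp
    also have "z + a - z = a" by (rule add_diff_cancel_left')
    also have "dirac1 T a = cd2 P T act (dirac1 (prod_topology T T) e)" unfolding e(2) by (rule dirac1_hd2[OF e(1)])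
    also have "\<dots> \<in> ?B" using e(1) unfolding chains2_def by (intro imageI dirac1_measure) blast
    finally show "dirac1 T (z + a) - dirac1 T z \<in> ?B" .
  next
    fix z z' assume z: "z \<in> ?Z" "z' \<in> ?Z" and "dirac1 T z - dirac1 T z' \<in> ?B"
    then obtain \<nu> where \<nu>: "\<nu> \<in> clopen_measures (prod_topology T T)" "dirac1 T z - dirac1 T z' = cd2 P T act \<nu>" by blast
    have fin: "finite {x. z x \<noteq> 0}" "finite {x. z' x \<noteq> 0}" using z unfolding chains1_def by auto
    have "{x. (z - z') x \<noteq> 0} \<subseteq> {x. z x \<noteq> 0} \<union> {x. z' x \<noteq> 0}" by auto
    then have ch: "z - z' \<in> chains1 P" using z unfolding chains1_def by (auto intro: finite_subset)
    have "dirac1 T (z - z') = cd2 P T act \<nu>" using dirac1_diff[OF fin] \<nu>(2) by simp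
    then have "discretize V (dirac1 T (z - z')) \<in> boundaries" using discretize_cd2[OF level_V \<nu>(1)] by simp
    then have "(z - z' - discretize V (dirac1 T (z - z'))) + discretize V (dirac1 T (z - z')) \<in> boundaries"
      using discretize_dirac1[OF level_V ch] boundariesD(4) by blast
    then show "z - z' \<in> boundaries" by simp
  next
    fix \<mu> assume \<mu>: "\<mu> \<in> ?Y"
    then have "hd1 P act (discretize V \<mu>) = 0" using hd1_discretize[OF level_V, of \<mu>] by simp
    then have "discretize V \<mu> \<in> ?Z" using discretize_chains1[OF level_V] by simp
    moreover have "\<mu> - dirac1 T (discretize V \<mu>) \<in> ?B" using measure_diff_dirac1_boundary \<mu> by blast
    ultimately show "\<exists>z\<in>?Z. \<mu> - dirac1 T z \<in> ?B" by blast
  qed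
  then show ?thesis unfolding phi_low1_def[abs_def] H1_hom_d_def H1_hom_c_def cls_d cls_c .
qed

end

theorem theorem2p7:
  fixes p :: nat and P :: "'a monoid" and T :: "'a topology"
    and act :: "'a \<Rightarrow> 'm::{finite,ab_group_add} \<Rightarrow> 'm"
  assumes "pro_p_group p P T"
    and "topologically_finitely_generated P T"
    and "finite_G_module P T act"
  shows "bij_betw (phi_up1 P act) (H1_c P T act) (H1_d P act)
       \<and> bij_betw (phi_low1 P T act) (H1_hom_d P act) (H1_hom_c P T act)"
proof -
  have "profinite_group P T" using assms(1) by (simp add: pro_p_group_def)
  then interpret compact_group P T by (rule profinite_compact_group)
  interpret compact_module P T act by unfold_locales (rule assms(3))
  obtain V where V: "openin T V" "V \<lhd> P" "V \<subseteq> act_kernel"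
    and min: "\<And>K. subgroup K P \<Longrightarrow> \<forall>u\<in>act_kernel. u [^]\<^bsub>P\<^esub> CARD('m) \<in> K \<Longrightarrow>
      \<forall>u\<in>act_kernel. \<forall>w\<in>act_kernel. commutator P u w \<in> K \<Longrightarrow> V \<subseteq> K"
    using pro_p_open_power_comm[OF assms(1,2) openin_act_kernel act_kernel_normal zero_less_card_finite[where 'a = 'm]]
    by blast
  interpret compact_module_trivial P T act V
  proof (intro compact_module_trivial.intro compact_module_trivial_axioms.intro compact_module_axioms V)
    show "single v m \<in> boundaries" if "v \<in> V" for v m
      by (rule single_kernel_in_boundaries[OF V(3) _ that]) (rule min)
  qed
  have "continuous_map T (discrete_topology UNIV) f" if "f \<in> cocycles1_d P act" for f
    by (rule cocycle_continuous[OF that V]) (rule min)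
  then show ?thesis using phi_up1_bij phi_low1_bij by blast
qed

end
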